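(* Let $\Omega\subset\mathbb{R}^2$ be a domain, and let $a_{11},a_{12},a_{22},b_1,b_2$ be bounded, measurable real functions on $\Omega$ (no continuity is assumed) satisfying, for some constants $0<\lambda_1\le\lambda_2$, $$\lambda_1|\xi|^2\le a_{11}\xi_1^2+2a_{12}\xi_1\xi_2+a_{22}\xi_2^2\le\lambda_2|\xi|^2\qquad\text{for all }\xi=(\xi_1,\xi_2)\in\mathbb{R}^2$$ on $\Omega$. Let $u\in C^\infty(\Omega)$ be a non-constant real solution in $\Omega$ of $$a_{11}u_{xx}+2a_{12}u_{xy}+a_{22}u_{yy}+b_1u_x+b_2u_y=0,$$ with $\nabla u(p_0)=(0,0)$ at some $p_0\in\Omega$. Then there exists a punctured disk $\mathcal{D}^*\subset\Omega$ centered at $p_0$ such that: 1. $\det(D^2u)<0$ in $\mathcal{D}^*$. 2. The (common) index of the gradient vector fields $\nabla u_x$ and $\nabla u_y$ around $p_0$ is non-positive.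
   Context: $D^2u$ is the Hessian matrix of $u$. The index around $p_0$ of a continuous vector field with no zeros in a punctured disk centered at $p_0$ is its winding number along a sufficiently small positively oriented circle centered at $p_0$ (so it is $0$ if the field extends continuously to $p_0$ with a nonzero value). Item 1 implies that $\nabla u_x,\nabla u_y$ are linearly independent on $\mathcal{D}^*$, so these two indices are defined and coincide. *)

theory Defs
  imports "HOL-Complex_Analysis.Complex_Analysis"
begin

definition partial :: "'n::finite \<Rightarrow> (real^'n \<Rightarrow> real) \<Rightarrow> real^'n \<Rightarrow> real" where
  "partial i f x = frechet_derivative f (at x) (axis i 1)"

definition grad :: "(real^'n::finite \<Rightarrow> real) \<Rightarrow> real^'n \<Rightarrow> real^'n" where
  "grad f x = (\<chi> i. partial i f x)"

definition hessian :: "(real^'n::finite \<Rightarrow> real) \<Rightarrow> real^'n \<Rightarrow> real^'n^'n" where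
  "hessian f x = (\<chi> i j. partial i (partial j f) x)"

text \<open>Meant for open \<open>S\<close>: differentiability is required at the points of \<open>S\<close>
  in the full space, not relative to \<open>S\<close>.\<close>

primrec Ck_on :: "nat \<Rightarrow> (real^'n::finite \<Rightarrow> real) \<Rightarrow> (real^'n) set \<Rightarrow> bool" where
  "Ck_on 0 f S \<longleftrightarrow> continuous_on S f"
| "Ck_on (Suc k) f S \<longleftrightarrow> (\<forall>x\<in>S. f differentiable (at x)) \<and> (\<forall>i. Ck_on k (partial i f) S)"

definition smooth_on :: "(real^'n::finite \<Rightarrow> real) \<Rightarrow> (real^'n) set \<Rightarrow> bool" where
  "smooth_on f S \<longleftrightarrow> (\<forall>k. Ck_on k f S)"

definition complex_of_vec :: "real^2 \<Rightarrow> complex" where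
  "complex_of_vec v = Complex (v $ 1) (v $ 2)"

definition vec_of_complex :: "complex \<Rightarrow> real^2" where
  "vec_of_complex z = vector [Re z, Im z]"

text \<open>The image under \<open>F\<close> of the positively oriented circle of radius \<open>r\<close> around \<open>p\<close>,
  as a curve in the complex plane, where the library's winding number is defined.\<close>

definition field_circle :: "(real^2 \<Rightarrow> real^2) \<Rightarrow> real^2 \<Rightarrow> real \<Rightarrow> real \<Rightarrow> complex" where
  "field_circle F p r = complex_of_vec \<circ> F \<circ> vec_of_complex \<circ> circlepath (complex_of_vec p) r"

text \<open>A relation rather than a function, so that it also asserts that the index is defined:
  \<open>F\<close> is continuous and has no zeros in a punctured disk around \<open>p\<close>. Nothing is said
  about \<open>F p\<close> itself.\<close>

definition has_index :: "(real^2 \<Rightarrow> real^2) \<Rightarrow> real^2 \<Rightarrow> int \<Rightarrow> bool" where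
  "has_index F p k \<longleftrightarrow>
     (\<exists>R>0. continuous_on (ball p R - {p}) F \<and> (\<forall>x\<in>ball p R - {p}. F x \<noteq> 0) \<and>
        (\<forall>r. 0 < r \<and> r < R \<longrightarrow> winding_number (field_circle F p r) 0 = of_int k))"

end

theory Submission
  imports Defs
begin

text \<open>
  Write \<open>w = (u\<^sub>x, u\<^sub>y)\<close>. Multiplying the equation by \<open>u\<^sub>x\<^sub>x\<close> and by \<open>u\<^sub>y\<^sub>y\<close> and adding turns ellipticity
  into the quasiregularity inequality \<open>|Dw|\<^sup>2 \<le> - K det Dw + C |w|\<^sup>2\<close>, which is all that is used
  about the coefficients.

  If \<open>w\<close> is not identically zero near \<open>p\<^sub>0\<close>, then it vanishes there only to finite order. Instead of
  the similarity principle this uses the closed-form identity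
  \<open>d(h(|w|\<^sup>2) (p dq - q dp)) = 2 (h + s h')(|w|\<^sup>2) dp dq\<close>, with \<open>s = |w|\<^sup>2\<close>, in polar coordinates. With
  \<open>h\<close> close to \<open>1 / (s ln (1/s))\<close> it bounds the energy of \<open>ln ln (1/s)\<close>, so that some circle around
  \<open>p\<^sub>0\<close> contains no zero of \<open>w\<close>. With \<open>h\<close> close to \<open>ln (s/e) / s\<close> it then bounds, inside such a circle,
  the energy of \<open>ln (s + e)\<close> by a multiple of \<open>ln (1/e)\<close>, whereas vanishing to infinite order would
  force it to be larger than any such multiple as \<open>e\<close> tends to \<open>0\<close>. Hence the points near which
  \<open>w\<close> vanishes form a clopen set, which is empty because \<open>u\<close> is not constant.

  Let \<open>m\<close> be the order of vanishing, so that \<open>Dw v\<close> is \<open>m w\<close> up to \<open>O(|v|\<^sup>m\<^sup>+\<^sup>1)\<close> at \<open>p\<^sub>0 + v\<close>. Along a circle,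
  quasiregularity and this relation give \<open>|w'| \<le> L (|w| + |v|\<^sup>m\<^sup>+\<^sup>1)\<close>, so by Gronwall \<open>|w|\<close> is at least
  \<open>c |v|\<^sup>m\<close> in all directions because it is in one; hence \<open>det Dw < 0\<close>. Moreover \<open>w\<close> turns strictly clockwise
  along small circles, since \<open>m w \<times> w'\<close> is nearly \<open>det Dw |v|\<^sup>2\<close>, so its index is at most \<open>-1\<close>.
  Finally, a symmetric matrix with negative determinant acts on \<open>\<zeta>\<close> as \<open>\<alpha> \<zeta> + \<beta> cnj \<zeta>\<close> with
  \<open>|\<alpha>| < |\<beta>|\<close>, so both gradient fields have the index of \<open>\<beta>\<close>, which is one more than that of \<open>w\<close>.
\<close>

section \<open>Real analysis preliminaries\<close>

lemma continuous_on_slice: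
  assumes "continuous_on (U \<times> V) (\<lambda>x. f (fst x) (snd x))" "t \<in> U"
  shows "continuous_on V (f t)"
proof -
  have "continuous_on V (\<lambda>a. f (fst (t, a)) (snd (t, a)))"
    by (rule continuous_on_compose2[OF assms(1), of V "\<lambda>a. (t, a)"])
      (use assms(2) in \<open>auto intro!: continuous_intros\<close>)
  then show ?thesis by simp
qed

lemma deriv_nonneg_imp_mono_within:
  fixes f f' :: "real \<Rightarrow> real"
  assumes "\<And>z. a \<le> z \<Longrightarrow> z \<le> b \<Longrightarrow> (f has_real_derivative f' z) (at z within {a..b})"
    and "\<And>z. a < z \<Longrightarrow> z < b \<Longrightarrow> 0 \<le> f' z"
    and "a \<le> x" "x \<le> y" "y \<le> b"
  shows "f x \<le> f y"
proof (rule DERIV_nonneg_imp_increasing_open[OF \<open>x \<le> y\<close>])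
  show "\<exists>d. (f has_real_derivative d) (at z) \<and> 0 \<le> d" if "x < z" "z < y" for z
  proof -
    have "at z within {a..b} = at z"
      using that assms by (intro at_within_interior) auto
    then show ?thesis using assms(1)[of z] assms(2)[of z] that assms by auto
  qed
  have "continuous_on {a..b} f"
    using assms(1) by (intro DERIV_continuous_on) auto
  then show "continuous_on {x..y} f"
    by (rule continuous_on_subset) (use assms in auto)
qed

text \<open>With \<open>I\<close> the primitive of \<open>G\<close>, both \<open>I + w\<close> and
  \<open>I - w\<close> are nondecreasing. As \<open>x\<close> and \<open>y\<close> may come in
  either order, this bounds the oscillation of \<open>w\<close> on the interval.\<close>

lemma diff_le_integral_of_deriv_bound:
  fixes w w' G :: "real \<Rightarrow> real"
  assumes G: "continuous_on {a..b} G"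
    and w: "\<And>z. a \<le> z \<Longrightarrow> z \<le> b \<Longrightarrow> (w has_real_derivative w' z) (at z within {a..b})"
    and wG: "\<And>z. a \<le> z \<Longrightarrow> z \<le> b \<Longrightarrow> \<bar>w' z\<bar> \<le> G z"
    and x: "x \<in> {a..b}" and y: "y \<in> {a..b}"
  shows "w y - w x \<le> integral {a..b} G"
proof -
  define I where "I = (\<lambda>x. integral {a..x} G)"
  have I: "(I has_real_derivative G z) (at z within {a..b})" if "a \<le> z" "z \<le> b" for z
    unfolding I_def using integral_has_real_derivative[OF G] that by auto
  have ww: "\<bar>w' z\<bar> \<le> G z" if "a < z" "z < b" for z using wG that by auto
  have p: "I s + w s \<le> I t + w t" if "a \<le> s" "s \<le> t" "t \<le> b" for s t
    by (rule deriv_nonneg_imp_mono_within[of a b _ "\<lambda>z. G z + w' z"])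
      (use that ww in \<open>fastforce intro: DERIV_add I w\<close>)+
  have m: "I s - w s \<le> I t - w t" if "a \<le> s" "s \<le> t" "t \<le> b" for s t
    by (rule deriv_nonneg_imp_mono_within[of a b _ "\<lambda>z. G z - w' z"])
      (use that ww in \<open>fastforce intro: DERIV_diff I w\<close>)+
  have i: "I s \<le> I t" if "a \<le> s" "s \<le> t" "t \<le> b" for s t
    using p[OF that] m[OF that] by linarith
  have "I a = 0" "I b = integral {a..b} G" by (auto simp: I_def)
  moreover have "I a \<le> I x" "I a \<le> I y" "I x \<le> I b" "I y \<le> I b"
    using x y i by auto
  ultimately show ?thesis
    using p[of y x] m[of x y] x y by (cases "x \<le> y") auto
qed

text \<open>Since \<open>f' / f\<^sup>2\<close> is at least \<open>1 / c\<close>, the function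
  \<open>- 1 / f - z / c\<close> is nondecreasing; as \<open>1 / f b\<close> is still positive, the
  interval is shorter than \<open>c / f a\<close>.\<close>

lemma riccati_blowup:
  fixes f f' :: "real \<Rightarrow> real"
  assumes f: "\<And>z. a \<le> z \<Longrightarrow> z \<le> b \<Longrightarrow> (f has_real_derivative f' z) (at z within {a..b})"
    and ab: "a \<le> b" and c: "0 < c" and fa: "0 < f a" and mono: "\<And>z. a \<le> z \<Longrightarrow> z \<le> b \<Longrightarrow> 0 \<le> f' z"
    and quad: "\<And>z. a \<le> z \<Longrightarrow> z \<le> b \<Longrightarrow> (f z)\<^sup>2 \<le> c * f' z"
  shows "f a * (b - a) < c"
proof -
  have pos: "0 < f z" if "a \<le> z" "z \<le> b" for z
    using deriv_nonneg_imp_mono_within[of a b f f' a z] f mono that fa by force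
  have "- inverse (f a) - a / c \<le> - inverse (f b) - b / c"
  proof (rule deriv_nonneg_imp_mono_within[of a b "\<lambda>z. - inverse (f z) - z / c" "\<lambda>z. f' z / (f z)\<^sup>2 - 1 / c"])
    fix z assume z: "a \<le> z" "z \<le> b"
    show "((\<lambda>z. - inverse (f z) - z / c) has_real_derivative f' z / (f z)\<^sup>2 - 1 / c) (at z within {a..b})"
      using pos[OF z] c
      by (auto intro!: derivative_eq_intros f z simp: power2_eq_square field_simps)
  next
    fix z assume z: "a < z" "z < b"
    then show "0 \<le> f' z / (f z)\<^sup>2 - 1 / c"
      using quad[of z] pos[of z] c by (simp add: field_simps)
  qed (use ab in auto)
  moreover have "0 < inverse (f b)"
    using pos[of b] ab by simp
  ultimately have "(b - a) / c < inverse (f a)"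
    unfolding diff_divide_distrib by linarith
  then show ?thesis
    using fa c by (simp add: field_simps)
qed

lemma ln_le_neg_one:
  fixes x :: real
  assumes "0 < x" "x \<le> 1/4"
  shows "ln x \<le> -1"
proof -
  have "x * exp 1 \<le> (1/4) * 3"
    using assms exp_le by (intro mult_mono) auto
  then have "x \<le> exp (-1)"
    by (simp add: exp_minus field_simps)
  then show ?thesis
    using assms by (metis ln_exp ln_mono)
qed

lemma integral_affine:
  fixes F :: "real \<Rightarrow> real"
  assumes "F integrable_on {a..b}" "a \<le> b"
  shows "integral {a..b} (\<lambda>x. c * F x + k) = c * integral {a..b} F + (b - a) * k"
  using assms by (subst integral_add) (auto intro: integrable_on_mult_right)

lemma mult_le_sum_squares:
  fixes x y k :: real
  shows "k * (x * y) \<le> x\<^sup>2 / 2 + k\<^sup>2 * y\<^sup>2 / 2"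
  using zero_le_power2[of "x - k * y"] by (simp add: power2_eq_square algebra_simps)

lemma square_add_le:
  fixes x y :: real
  shows "(x + y)\<^sup>2 \<le> 2 * x\<^sup>2 + 2 * y\<^sup>2"
  using zero_le_power2[of "x - y"] by (simp add: power2_eq_square algebra_simps)

section \<open>Quasiregular pairs in polar coordinates\<close>

text \<open>\<open>P\<close> and \<open>Q\<close> are the components of a plane field in polar coordinates \<open>(t, a)\<close>; the suffixes
  denote partial derivatives. Multiplied by \<open>t\<^sup>2\<close>, the inequality \<open>|Dw|\<^sup>2 \<le> - K det Dw + C |w|\<^sup>2\<close> becomes
  \<open>quasi\<close>. The bound \<open>1/8\<close> only serves to keep \<open>ln (S + e)\<close> below \<open>-1\<close> for \<open>e \<le> 1/8\<close>.\<close>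

locale polar_pair =
  fixes P Q Pt Qt Pa Qa Pta Qta :: "real \<Rightarrow> real \<Rightarrow> real" and R K C :: real
  assumes R: "0 < R" and K: "0 < K" and C: "0 \<le> C"
    and deriv_t: "\<And>t a. 0 \<le> t \<Longrightarrow> t \<le> R \<Longrightarrow> ((\<lambda>t. P t a) has_real_derivative Pt t a) (at t)"
      "\<And>t a. 0 \<le> t \<Longrightarrow> t \<le> R \<Longrightarrow> ((\<lambda>t. Q t a) has_real_derivative Qt t a) (at t)"
    and deriv_a: "\<And>t a. 0 \<le> t \<Longrightarrow> t \<le> R \<Longrightarrow> ((\<lambda>a. P t a) has_real_derivative Pa t a) (at a)"
      "\<And>t a. 0 \<le> t \<Longrightarrow> t \<le> R \<Longrightarrow> ((\<lambda>a. Q t a) has_real_derivative Qa t a) (at a)"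
    and deriv_ta: "\<And>t a. 0 \<le> t \<Longrightarrow> t \<le> R \<Longrightarrow> ((\<lambda>a. Pt t a) has_real_derivative Pta t a) (at a)"
      "\<And>t a. 0 \<le> t \<Longrightarrow> t \<le> R \<Longrightarrow> ((\<lambda>a. Qt t a) has_real_derivative Qta t a) (at a)"
    and deriv_at: "\<And>t a. 0 \<le> t \<Longrightarrow> t \<le> R \<Longrightarrow> ((\<lambda>t. Pa t a) has_real_derivative Pta t a) (at t)"
      "\<And>t a. 0 \<le> t \<Longrightarrow> t \<le> R \<Longrightarrow> ((\<lambda>t. Qa t a) has_real_derivative Qta t a) (at t)"
    and cont: "\<And>F. F \<in> {P, Q, Pt, Qt, Pa, Qa, Pta, Qta} \<Longrightarrow>
      continuous_on ({0..R} \<times> {0..2*pi}) (\<lambda>x. F (fst x) (snd x))"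
    and periodic: "\<And>F t. F \<in> {P, Q, Pt, Qt} \<Longrightarrow> F t (2*pi) = F t 0"
    and centre: "\<And>a. Pa 0 a = 0" "\<And>a. Qa 0 a = 0"
    and small: "\<And>t a. 0 \<le> t \<Longrightarrow> t \<le> R \<Longrightarrow> (P t a)\<^sup>2 + (Q t a)\<^sup>2 \<le> 1/8"
    and quasi: "\<And>t a. 0 < t \<Longrightarrow> t \<le> R \<Longrightarrow>
      t\<^sup>2 * ((Pt t a)\<^sup>2 + (Qt t a)\<^sup>2) + ((Pa t a)\<^sup>2 + (Qa t a)\<^sup>2)
      \<le> K * t * (Pa t a * Qt t a - Pt t a * Qa t a) + C * t\<^sup>2 * ((P t a)\<^sup>2 + (Q t a)\<^sup>2)"
begin

section \<open>Circle integrals and the energies they control\<close>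

definition S :: "real \<Rightarrow> real \<Rightarrow> real" where
  "S t a = (P t a)\<^sup>2 + (Q t a)\<^sup>2"

text \<open>The energy density \<open>|Dw|\<^sup>2\<close> times the Jacobian \<open>t\<close> of polar coordinates.\<close>

definition E :: "real \<Rightarrow> real \<Rightarrow> real" where
  "E t a = t * ((Pt t a)\<^sup>2 + (Qt t a)\<^sup>2) + ((Pa t a)\<^sup>2 + (Qa t a)\<^sup>2) / t"

text \<open>The integral of \<open>h(|w|\<^sup>2) (q dp - p dq)\<close> over the circle of radius
  \<open>t\<close>. With this sign it is nondecreasing in \<open>t\<close> when
  \<open>det Dw \<le> 0\<close> and \<open>h + s h' \<ge> 0\<close>.\<close>

definition ang :: "(real \<Rightarrow> real) \<Rightarrow> real \<Rightarrow> real" where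
  "ang h t = integral {0..2*pi} (\<lambda>a. h (S t a) * (Q t a * Pa t a - P t a * Qa t a))"

text \<open>The Jacobian \<open>Pa * Qt - Pt * Qa\<close> equals \<open>- t det Dw\<close>.\<close>

definition ang' :: "(real \<Rightarrow> real) \<Rightarrow> real \<Rightarrow> real" where
  "ang' H t = integral {0..2*pi} (\<lambda>a. 2 * H (S t a) * (Pa t a * Qt t a - Pt t a * Qa t a))"

text \<open>The second summand absorbs the term \<open>C |w|\<^sup>2\<close>, so that \<open>B\<close> dominates a weighted energy of the disc of
  radius \<open>t\<close>.\<close>

definition B :: "(real \<Rightarrow> real) \<Rightarrow> real \<Rightarrow> real" where
  "B h t = K / 2 * ang h t + 2 * pi * C * t\<^sup>2"

lemma S_nonneg: "0 \<le> S t a"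
  by (simp add: S_def)

lemma S_small: "0 \<le> t \<Longrightarrow> t \<le> R \<Longrightarrow> S t a \<le> 1/8"
  unfolding S_def by (rule small)

lemmas cont' [continuous_intros] =
  cont[of P, simplified] cont[of Q, simplified] cont[of Pt, simplified] cont[of Qt, simplified]
  cont[of Pa, simplified] cont[of Qa, simplified] cont[of Pta, simplified] cont[of Qta, simplified]

lemma cont_S [continuous_intros]: "continuous_on ({0..R} \<times> {0..2*pi}) (\<lambda>x. S (fst x) (snd x))"
  unfolding S_def by (intro continuous_intros)

lemma cont_compose_S:
  assumes "continuous_on {0..1/8} h"
  shows "continuous_on ({0..R} \<times> {0..2*pi}) (\<lambda>x. h (S (fst x) (snd x)))"
  by (rule continuous_on_compose2[OF assms cont_S]) (use S_nonneg S_small in auto)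

lemma slice:
  assumes "continuous_on ({0..R} \<times> {0..2*pi}) (\<lambda>x. F (fst x) (snd x))" "0 \<le> t" "t \<le> R"
  shows "continuous_on {0..2*pi} (F t)"
  by (rule continuous_on_slice[OF assms(1)]) (use assms in auto)

lemma cont_E:
  assumes "continuous_on {0..1/8} g" "0 < t" "t \<le> R"
  shows "continuous_on {0..2*pi} (\<lambda>a. g (S t a) * E t a)"
proof -
  note [continuous_intros] = slice[OF cont'(1)] slice[OF cont'(2)] slice[OF cont'(3)] slice[OF cont'(4)]
    slice[OF cont'(5)] slice[OF cont'(6)] slice[OF cont_compose_S[OF assms(1)]]
  show ?thesis using assms unfolding E_def
    by (intro continuous_intros) auto
qed

text \<open>Green's formula in polar coordinates: \<open>?f\<close> and \<open>?m\<close> are the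
  angular and the radial component of the form \<open>h(S) (q dp - p dq)\<close>, and
  \<open>?H\<close> is the density of its exterior derivative.\<close>

lemma ang_deriv:
  assumes h: "\<And>s. 0 \<le> s \<Longrightarrow> s \<le> 1/8 \<Longrightarrow> (h has_real_derivative h' s) (at s)"
    and h': "continuous_on {0..1/8} h'"
    and t: "0 \<le> t" "t \<le> R"
  shows "(ang h has_real_derivative ang' (\<lambda>s. h s + s * h' s) t) (at t within {0..R})"
proof -
  let ?f = "\<lambda>t a. h (S t a) * (Q t a * Pa t a - P t a * Qa t a)"
  let ?dS = "\<lambda>t a. 2 * (P t a * Pt t a + Q t a * Qt t a)"
  let ?f' = "\<lambda>t a. h (S t a) * (Qt t a * Pa t a + Q t a * Pta t a - Pt t a * Qa t a - P t a * Qta t a)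
     + h' (S t a) * ?dS t a * (Q t a * Pa t a - P t a * Qa t a)"
  let ?m = "\<lambda>t a. h (S t a) * (Q t a * Pt t a - P t a * Qt t a)"
  let ?m' = "\<lambda>t a. h (S t a) * (Qa t a * Pt t a + Q t a * Pta t a - Pa t a * Qt t a - P t a * Qta t a)
     + h' (S t a) * (2 * (P t a * Pa t a + Q t a * Qa t a)) * (Q t a * Pt t a - P t a * Qt t a)"
  let ?H = "\<lambda>t a. 2 * (h (S t a) + S t a * h' (S t a)) * (Pa t a * Qt t a - Pt t a * Qa t a)"
  have hc: "continuous_on {0..1/8} h"
    by (meson h DERIV_isCont atLeastAtMost_iff continuous_at_imp_continuous_on)
  note cS = cont_compose_S[OF hc] cont_compose_S[OF h']
  have dSt: "((\<lambda>t. S t a) has_real_derivative ?dS t a) (at t)" if "0 \<le> t" "t \<le> R" for t a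
    unfolding S_def using that
    by (auto intro!: derivative_eq_intros deriv_t simp: algebra_simps)
  have dSa: "((\<lambda>a. S t a) has_real_derivative 2 * (P t a * Pa t a + Q t a * Qa t a)) (at a)"
    if "0 \<le> t" "t \<le> R" for t a
    unfolding S_def using that
    by (auto intro!: derivative_eq_intros deriv_a simp: algebra_simps)
  have hS: "((\<lambda>t. h (S t a)) has_real_derivative h' (S t a) * ?dS t a) (at t)"
    if "0 \<le> t" "t \<le> R" for t a
    using DERIV_chain2[OF h[OF S_nonneg S_small] dSt] that by blast
  have hSa: "((\<lambda>a. h (S t a)) has_real_derivative
      h' (S t a) * (2 * (P t a * Pa t a + Q t a * Qa t a))) (at a)"
    if "0 \<le> t" "t \<le> R" for t a
    using DERIV_chain2[OF h[OF S_nonneg S_small] dSa] that by blast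
  have 1: "((\<lambda>t. ?f t a) has_real_derivative ?f' t a) (at t within {0..R})"
    if "0 \<le> t" "t \<le> R" for t a
    by (rule DERIV_subset[OF DERIV_cong[OF DERIV_mult[OF hS[OF that] DERIV_diff[OF
        DERIV_mult[OF deriv_t(2)[OF that] deriv_at(1)[OF that]]
        DERIV_mult[OF deriv_t(1)[OF that] deriv_at(2)[OF that]]]]] subset_UNIV])
      (simp add: algebra_simps)
  have 2: "(?m t has_real_derivative ?m' t a) (at a within {0..2*pi})" for a
    by (rule DERIV_subset[OF DERIV_cong[OF DERIV_mult[OF hSa[OF t] DERIV_diff[OF
        DERIV_mult[OF deriv_a(2)[OF t] deriv_ta(1)[OF t]]
        DERIV_mult[OF deriv_a(1)[OF t] deriv_ta(2)[OF t]]]]] subset_UNIV])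
      (simp add: algebra_simps)
  \<comment> \<open>The mixed derivatives \<open>Pta\<close> and \<open>Qta\<close> cancel, and the
    terms with \<open>h'\<close> combine to \<open>S * h'(S)\<close>.\<close>
  have id: "?f' t a = ?m' t a + ?H t a" for a
    unfolding S_def by (simp add: algebra_simps power2_eq_square)
  have cf: "continuous_on ({0..R} \<times> {0..2*pi}) (\<lambda>x. ?f (fst x) (snd x))"
    by (intro continuous_intros cS)
  have cf': "continuous_on ({0..R} \<times> {0..2*pi}) (\<lambda>x. ?f' (fst x) (snd x))"
    by (intro continuous_intros cS)
  have cm': "continuous_on ({0..R} \<times> {0..2*pi}) (\<lambda>x. ?m' (fst x) (snd x))"
    by (intro continuous_intros cS)
  have cH: "continuous_on ({0..R} \<times> {0..2*pi}) (\<lambda>x. ?H (fst x) (snd x))"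
    by (intro continuous_intros cS)
  have "(?m' t has_integral ?m t (2*pi) - ?m t 0) {0..2*pi}"
    by (rule fundamental_theorem_of_calculus)
      (use 2 in \<open>auto simp: has_real_derivative_iff_has_vector_derivative[symmetric]\<close>)
  \<comment> \<open>This integrates an \<open>a\<close>-derivative over a full period;
    \<open>Pt\<close> and \<open>Qt\<close> have to be periodic as well because \<open>?m\<close>
    contains them.\<close>
  then have m0: "integral {0..2*pi} (?m' t) = 0"
    using periodic[of P t] periodic[of Q t] periodic[of Pt t] periodic[of Qt t]
    by (simp add: integral_unique S_def)
  have "(ang h has_real_derivative integral (cbox 0 (2*pi)) (?f' t)) (at t within {0..R})"
    unfolding ang_def[abs_def] box_real(2)[symmetric]
  proof (rule leibniz_rule_field_derivative)
    show "continuous_on (cbox 0 R \<times> cbox 0 (2 * pi)) (\<lambda>(t, a). ?f' t a)"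
      using cf' by (simp add: case_prod_beta')
    show "?f t integrable_on cbox 0 (2*pi)" if "t \<in> cbox 0 R" for t
      using slice[of ?f, OF cf] that by (auto intro: integrable_continuous_real)
  qed (use 1 t in auto)
  also have "integral (cbox 0 (2*pi)) (?f' t) = integral {0..2*pi} (?m' t) + integral {0..2*pi} (?H t)"
    unfolding id using slice[of ?m', OF cm' t] slice[of ?H, OF cH t]
    by (simp add: integral_add integrable_continuous_real)
  also have "integral {0..2*pi} (?m' t) = 0" by (rule m0)
  finally show ?thesis
    by (simp add: ang'_def)
qed

lemma B_0: "B h 0 = 0"
  by (simp add: B_def ang_def centre)

text \<open>Multiplying \<open>quasi\<close> by the nonnegative weight \<open>H = h + s h'\<close>
  and integrating over the circle bounds the weighted energy by \<open>K / 2\<close> times the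
  derivative of \<open>ang h\<close>, up to the integral of \<open>C t S H\<close>. By
  \<open>H2\<close> the latter is at most the derivative \<open>4 pi C t\<close> of the second
  summand of \<open>B\<close>. The weight \<open>g\<close> may be any simpler function below
  \<open>H\<close>.\<close>

lemma B_deriv:
  assumes h: "\<And>s. 0 \<le> s \<Longrightarrow> s \<le> 1/8 \<Longrightarrow> (h has_real_derivative h' s) (at s)"
    and h': "continuous_on {0..1/8} h'"
    and g: "continuous_on {0..1/8} g"
    and gH: "\<And>s. 0 \<le> s \<Longrightarrow> s \<le> 1/8 \<Longrightarrow> g s \<le> h s + s * h' s"
    and g0: "\<And>s. 0 \<le> s \<Longrightarrow> s \<le> 1/8 \<Longrightarrow> 0 \<le> g s"
    and H2: "\<And>s. 0 \<le> s \<Longrightarrow> s \<le> 1/8 \<Longrightarrow> s * (h s + s * h' s) \<le> 2"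
  obtains B' where "\<And>t. 0 \<le> t \<Longrightarrow> t \<le> R \<Longrightarrow> (B h has_real_derivative B' t) (at t within {0..R})"
    "\<And>t. 0 < t \<Longrightarrow> t \<le> R \<Longrightarrow> integral {0..2*pi} (\<lambda>a. g (S t a) * E t a) \<le> B' t"
proof
  let ?H = "\<lambda>s. h s + s * h' s"
  let ?B' = "\<lambda>t. K / 2 * ang' ?H t + 4 * pi * C * t"
  show "(B h has_real_derivative ?B' t) (at t within {0..R})" if "0 \<le> t" "t \<le> R" for t
    unfolding B_def[abs_def]
    by (auto intro!: derivative_eq_intros ang_deriv h h' that)
  show "integral {0..2*pi} (\<lambda>a. g (S t a) * E t a) \<le> ?B' t" if t: "0 < t" "t \<le> R" for t
  proof -
    let ?J = "\<lambda>t a. ?H (S t a) * (Pa t a * Qt t a - Pt t a * Qa t a)"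
    have hc: "continuous_on {0..1/8} h"
      by (meson h DERIV_isCont atLeastAtMost_iff continuous_at_imp_continuous_on)
    have cJ: "continuous_on {0..2*pi} (?J t)"
    proof (rule slice[of ?J])
      show "continuous_on ({0..R} \<times> {0..2*pi}) (\<lambda>x. ?J (fst x) (snd x))"
        by (intro continuous_intros cont_compose_S[OF hc] cont_compose_S[OF h'])
    qed (use t in auto)
    have "integral {0..2*pi} (\<lambda>a. g (S t a) * E t a)
        \<le> integral {0..2*pi} (\<lambda>a. K * ?J t a + 2 * C * t)"
    proof (rule integral_le)
      show "(\<lambda>a. g (S t a) * E t a) integrable_on {0..2*pi}"
        by (intro integrable_continuous_real cont_E g t)
      show "(\<lambda>a. K * ?J t a + 2 * C * t) integrable_on {0..2*pi}"
        by (intro integrable_continuous_real continuous_intros cJ)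
      fix a
      have s: "0 \<le> S t a" "S t a \<le> 1/8"
        using S_nonneg S_small t by auto
      have E0: "0 \<le> E t a"
        using t by (simp add: E_def)
      have "t * E t a = t\<^sup>2 * ((Pt t a)\<^sup>2 + (Qt t a)\<^sup>2) + ((Pa t a)\<^sup>2 + (Qa t a)\<^sup>2)"
        using t by (simp add: E_def power2_eq_square field_simps)
      then have "t * E t a \<le> t * (K * (Pa t a * Qt t a - Pt t a * Qa t a) + C * t * S t a)"
        using quasi[OF t, of a] by (simp add: S_def power2_eq_square algebra_simps)
      then have E: "E t a \<le> K * (Pa t a * Qt t a - Pt t a * Qa t a) + C * t * S t a"
        using t by simp
      have H0: "0 \<le> ?H (S t a)"
        using g0[OF s] gH[OF s] by simp
      have "g (S t a) * E t a \<le> ?H (S t a) * E t a"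
        by (intro mult_right_mono gH s E0)
      also have "\<dots> \<le> ?H (S t a) * (K * (Pa t a * Qt t a - Pt t a * Qa t a) + C * t * S t a)"
        by (intro mult_left_mono E H0)
      also have "\<dots> = K * ?J t a + C * t * (S t a * ?H (S t a))"
        by (simp add: algebra_simps)
      also have "\<dots> \<le> K * ?J t a + C * t * 2"
        using t C by (intro add_left_mono mult_left_mono H2 s) auto
      finally show "g (S t a) * E t a \<le> K * ?J t a + 2 * C * t"
        by (simp add: algebra_simps)
    qed
    also have "\<dots> = K * integral {0..2*pi} (?J t) + 4 * pi * C * t"
      by (subst integral_add) (auto intro!: integrable_continuous_real continuous_intros cJ)
    also have "integral {0..2*pi} (?J t) = ang' ?H t / 2"
      unfolding ang'_def mult.assoc by (subst integral_mult_right) simp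
    finally show ?thesis by simp
  qed
qed

lemma S_deriv_a:
  assumes "0 \<le> t" "t \<le> R"
  shows "((\<lambda>a. S t a) has_real_derivative 2 * (P t a * Pa t a + Q t a * Qa t a)) (at a)"
  unfolding S_def using assms
  by (auto intro!: derivative_eq_intros deriv_a simp: algebra_simps)

text \<open>Lagrange's identity: the defect is the square of a determinant.\<close>

lemma cauchy_schwarz:
  "(P t a * x + Q t a * y)\<^sup>2 \<le> S t a * (x\<^sup>2 + y\<^sup>2)"
proof -
  have "S t a * (x\<^sup>2 + y\<^sup>2) - (P t a * x + Q t a * y)\<^sup>2 = (P t a * y - Q t a * x)\<^sup>2"
    unfolding S_def by (simp add: power2_eq_square algebra_simps)
  then show ?thesis by (metis diff_ge_0_iff_ge zero_le_power2)
qed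

lemma angular_le_E:
  assumes "0 < t"
  shows "(Pa t a)\<^sup>2 + (Qa t a)\<^sup>2 \<le> t * E t a"
  using assms by (simp add: E_def power2_eq_square field_simps)

lemma E_nonneg: "0 < t \<Longrightarrow> 0 \<le> E t a"
  by (simp add: E_def)

section \<open>Log-log energy and circles without zeros\<close>

text \<open>As \<open>|grad S|\<^sup>2\<close> is at most \<open>4 S |Dw|\<^sup>2\<close>, the
  squared gradient of \<open>ln (- ln (S + e))\<close> is at most
  \<open>4 dens e S |Dw|\<^sup>2\<close>. The shift by \<open>e\<close> keeps everything finite at
  zeros of \<open>w\<close>.\<close>

definition dens :: "real \<Rightarrow> real \<Rightarrow> real" where
  "dens e s = 1 / ((s + e) * (ln (s + e))\<^sup>2)"

lemma dens_cont: "0 < e \<Longrightarrow> e \<le> 1/8 \<Longrightarrow> continuous_on {0..1/8} (dens e)"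
  unfolding dens_def[abs_def]
  using ln_le_neg_one[of "s + e" for s] by (intro continuous_intros) force+

lemma dens_nonneg: "0 < e \<Longrightarrow> 0 \<le> s \<Longrightarrow> 0 \<le> dens e s"
  by (simp add: dens_def)

text \<open>The angular derivative of \<open>ln (- ln (S + e))\<close> is \<open>2 v\<close> with
  \<open>v\<^sup>2\<close> at most \<open>t * dens * E\<close>; the pointwise inequality
  \<open>|2 v| \<le> 1 + v\<^sup>2\<close> makes the bound linear in the energy.\<close>

lemma loglog_oscillation:
  assumes t: "0 < t" "t \<le> R" and e: "0 < e" "e \<le> 1/8"
    and a: "a0 \<in> {0..2*pi}" "a1 \<in> {0..2*pi}"
  shows "ln (- ln (S t a1 + e)) - ln (- ln (S t a0 + e))
    \<le> 2 * pi + t * integral {0..2*pi} (\<lambda>a. dens e (S t a) * E t a)"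
proof -
  let ?G = "\<lambda>a. 1 + t * (dens e (S t a) * E t a)"
  have c: "continuous_on {0..2*pi} (\<lambda>a. dens e (S t a) * E t a)"
    using cont_E[OF dens_cont] t e by simp
  have "ln (- ln (S t a1 + e)) - ln (- ln (S t a0 + e)) \<le> integral {0..2*pi} ?G"
  proof (rule diff_le_integral_of_deriv_bound[where w = "\<lambda>a. ln (- ln (S t a + e))" and w' = "\<lambda>a.
      2 * (P t a * Pa t a + Q t a * Qa t a) / ((S t a + e) * ln (S t a + e))"])
    show "continuous_on {0..2*pi} ?G"
      by (intro continuous_intros c)
    fix a assume "0 \<le> a" "a \<le> 2*pi"
    define x where "x = S t a + e"
    have x: "0 < x" "x \<le> 1/4"
      using S_nonneg[of t a] S_small[of t a] t e by (auto simp: x_def)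
    have l: "ln x \<le> -1" using ln_le_neg_one x .
    have "((\<lambda>a. ln (- ln (S t a + e))) has_real_derivative
        2 * (P t a * Pa t a + Q t a * Qa t a) / ((S t a + e) * ln (S t a + e))) (at a)"
      using l x t unfolding x_def
      by (auto intro!: derivative_eq_intros S_deriv_a simp: field_simps)
    then show "((\<lambda>a. ln (- ln (S t a + e))) has_real_derivative
        2 * (P t a * Pa t a + Q t a * Qa t a) / ((S t a + e) * ln (S t a + e))) (at a within {0..2*pi})"
      by (rule DERIV_subset) simp
    define v where "v = (P t a * Pa t a + Q t a * Qa t a) / (x * ln x)"
    have "v\<^sup>2 = (P t a * Pa t a + Q t a * Qa t a)\<^sup>2 / (x * ln x)\<^sup>2"
      by (simp add: v_def power_divide)
    also have "\<dots> \<le> (x * (t * E t a)) / (x * ln x)\<^sup>2"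
    proof (intro divide_right_mono order_trans[OF cauchy_schwarz] mult_mono angular_le_E)
    qed (use x t e in \<open>auto simp: x_def S_nonneg\<close>)
    also have "\<dots> = t * (dens e (S t a) * E t a)"
      using x by (simp add: dens_def x_def[symmetric] power2_eq_square)
    finally have "v\<^sup>2 \<le> t * (dens e (S t a) * E t a)" .
    moreover have "\<bar>2 * v\<bar> \<le> 1 + v\<^sup>2"
    proof -
      have "0 \<le> (\<bar>v\<bar> - 1)\<^sup>2" by simp
      then show ?thesis by (simp add: power2_eq_square algebra_simps)
    qed
    ultimately show "\<bar>2 * (P t a * Pa t a + Q t a * Qa t a) / ((S t a + e) * ln (S t a + e))\<bar> \<le> ?G a"
      by (simp add: v_def x_def[symmetric])
  qed (use a in auto)
  also have "\<dots> = 2 * pi + t * integral {0..2*pi} (\<lambda>a. dens e (S t a) * E t a)"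
    by (subst integral_add) (auto intro!: integrable_continuous_real continuous_intros c)
  finally show ?thesis .
qed

text \<open>If every circle met a zero, \<open>ln ln (1 / (S + e))\<close> would oscillate a lot on each of them, which makes
  \<open>B\<close> large; but \<open>B\<^sup>2\<close> is at most a multiple of \<open>t B'\<close>, so a large \<open>B\<close> blows up before \<open>r2\<close>.\<close>

lemma exists_zero_free_circle:
  assumes r: "0 < r1" "r1 < r2" "r2 \<le> R" and d: "0 < d" and a0: "a0 \<in> {0..2*pi}"
    and S0: "\<And>t. r1 \<le> t \<Longrightarrow> t \<le> r2 \<Longrightarrow> d \<le> S t a0"
  shows "\<exists>t\<in>{r1..r2}. \<forall>a\<in>{0..2*pi}. S t a \<noteq> 0"
proof (rule ccontr)
  assume "\<not> ?thesis"
  then have zero: "\<exists>a\<in>{0..2*pi}. S t a = 0" if "r1 \<le> t" "t \<le> r2" for t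
    using that by auto
  \<comment> \<open>On \<open>[r1, m]\<close> the oscillation drives \<open>B\<close> up to
    \<open>c1\<close>; \<open>[m, r2]\<close> is reserved for the blow-up.\<close>
  define m where "m = (r1 + r2) / 2"
  have m: "r1 < m" "m < r2" "0 < m" using r by (auto simp: m_def)
  define c0 where "c0 = ln (- ln d) + 2 * pi"
  \<comment> \<open>The first summand makes \<open>2 pi C t\<^sup>2\<close> at most a quarter of
    \<open>B\<close>, the second contradicts \<open>riccati_blowup\<close> on
    \<open>[m, r2]\<close>, and the third makes \<open>c1\<close> positive.\<close>
  define c1 where "c1 = 8 * pi * C * R\<^sup>2 + K\<^sup>2 * pi * r2 / (r2 - m) + 1"
  have c1: "0 < c1" using C K r m by (auto simp: c1_def intro!: add_nonneg_pos divide_nonneg_pos)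
  \<comment> \<open>The number \<open>e\<close> below satisfies \<open>ln (- ln e) = y\<close>, so
    \<open>y\<close> is the value of the iterated logarithm at a zero. The entry \<open>3\<close>
    yields \<open>e \<le> 1/8\<close>; the other one makes the oscillation large enough for
    \<open>large\<close>.\<close>
  define y where "y = max 3 (c0 + c1 * r2 / (m - r1))"
  define e where "e = exp (- exp y)"
  have e: "0 < e" "e \<le> 1/8"
  proof -
    have "3 \<le> y" by (simp add: y_def)
    then have "4 \<le> exp y" using exp_ge_add_one_self[of y] by linarith
    then have "e \<le> exp (-4)" by (simp add: e_def)
    moreover have "2 ^ 4 \<le> (exp 1 :: real) ^ 4"
      using exp_ge_add_one_self[of 1] by (intro power_mono) auto
    then have "8 \<le> exp (4::real)" by (simp add: exp_of_nat_mult[symmetric])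
    then have "exp (-4::real) \<le> 1/8" by (simp add: exp_minus field_simps)
    ultimately show "e \<le> 1/8" by linarith
  qed (simp add: e_def)
  \<comment> \<open>This regularises \<open>1 / (s ln (1/s))\<close>; the resulting
    \<open>h + s h'\<close> dominates \<open>dens e\<close>.\<close>
  define h where "h = (\<lambda>s. - 1 / ((s + e) * ln (s + e)))"
  define h' where "h' = (\<lambda>s. (1 + ln (s + e)) / ((s + e) * ln (s + e))\<^sup>2)"
  have ln1: "0 < s + e" "ln (s + e) \<le> -1" if "0 \<le> s" "s \<le> 1/8" for s
    using that e ln_le_neg_one[of "s + e"] by auto
  have H: "h s + s * h' s = (s - e * ln (s + e)) / ((s + e) * ln (s + e))\<^sup>2"
    if "0 \<le> s" "s \<le> 1/8" for s
  proof -
    have "- 1 / (x * l) + s * ((1 + l) / (x * l)\<^sup>2) = (s - e * l) / (x * l)\<^sup>2"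
      if "x \<noteq> 0" "l \<noteq> 0" "e = x - s" for x l :: real
      using that(1,2) unfolding that(3) by (simp add: field_simps power2_eq_square)
    then show ?thesis unfolding h_def h'_def by this (use ln1[OF that] in linarith)+
  qed
  obtain B' where B': "\<And>t. 0 \<le> t \<Longrightarrow> t \<le> R \<Longrightarrow> (B h has_real_derivative B' t) (at t within {0..R})"
    and B'E: "\<And>t. 0 < t \<Longrightarrow> t \<le> R \<Longrightarrow> integral {0..2*pi} (\<lambda>a. dens e (S t a) * E t a) \<le> B' t"
  proof (rule B_deriv[of h h' "dens e"])
    show "continuous_on {0..1/8} (dens e)" using dens_cont e .
    show "continuous_on {0..1/8} h'"
      unfolding h'_def using ln1 by (intro continuous_intros) force+
    fix s :: real assume s: "0 \<le> s" "s \<le> 1/8"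
    define x where "x = s + e"
    have x: "0 < x" "ln x \<le> -1" "s \<le> x" "s = x - e" "x \<le> 1" using ln1[OF s] e s by (auto simp: x_def)
    show "(h has_real_derivative h' s) (at s)"
    proof -
      have "((\<lambda>x. - 1 / (x * ln x)) has_real_derivative (1 + ln x) / (x * ln x)\<^sup>2) (at x)"
        using x(1,2)
        by (auto intro!: derivative_eq_intros simp: power2_eq_square add_divide_distrib diff_divide_distrib)
      moreover have "((\<lambda>s. s + e) has_real_derivative 1) (at s)"
        by (auto intro!: derivative_eq_intros)
      ultimately show ?thesis
        using DERIV_chain2[of "\<lambda>x. - 1 / (x * ln x)" "(1 + ln x) / (x * ln x)\<^sup>2" "\<lambda>s. s + e" s 1]
        by (simp add: x_def h_def h'_def)
    qed
    show "0 \<le> dens e s" using dens_nonneg e s by simp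
    have "dens e s = x / (x * ln x)\<^sup>2"
      using x by (simp add: dens_def x_def[symmetric] power2_eq_square)
    also have "\<dots> \<le> (s - e * ln x) / (x * ln x)\<^sup>2"
      using mult_left_mono[OF x(2), of e] x e by (intro divide_right_mono) auto
    finally show "dens e s \<le> h s + s * h' s"
      unfolding H[OF s] x_def .
    have xl: "x \<le> x * - ln x"
      using mult_left_mono[of 1 "- ln x" x] x by simp
    have el: "e * - ln x \<le> x * - ln x"
      by (rule mult_right_mono) (use x s in auto)
    have e0: "0 \<le> e * - ln x"
      using x e by (intro mult_nonneg_nonneg) auto
    have l: "s - e * ln x \<le> 2 * (x * - ln x)"
      using xl el x(3) by linarith
    \<comment> \<open>Both factors are compared with \<open>x |ln x|\<close>, the square of which is
      the denominator in \<open>H\<close>.\<close>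
    have "s * (s - e * ln x) \<le> x * (2 * (x * - ln x))"
      using e0 s x by (intro mult_mono l) auto
    also have "\<dots> \<le> (x * - ln x) * (2 * (x * - ln x))"
      using x xl by (intro mult_right_mono) (auto simp: mult_nonneg_nonpos)
    finally have "s * (s - e * ln x) \<le> 2 * (x * ln x)\<^sup>2"
      by (simp add: power2_eq_square algebra_simps)
    moreover have "0 < (x * ln x)\<^sup>2"
      using x(1,2) by auto
    ultimately show "s * (h s + s * h' s) \<le> 2"
      unfolding H[OF s] unfolding x_def[symmetric] times_divide_eq_right by (simp only: pos_divide_le_eq)
  qed auto
  define I where "I t = integral {0..2*pi} (\<lambda>a. dens e (S t a) * E t a)" for t
  have gE: "continuous_on {0..2*pi} (\<lambda>a. dens e (S t a) * E t a)" if "0 < t" "t \<le> R" for t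
    using cont_E[OF dens_cont[OF e] that] .
  have I0: "0 \<le> I t" if "0 < t" "t \<le> R" for t
    unfolding I_def using that e
    by (intro integral_nonneg integrable_continuous_real gE) (auto simp: dens_nonneg S_nonneg E_nonneg)
  have mono: "B h s \<le> B h t" if "0 \<le> s" "s \<le> t" "t \<le> R" for s t
    by (rule deriv_nonneg_imp_mono_within[of 0 R "B h" B'])
      (use that B' in \<open>auto intro!: order_trans[OF I0 B'E[folded I_def]]\<close>)
  \<comment> \<open>The circle contains a zero, where the iterated logarithm is \<open>y\<close>,
    and the direction \<open>a0\<close>, where it is at most \<open>ln (- ln d)\<close>.\<close>
  have large: "c1 / (m - r1) \<le> I t" if t: "r1 \<le> t" "t \<le> r2" for t
  proof -
    obtain a1 where a1: "a1 \<in> {0..2*pi}" "S t a1 = 0" using zero[OF t] by blast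
    have s: "0 < d" "d \<le> S t a0 + e" "S t a0 + e \<le> 1/4"
      using S0[OF t] d e S_small[of t a0] t r by auto
    have "ln (S t a0 + e) \<le> -1" using s by (intro ln_le_neg_one) auto
    moreover have "ln d \<le> ln (S t a0 + e)" using s by (subst ln_le_cancel_iff) auto
    ultimately have "ln (- ln (S t a0 + e)) \<le> ln (- ln d)"
      by (subst ln_le_cancel_iff) auto
    moreover have "ln (- ln (S t a1 + e)) = y"
      using a1 by (simp add: e_def)
    ultimately have "y - c0 \<le> t * I t"
      using loglog_oscillation[of t e a0 a1] t r e a0 a1(1) by (simp add: I_def c0_def)
    also have "\<dots> \<le> r2 * I t"
      using t r I0[of t] by (intro mult_right_mono) auto
    finally have "y - c0 \<le> r2 * I t" .
    moreover have "c1 * r2 / (m - r1) \<le> y - c0" by (simp add: y_def)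
    ultimately have "r2 * (c1 / (m - r1)) \<le> r2 * I t" by (simp add: mult.commute)
    then show ?thesis by (rule mult_left_le_imp_le) (use r in auto)
  qed
  \<comment> \<open>The lower bound for \<open>B'\<close> is integrated over an interval of length
    \<open>m - r1\<close>.\<close>
  have Bm: "c1 \<le> B h m"
  proof -
    have "B h r1 - c1 / (m - r1) * r1 \<le> B h m - c1 / (m - r1) * m"
    proof (rule deriv_nonneg_imp_mono_within[of r1 m "\<lambda>t. B h t - c1 / (m - r1) * t" "\<lambda>t. B' t - c1 / (m - r1)"])
      fix t assume "r1 \<le> t" "t \<le> m"
      then show "((\<lambda>t. B h t - c1 / (m - r1) * t) has_real_derivative B' t - c1 / (m - r1)) (at t within {r1..m})"
        using m r by (auto intro!: derivative_eq_intros DERIV_subset[OF B'])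
    next
      fix t assume "r1 < t" "t < m"
      then show "0 \<le> B' t - c1 / (m - r1)"
        using large[of t] B'E[of t] m r unfolding I_def by auto
    qed (use m in auto)
    moreover have "0 \<le> B h r1" using mono[of 0 r1] r by (simp add: B_0)
    ultimately have "c1 / (m - r1) * (m - r1) \<le> B h m"
      unfolding right_diff_distrib by linarith
    then show ?thesis using m by simp
  qed
  have quad: "(B h t)\<^sup>2 \<le> (K\<^sup>2 * pi * r2) * B' t" if t: "m \<le> t" "t \<le> r2" for t
  proof -
    have t0: "0 < t" "t \<le> R" using t m r by auto
    have Bt: "c1 \<le> B h t" using Bm mono[of m t] t m r by auto
    \<comment> \<open>The weight in the inequality
      \<open>- v \<le> b / 2 + v\<^sup>2 / (2 b)\<close>. With this value the first term contributes
      \<open>K / 2 * (pi * b) = B / 2\<close>, which can be absorbed.\<close>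
    define b where "b = B h t / (K * pi)"
    have b: "0 < b" using Bt c1 K by (simp add: b_def)
    have hc: "continuous_on {0..1/8} h"
      unfolding h_def using ln1 by (intro continuous_intros) force+
    have "ang h t \<le> integral {0..2*pi} (\<lambda>a. b / 2 + t / (2 * b) * (dens e (S t a) * E t a))"
      unfolding ang_def
    proof (rule integral_le)
      let ?f = "\<lambda>t a. h (S t a) * (Q t a * Pa t a - P t a * Qa t a)"
      have "continuous_on ({0..R} \<times> {0..2*pi}) (\<lambda>x. ?f (fst x) (snd x))"
        by (intro continuous_on_mult cont_compose_S[OF hc]) (intro continuous_intros)
      then show "?f t integrable_on {0..2*pi}"
        using slice[of ?f] t0 by (intro integrable_continuous_real) auto
      show "(\<lambda>a. b / 2 + t / (2 * b) * (dens e (S t a) * E t a)) integrable_on {0..2*pi}"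
        by (intro integrable_continuous_real continuous_intros gE t0)
      fix a
      define x where "x = S t a + e"
      have x: "0 < x" "ln x \<le> -1"
        using ln1[of "S t a"] S_nonneg[of t a] S_small[of t a] t0 by (auto simp: x_def)
      define v where "v = (Q t a * Pa t a - P t a * Qa t a) / (x * ln x)"
      have "v\<^sup>2 = (P t a * - Qa t a + Q t a * Pa t a)\<^sup>2 / (x * ln x)\<^sup>2"
        by (simp add: v_def power_divide algebra_simps)
      also have "\<dots> \<le> (x * (t * E t a)) / (x * ln x)\<^sup>2"
      proof (intro divide_right_mono order_trans[OF cauchy_schwarz] mult_mono)
        show "(- Qa t a)\<^sup>2 + (Pa t a)\<^sup>2 \<le> t * E t a"
          using angular_le_E[OF t0(1), of a] by simp
      qed (use x e in \<open>auto simp: x_def S_nonneg\<close>)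
      also have "\<dots> = t * (dens e (S t a) * E t a)"
        using x by (simp add: dens_def x_def[symmetric] power2_eq_square)
      finally have v: "v\<^sup>2 \<le> t * (dens e (S t a) * E t a)" .
      have "0 \<le> (b + v)\<^sup>2" by simp
      then have "- v * (2 * b) \<le> b\<^sup>2 + v\<^sup>2" by (simp add: power2_eq_square algebra_simps)
      then have "- v \<le> (b\<^sup>2 + v\<^sup>2) / (2 * b)" using b by (simp add: field_simps)
      also have "\<dots> \<le> (b\<^sup>2 + t * (dens e (S t a) * E t a)) / (2 * b)"
        using v b by (intro divide_right_mono) auto
      also have "\<dots> = b / 2 + t / (2 * b) * (dens e (S t a) * E t a)"
        using b by (simp add: field_simps power2_eq_square)
      finally show "?f t a \<le> b / 2 + t / (2 * b) * (dens e (S t a) * E t a)"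
        by (simp add: v_def x_def h_def)
    qed
    also have "\<dots> = pi * b + t / (2 * b) * I t"
      using less_imp_neq[OF b] by (subst integral_add)
        (auto simp: I_def intro!: integrable_continuous_real continuous_intros gE t0)
    finally have "K / 2 * ang h t \<le> K / 2 * (pi * b + t / (2 * b) * I t)"
      using K by (intro mult_left_mono) auto
    also have "\<dots> = B h t / 2 + K\<^sup>2 * pi * t * I t / (4 * B h t)"
      using K Bt c1 by (simp add: b_def field_simps power2_eq_square)
    finally have 1: "K / 2 * ang h t \<le> B h t / 2 + K\<^sup>2 * pi * t * I t / (4 * B h t)" .
    \<comment> \<open>A further quarter of \<open>B\<close> pays for the term with \<open>C\<close>,
      so that \<open>B / 4\<close> remains against the energy.\<close>
    have "2 * pi * C * t\<^sup>2 \<le> 2 * pi * C * R\<^sup>2"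
      using t0 C by (intro mult_left_mono power_mono) auto
    moreover have "0 \<le> K\<^sup>2 * pi * r2 / (r2 - m)" using K m r by simp
    ultimately have "2 * pi * C * t\<^sup>2 \<le> B h t / 4"
      using Bt unfolding c1_def by linarith
    with 1 have "B h t / 4 \<le> K\<^sup>2 * pi * t * I t / (4 * B h t)"
      using B_def[of h t] by linarith
    then have "(B h t)\<^sup>2 \<le> K\<^sup>2 * pi * t * I t"
      using Bt c1 by (simp add: field_simps power2_eq_square)
    also have "\<dots> \<le> K\<^sup>2 * pi * r2 * B' t"
      using t t0 r m B'E[OF t0, folded I_def] I0[OF t0] by (intro mult_mono) auto
    finally show ?thesis .
  qed
  have "B h m * (r2 - m) < K\<^sup>2 * pi * r2"
  proof (rule riccati_blowup[of m r2 "B h" B'])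
    show "(B h has_real_derivative B' t) (at t within {m..r2})" if "m \<le> t" "t \<le> r2" for t
      using that m r by (intro DERIV_subset[OF B']) auto
    show "0 \<le> B' t" if "m \<le> t" "t \<le> r2" for t
      using that m r I0[of t] B'E[of t, folded I_def] by auto
    show "0 < K\<^sup>2 * pi * r2" using K r by simp
  qed (use m Bm c1 quad in auto)
  moreover have "K\<^sup>2 * pi * r2 / (r2 - m) \<le> B h m"
    using Bm C by (auto simp: c1_def intro: order_trans[rotated])
  ultimately show False
    using m by (simp add: field_simps)
qed

section \<open>Logarithmic energy and vanishing of infinite order\<close>

lemma S_deriv_t:
  assumes "0 \<le> t" "t \<le> R"
  shows "((\<lambda>t. S t a) has_real_derivative 2 * (P t a * Pt t a + Q t a * Qt t a)) (at t)"
  unfolding S_def using assms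
  by (auto intro!: derivative_eq_intros deriv_t simp: algebra_simps)

lemma radial_le_E:
  assumes "0 < t"
  shows "t * ((Pt t a)\<^sup>2 + (Qt t a)\<^sup>2) \<le> E t a"
  using assms by (simp add: E_def)

text \<open>This is \<open>2 pi\<close> times the mean of \<open>ln (|w|\<^sup>2 + e)\<close> over
  the circle; its growth between two radii detects the order of vanishing.\<close>

definition V :: "real \<Rightarrow> real \<Rightarrow> real" where
  "V e t = integral {0..2*pi} (\<lambda>a. ln (S t a + e))"

lemma V_integrand_cont:
  assumes e: "0 < e"
  shows "continuous_on ({0..R} \<times> {0..2*pi}) (\<lambda>x. ln (S (fst x) (snd x) + e))"
proof -
  have "S t a + e \<noteq> 0" for t a using S_nonneg[of t a] e by linarith
  then show ?thesis by (intro continuous_intros) auto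
qed

lemma V_integrable:
  assumes "0 < e" "0 \<le> t" "t \<le> R"
  shows "(\<lambda>a. ln (S t a + e)) integrable_on {0..2*pi}"
  using slice[of "\<lambda>t a. ln (S t a + e)", OF V_integrand_cont] assms
  by (intro integrable_continuous_real) auto

lemma V_deriv:
  assumes e: "0 < e" and t: "0 \<le> t" "t \<le> R"
  shows "(V e has_real_derivative integral {0..2*pi}
     (\<lambda>a. 2 * (P t a * Pt t a + Q t a * Qt t a) / (S t a + e))) (at t within {0..R})"
proof -
  let ?f = "\<lambda>t a. ln (S t a + e)"
  let ?f' = "\<lambda>t a. 2 * (P t a * Pt t a + Q t a * Qt t a) / (S t a + e)"
  have Se: "0 < S t a + e" for t a using S_nonneg[of t a] e by linarith
  have 1: "((\<lambda>t. ?f t a) has_real_derivative ?f' t a) (at t within {0..R})"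
    if "0 \<le> t" "t \<le> R" for t a
    by (rule DERIV_subset[OF _ subset_UNIV])
      (use Se[of t a] that in \<open>auto intro!: derivative_eq_intros S_deriv_t\<close>)
  have cf': "continuous_on ({0..R} \<times> {0..2*pi}) (\<lambda>x. ?f' (fst x) (snd x))"
    using Se by (intro continuous_intros) (metis less_irrefl)
  have "(V e has_real_derivative integral (cbox 0 (2*pi)) (?f' t)) (at t within {0..R})"
    unfolding V_def[abs_def] box_real(2)[symmetric]
  proof (rule leibniz_rule_field_derivative)
    show "continuous_on (cbox 0 R \<times> cbox 0 (2 * pi)) (\<lambda>(t, a). ?f' t a)"
      using cf' by (simp add: case_prod_beta')
    show "?f t integrable_on cbox 0 (2*pi)" if "t \<in> cbox 0 R" for t
      using V_integrable[OF e] that by auto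
  qed (use 1 t in auto)
  then show ?thesis by simp
qed

text \<open>Young's inequality with weight \<open>al * t\<close> trades the radial energy against
  \<open>1 / (al * t)\<close>, which integrates to a logarithm of \<open>t\<close>. The parameter
  \<open>al\<close> stays free so that the two can be balanced later.\<close>

lemma V_deriv_le:
  assumes e: "0 < e" and t: "0 < t" "t \<le> R" and al: "0 < al"
  shows "integral {0..2*pi} (\<lambda>a. 2 * (P t a * Pt t a + Q t a * Qt t a) / (S t a + e))
    \<le> al * integral {0..2*pi} (\<lambda>a. 1 / (S t a + e) * E t a) + 2 * pi / (al * t)"
proof -
  have Se: "0 < S t a + e" for t a using S_nonneg[of t a] e by linarith
  have c: "continuous_on {0..2*pi} (\<lambda>a. 1 / (S t a + e) * E t a)"
    using e t by (intro cont_E[of "\<lambda>s. 1 / (s + e)"] continuous_intros) auto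
  note [continuous_intros] = slice[OF cont'(1)] slice[OF cont'(2)] slice[OF cont'(3)] slice[OF cont'(4)]
    slice[OF cont_S]
  have "integral {0..2*pi} (\<lambda>a. 2 * (P t a * Pt t a + Q t a * Qt t a) / (S t a + e))
    \<le> integral {0..2*pi} (\<lambda>a. al * (1 / (S t a + e) * E t a) + 1 / (al * t))"
  proof (rule integral_le)
    show "(\<lambda>a. 2 * (P t a * Pt t a + Q t a * Qt t a) / (S t a + e)) integrable_on {0..2*pi}"
      using t Se[of t] by (intro integrable_continuous_real continuous_intros) (auto simp: less_imp_neq[symmetric])
    show "(\<lambda>a. al * (1 / (S t a + e) * E t a) + 1 / (al * t)) integrable_on {0..2*pi}"
      by (intro integrable_continuous_real continuous_intros c)
    fix a
    define x where "x = S t a + e"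
    define b where "b = al * t"
    have x: "0 < x" and b: "0 < b" using Se[of t a] al t by (auto simp: x_def b_def)
    define v where "v = (P t a * Pt t a + Q t a * Qt t a) / x"
    have "v\<^sup>2 = (P t a * Pt t a + Q t a * Qt t a)\<^sup>2 / x\<^sup>2"
      by (simp add: v_def power_divide)
    also have "\<dots> \<le> (x * ((Pt t a)\<^sup>2 + (Qt t a)\<^sup>2)) / x\<^sup>2"
    proof (intro divide_right_mono order_trans[OF cauchy_schwarz] mult_right_mono)
    qed (use x e in \<open>auto simp: x_def S_nonneg\<close>)
    also have "\<dots> = ((Pt t a)\<^sup>2 + (Qt t a)\<^sup>2) / x"
      using x by (simp add: power2_eq_square)
    finally have v: "b * v\<^sup>2 \<le> b * (((Pt t a)\<^sup>2 + (Qt t a)\<^sup>2) / x)"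
      using b by (intro mult_left_mono) auto
    also have "\<dots> = al * (1 / x * (t * ((Pt t a)\<^sup>2 + (Qt t a)\<^sup>2)))"
      by (simp add: b_def)
    also have "\<dots> \<le> al * (1 / x * E t a)"
      using x al radial_le_E[OF t(1), of a] by (intro mult_left_mono) auto
    finally have v: "b * v\<^sup>2 \<le> al * (1 / x * E t a)" .
    have "0 \<le> b * (v - 1 / b)\<^sup>2" using b by simp
    also have "\<dots> = b * v\<^sup>2 + 1 / b - 2 * v"
      using b by (simp add: power2_eq_square field_simps)
    finally have "2 * v \<le> al * (1 / x * E t a) + 1 / b" using v by linarith
    then show "2 * (P t a * Pt t a + Q t a * Qt t a) / (S t a + e)
      \<le> al * (1 / (S t a + e) * E t a) + 1 / (al * t)"
      by (simp add: v_def x_def b_def)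
  qed
  also have "\<dots> = al * integral {0..2*pi} (\<lambda>a. 1 / (S t a + e) * E t a) + 2 * pi / (al * t)"
    by (subst integral_affine[OF integrable_continuous_real[OF c]]) auto
  finally show ?thesis .
qed

text \<open>What matters is that \<open>M\<close> does not depend on \<open>e\<close>,
  \<open>t\<close> and \<open>al\<close>. The value \<open>ang h r\<close> involves only the circle
  of radius \<open>r\<close>, where \<open>S \<ge> d\<close> keeps \<open>h\<close> below
  \<open>(1 - ln e) / d\<close>; and by \<open>V_deriv_le\<close> the function
  \<open>al * B h t + 2 * pi / al * ln t - V e t\<close> is nondecreasing in
  \<open>t\<close>.\<close>

lemma log_energy_bound:
  assumes r: "0 < r" "r \<le> R" and d: "0 < d" and Sd: "\<And>a. a \<in> {0..2*pi} \<Longrightarrow> d \<le> S r a"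
  obtains M where "0 < M"
    "\<And>e t al. 0 < e \<Longrightarrow> e \<le> 1/8 \<Longrightarrow> 0 < t \<Longrightarrow> t \<le> r \<Longrightarrow> 0 < al \<Longrightarrow>
       V e r - V e t \<le> al * (M * (1 - ln e)) + 2 * pi / al * (ln r - ln t)"
proof -
  define N where "N a = \<bar>Q r a * Pa r a - P r a * Qa r a\<bar>" for a
  have "continuous_on {0..2*pi} N"
    unfolding N_def using r
    by (intro continuous_intros slice[OF cont'(1)] slice[OF cont'(2)] slice[OF cont'(5)] slice[OF cont'(6)]) auto
  then have "compact (N ` {0..2*pi})" by (intro compact_continuous_image) auto
  then obtain n where n: "\<And>a. a \<in> {0..2*pi} \<Longrightarrow> N a \<le> n"
    using compact_imp_bounded bounded_real by (metis abs_le_D1 imageI)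
  have n0: "0 \<le> n" using n[of 0] by (auto simp: N_def)
  define M where "M = K / 2 * (2 * pi * (n / d)) + 2 * pi * C * r\<^sup>2 + 1"
  have M0: "0 < M" using K C n0 d by (auto simp: M_def intro!: add_nonneg_pos)
  show ?thesis
  proof (rule that[OF M0])
    fix e t al :: real assume e: "0 < e" "e \<le> 1/8" and t: "0 < t" "t \<le> r" and al: "0 < al"
    \<comment> \<open>With \<open>x = s + e\<close> and \<open>l = ln (x / e)\<close> this is
      \<open>(1 + l) / x\<close>. Then \<open>h + s h' = (x + e l) / x\<^sup>2\<close> is at least
      \<open>1 / x\<close>, and \<open>1 + l \<le> x / e\<close> bounds its product with
      \<open>s\<close> by \<open>2\<close>.\<close>
    define h where "h = (\<lambda>s. (1 - ln e + ln (s + e)) / (s + e))"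
    define h' where "h' = (\<lambda>s. (ln e - ln (s + e)) / (s + e)\<^sup>2)"
    have lne: "ln e \<le> 0" using e by simp
    obtain B' where B': "\<And>t. 0 \<le> t \<Longrightarrow> t \<le> R \<Longrightarrow> (B h has_real_derivative B' t) (at t within {0..R})"
      and B'E: "\<And>t. 0 < t \<Longrightarrow> t \<le> R \<Longrightarrow> integral {0..2*pi} (\<lambda>a. 1 / (S t a + e) * E t a) \<le> B' t"
    proof (rule B_deriv[of h h' "\<lambda>s. 1 / (s + e)"])
      show "continuous_on {0..1/8} (\<lambda>s. 1 / (s + e))"
        using e by (intro continuous_intros) auto
      show "continuous_on {0..1/8} h'"
        unfolding h'_def using e by (intro continuous_intros) auto
      fix s :: real assume s: "0 \<le> s" "s \<le> 1/8"
      define x where "x = s + e"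
      have x: "0 < x" "s = x - e" "e \<le> x" using e s by (auto simp: x_def)
      define l where "l = ln x - ln e"
      have l: "0 \<le> l" "1 + l \<le> x / e"
      proof -
        have "l = ln (x / e)" using e x by (simp add: l_def ln_div)
        moreover have "ln (x / e) \<le> x / e - 1" using e x by (intro ln_le_minus_one) auto
        ultimately show "1 + l \<le> x / e" by simp
        show "0 \<le> l" using e x by (simp add: l_def)
      qed
      have "((\<lambda>x. (1 - ln e + ln x) / x) has_real_derivative (ln e - ln x) / x\<^sup>2) (at x)"
        using x(1) by (auto intro!: derivative_eq_intros simp: power2_eq_square)
      moreover have "((\<lambda>s. s + e) has_real_derivative 1) (at s)"
        by (auto intro!: derivative_eq_intros)
      ultimately show "(h has_real_derivative h' s) (at s)"
        using DERIV_chain2[of "\<lambda>x. (1 - ln e + ln x) / x" "(ln e - ln x) / x\<^sup>2" "\<lambda>s. s + e" s 1]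
        by (simp add: x_def h_def h'_def)
      show "0 \<le> 1 / (s + e)" using x(1) by (simp add: x_def)
      have hs: "h s = (1 + l) / x" "h' s = - l / x\<^sup>2"
        by (simp_all add: h_def h'_def x_def l_def)
      have "(1 + l) / x + (x - e) * (- l / x\<^sup>2) = (x + e * l) / x\<^sup>2"
        using x(1) by (simp add: field_simps power2_eq_square)
      then have H: "h s + s * h' s = (x + e * l) / x\<^sup>2"
        unfolding hs x(2)[symmetric] .
      have "1 / (s + e) = (x + 0) / x\<^sup>2"
        using x(1) by (simp add: x_def[symmetric] power2_eq_square)
      also have "\<dots> \<le> (x + e * l) / x\<^sup>2"
        using e l by (intro divide_right_mono add_left_mono) auto
      finally show "1 / (s + e) \<le> h s + s * h' s"
        by (simp add: H)
      have "s * (x + e * l) \<le> x * (x + x)"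
      proof (intro mult_mono add_left_mono)
        have "e * (1 + l) \<le> x" using l(2) e by (simp add: field_simps)
        moreover have "e * l \<le> e * (1 + l)" using e by simp
        ultimately show "e * l \<le> x" by linarith
      qed (use e x s l in auto)
      also have "\<dots> = 2 * x\<^sup>2" by (simp add: power2_eq_square)
      finally show "s * (h s + s * h' s) \<le> 2"
        unfolding H times_divide_eq_right using x(1) by (simp add: pos_divide_le_eq)
    qed auto
    have Br: "B h r \<le> M * (1 - ln e)"
    proof -
      have "\<bar>ang h r\<bar> \<le> integral {0..2*pi} (\<lambda>a. (1 - ln e) / d * n)"
        unfolding ang_def real_norm_def[symmetric]
      proof (rule integral_norm_bound_integral)
        have hc: "continuous_on {0..1/8} h"
          unfolding h_def using e by (intro continuous_intros) auto
        let ?f = "\<lambda>t a. h (S t a) * (Q t a * Pa t a - P t a * Qa t a)"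
        have "continuous_on ({0..R} \<times> {0..2*pi}) (\<lambda>x. ?f (fst x) (snd x))"
          by (intro continuous_on_mult cont_compose_S[OF hc]) (intro continuous_intros)
        then show "?f r integrable_on {0..2*pi}"
          using slice[of ?f] r by (intro integrable_continuous_real) auto
        show "(\<lambda>a. (1 - ln e) / d * n) integrable_on {0..2*pi}"
          by (intro integrable_continuous_real continuous_intros)
        fix a assume a: "a \<in> {0..2*pi}"
        define x where "x = S r a + e"
        have x: "e \<le> x" "d \<le> x" "x \<le> 1"
          using Sd[OF a] S_small[of r a] S_nonneg[of r a] r e by (auto simp: x_def)
        have lx: "ln e \<le> ln x" "ln x \<le> 0" using x e by auto
        then have "h (S r a) \<le> (1 - ln e) / d"
          unfolding h_def x_def[symmetric] using lne x d by (intro frac_le) auto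
        moreover have "0 \<le> h (S r a)"
          unfolding h_def x_def[symmetric] using lx x d by auto
        moreover have "N a \<le> n" "0 \<le> N a" using n[OF a] by (auto simp: N_def)
        ultimately have "h (S r a) * N a \<le> (1 - ln e) / d * n"
          by (intro mult_mono) auto
        then show "norm (?f r a) \<le> (1 - ln e) / d * n"
          using \<open>0 \<le> h (S r a)\<close> by (simp add: N_def abs_mult)
      qed
      also have "\<dots> = 2 * pi * ((1 - ln e) / d * n)" by simp
      finally have A: "ang h r \<le> 2 * pi * ((1 - ln e) / d * n)" by (rule abs_le_D1)
      define z where "z = 1 - ln e"
      have "ang h r \<le> (2 * pi * (n / d)) * z"
        using A unfolding z_def[symmetric] by (simp add: field_simps)
      then have 1: "K / 2 * ang h r \<le> K / 2 * ((2 * pi * (n / d)) * z)"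
        using K by (intro mult_left_mono) auto
      have 2: "(2 * pi * C * r\<^sup>2 + 1) * 1 \<le> (2 * pi * C * r\<^sup>2 + 1) * z"
        using lne C unfolding z_def by (intro mult_left_mono) auto
      have "B h r \<le> K / 2 * ang h r + (2 * pi * C * r\<^sup>2 + 1) * 1"
        by (simp add: B_def)
      also have "\<dots> \<le> K / 2 * ((2 * pi * (n / d)) * z) + (2 * pi * C * r\<^sup>2 + 1) * z"
        using 1 2 by (rule add_mono)
      also have "\<dots> = M * z"
        unfolding M_def distrib_right[symmetric] mult.assoc[symmetric] add.assoc[symmetric] ..
      finally show ?thesis
        by (simp only: z_def)
    qed
    define I where "I t = integral {0..2*pi} (\<lambda>a. 1 / (S t a + e) * E t a)" for t
    have I0: "0 \<le> I t" if "0 < t" "t \<le> R" for t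
    proof -
      have "continuous_on {0..2*pi} (\<lambda>a. 1 / (S t a + e) * E t a)"
        using e that by (intro cont_E[of "\<lambda>s. 1 / (s + e)"] continuous_intros) auto
      then show ?thesis
        unfolding I_def using that e
        by (intro integral_nonneg integrable_continuous_real)
          (auto simp: S_nonneg E_nonneg intro!: divide_nonneg_nonneg add_nonneg_nonneg)
    qed
    \<comment> \<open>The resulting sign of \<open>B h t\<close> allows dropping the energy term at
      the inner radius.\<close>
    have "B h 0 \<le> B h t"
      by (rule deriv_nonneg_imp_mono_within[of 0 R "B h" B'])
        (use t r B' in \<open>auto intro!: order_trans[OF I0 B'E[folded I_def]]\<close>)
    then have Bt: "0 \<le> B h t" by (simp add: B_0)
    let ?F = "\<lambda>t. al * B h t + 2 * pi / al * ln t - V e t"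
    have "?F t \<le> ?F r"
    proof (rule deriv_nonneg_imp_mono_within[of t r ?F "\<lambda>t. al * B' t + 2 * pi / al * (1 / t) - integral {0..2*pi}
     (\<lambda>a. 2 * (P t a * Pt t a + Q t a * Qt t a) / (S t a + e))"])
      fix z assume z: "t \<le> z" "z \<le> r"
      have "(?F has_real_derivative al * B' z + 2 * pi / al * (1 / z) - integral {0..2*pi}
         (\<lambda>a. 2 * (P z a * Pt z a + Q z a * Qt z a) / (S z a + e))) (at z within {0..R})"
        using z t r e
        by (intro DERIV_diff DERIV_add DERIV_cmult B' V_deriv DERIV_subset[OF DERIV_ln_divide subset_UNIV]) auto
      then show "(?F has_real_derivative al * B' z + 2 * pi / al * (1 / z) - integral {0..2*pi}
         (\<lambda>a. 2 * (P z a * Pt z a + Q z a * Qt z a) / (S z a + e))) (at z within {t..r})"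
        by (rule DERIV_subset) (use t r in auto)
    next
      fix z assume z: "t < z" "z < r"
      have "al * I z \<le> al * B' z"
        using B'E[of z] z t r al unfolding I_def by (intro mult_left_mono) auto
      then show "0 \<le> al * B' z + 2 * pi / al * (1 / z) - integral {0..2*pi}
         (\<lambda>a. 2 * (P z a * Pt z a + Q z a * Qt z a) / (S z a + e))"
        using V_deriv_le[OF e(1) _ _ al, of z] z t r unfolding I_def by simp
    qed (use t in auto)
    moreover have "0 \<le> al * B h t" using al Bt by simp
    moreover have "al * B h r \<le> al * (M * (1 - ln e))" using al Br by (intro mult_left_mono) auto
    ultimately show "V e r - V e t \<le> al * (M * (1 - ln e)) + 2 * pi / al * (ln r - ln t)"
      unfolding right_diff_distrib by linarith
  qed
qed

text \<open>For a tiny radius \<open>t\<close> let \<open>e = c t\<^sup>n\<close> bound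
  \<open>S\<close> there. Then \<open>V e r - V e t\<close> is at least \<open>2 pi ln (1/e)\<close>
  up to a constant, while \<open>log_energy_bound\<close> allows only
  \<open>pi ln (1/e) + 2 M ln (1/t)\<close> up to a constant. Since \<open>ln (1/e)\<close> is
  \<open>n ln (1/t)\<close> up to a constant, this fails for large \<open>n\<close>.\<close>

lemma not_infinite_order:
  assumes r: "0 < r" "r \<le> R" and nz: "\<And>a. a \<in> {0..2*pi} \<Longrightarrow> S r a \<noteq> 0"
    and flat: "\<And>n::nat. \<exists>c. \<forall>t\<in>{0..R}. \<forall>a. S t a \<le> c * t ^ n"
  shows False
proof -
  have cS: "continuous_on {0..2*pi} (S r)"
    using slice[OF cont_S] r by auto
  obtain a0 where a0: "a0 \<in> {0..2*pi}" "\<And>a. a \<in> {0..2*pi} \<Longrightarrow> S r a0 \<le> S r a"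
    using continuous_attains_inf[OF _ _ cS] by auto
  define d where "d = S r a0"
  have d: "0 < d" "d \<le> 1/8" using nz[OF a0(1)] S_nonneg[of r a0] S_small[of r a0] r by (auto simp: d_def)
  obtain M where M: "0 < M" and MV: "\<And>e t al. 0 < e \<Longrightarrow> e \<le> 1/8 \<Longrightarrow> 0 < t \<Longrightarrow> t \<le> r \<Longrightarrow> 0 < al \<Longrightarrow>
       V e r - V e t \<le> al * (M * (1 - ln e)) + 2 * pi / al * (ln r - ln t)"
    using log_energy_bound[OF r d(1)] a0(2) unfolding d_def by blast
  obtain n :: nat where n: "2 * M + 1 \<le> pi * real n"
  proof -
    obtain n :: nat where "(2 * M + 1) / pi < real n" using reals_Archimedean2 by blast
    then show ?thesis using that[of n] by (simp add: field_simps)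
  qed
  have n0: "0 < n" using n M by (cases n) auto
  obtain c' where c': "\<And>t a. 0 \<le> t \<Longrightarrow> t \<le> R \<Longrightarrow> S t a \<le> c' * t ^ n"
    using flat[of n] by (metis atLeastAtMost_iff)
  define c where "c = max 1 c'"
  have c: "1 \<le> c" "\<And>t a. 0 \<le> t \<Longrightarrow> t \<le> R \<Longrightarrow> S t a \<le> c * t ^ n"
  proof -
    fix t a :: real assume "0 \<le> t" "t \<le> R"
    then have "S t a \<le> c' * t ^ n" "c' * t ^ n \<le> c * t ^ n"
      using c' by (auto simp: c_def intro!: mult_right_mono)
    then show "S t a \<le> c * t ^ n" by linarith
  qed (simp add: c_def)
  define k where "k = pi + 2 * M * ln r + 2 * pi * (ln 2 - ln d) + pi * ln c"
  \<comment> \<open>Here \<open>y\<close> is \<open>ln (1/t)\<close> and \<open>k\<close> collects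
    what does not grow with \<open>y\<close>. The entries provide in turn the contradiction with
    \<open>y \<le> k\<close>, then \<open>t \<le> r\<close>, \<open>e \<le> 1/8\<close> and
    \<open>t \<le> 1\<close>.\<close>
  define y where "y = Max {k + 1, - ln r, ln (8 * c), 0}"
  have y: "k + 1 \<le> y" "- ln r \<le> y" "ln (8 * c) \<le> y" "0 \<le> y"
    by (simp_all add: y_def)
  define t where "t = exp (- y)"
  define e where "e = c * t ^ n"
  have t: "0 < t" "t \<le> r"
  proof -
    have "t \<le> exp (ln r)" unfolding t_def using y(2) by (subst exp_le_cancel_iff) linarith
    then show "t \<le> r" using r by simp
  qed (simp add: t_def)
  have e: "0 < e" "e \<le> 1/8"
  proof -
    show "0 < e" using c t by (simp add: e_def)
    have "t ^ n \<le> t ^ 1" using n0 y by (intro power_decreasing) (auto simp: t_def)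
    then have "e \<le> c * t" using c(1) by (simp add: e_def)
    moreover have "t \<le> exp (- ln (8 * c))" unfolding t_def using y(3) by simp
    then have "t \<le> 1 / (8 * c)" using c(1) by (simp add: exp_minus field_simps)
    then have "c * t \<le> c * (1 / (8 * c))" using c(1) by (intro mult_left_mono) auto
    ultimately show "e \<le> 1/8" using c(1) by simp
  qed
  have lt: "ln t = - y" by (simp add: t_def)
  have le: "ln e = ln c - n * y"
    using c(1) t by (simp add: e_def ln_mult ln_realpow lt)
  have Vr: "2 * pi * ln d \<le> V e r"
  proof -
    have "integral {0..2*pi} (\<lambda>a. ln d) \<le> V e r"
      unfolding V_def
    proof (rule integral_le)
      fix a assume "a \<in> {0..2*pi}"
      then have "d \<le> S r a + e" using a0(2)[of a] e unfolding d_def by linarith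
      then show "ln d \<le> ln (S r a + e)" using d by simp
    qed (use V_integrable e r in auto)
    then show ?thesis by simp
  qed
  have Vt: "V e t \<le> 2 * pi * (ln 2 + ln e)"
  proof -
    have "V e t \<le> integral {0..2*pi} (\<lambda>a. ln (2 * e))"
      unfolding V_def
    proof (rule integral_le)
      fix a
      have "S t a + e \<le> 2 * e" "0 < S t a + e"
        using c(2)[of t a] t r e S_nonneg[of t a] unfolding e_def by auto
      then show "ln (S t a + e) \<le> ln (2 * e)" using e by simp
    qed (use V_integrable e t r in auto)
    then show ?thesis using e by (simp add: ln_mult)
  qed
  \<comment> \<open>The choice \<open>al = pi / M\<close> makes the coefficient of
    \<open>ln (1/e)\<close> half of the one on the left.\<close>
  have "V e r - V e t \<le> (pi / M) * (M * (1 - ln e)) + 2 * pi / (pi / M) * (ln r - ln t)"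
    by (rule MV) (use e t M in auto)
  also have "\<dots> = pi * (1 - ln e) + 2 * M * (ln r + y)"
    using M by (simp add: lt)
  finally have "2 * pi * ln d - 2 * pi * (ln 2 + ln e) \<le> pi * (1 - ln e) + 2 * M * (ln r + y)"
    using Vr Vt by linarith
  then have "(pi * real n) * y - 2 * M * y \<le> k"
    by (simp add: k_def le algebra_simps)
  moreover have "(2 * M + 1) * y \<le> (pi * real n) * y"
    using n y by (intro mult_right_mono) auto
  ultimately have "y \<le> k" by (simp add: algebra_simps)
  then show False using y by linarith
qed

section \<open>Behaviour near a zero of finite order\<close>

text \<open>Young's inequality applied to the Jacobian in \<open>quasi\<close> leaves half of the
  angular part on the left.\<close>

lemma angular_le_radial:
  assumes t: "0 < t" "t \<le> R"
  shows "(Pa t a)\<^sup>2 + (Qa t a)\<^sup>2 \<le> K\<^sup>2 * (t\<^sup>2 * ((Pt t a)\<^sup>2 + (Qt t a)\<^sup>2)) + 2 * C * t\<^sup>2 * S t a"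
proof -
  have "K * (Pa t a * (t * Qt t a)) \<le> (Pa t a)\<^sup>2 / 2 + K\<^sup>2 * (t * Qt t a)\<^sup>2 / 2"
    by (rule mult_le_sum_squares)
  moreover have "K * (- Qa t a * (t * Pt t a)) \<le> (- Qa t a)\<^sup>2 / 2 + K\<^sup>2 * (t * Pt t a)\<^sup>2 / 2"
    by (rule mult_le_sum_squares)
  moreover have "0 \<le> t\<^sup>2 * ((Pt t a)\<^sup>2 + (Qt t a)\<^sup>2)" by simp
  ultimately show ?thesis
    using quasi[OF t, of a] unfolding S_def
    by (simp only: power_mult_distrib algebra_simps mult_minus_left mult_minus_right power2_minus)
qed

text \<open>Gronwall along the circle. The approximate Euler relation \<open>D\<close> bounds
  \<open>t\<close> times the radial derivative by \<open>m |w|\<close> up to an error,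
  \<open>angular_le_radial\<close> passes this on to the angular derivative, and so the derivative
  of \<open>ln (S + T)\<close> is bounded by a constant. Adding \<open>T\<close> absorbs the error
  and keeps the logarithm finite at possible zeros.\<close>

lemma circle_lower_bound:
  assumes t: "0 < t" "t \<le> R" "t \<le> 1" and a: "a0 \<in> {0..2*pi}" "a \<in> {0..2*pi}"
    and D: "\<And>a. a \<in> {0..2*pi} \<Longrightarrow> (t * Pt t a - m * P t a)\<^sup>2 + (t * Qt t a - m * Q t a)\<^sup>2 \<le> T" and T: "0 < T"
  shows "exp (- 2 * pi * (K\<^sup>2 * (2 * m\<^sup>2 + 2) + 2 * C + 1)) * S t a0 - T \<le> S t a"
proof -
  define L where "L = K\<^sup>2 * (2 * m\<^sup>2 + 2) + 2 * C + 1"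
  have "ln (S t a0 + T) - ln (S t a + T) \<le> integral {0..2*pi} (\<lambda>a. L)"
  proof (rule diff_le_integral_of_deriv_bound[where w = "\<lambda>a. ln (S t a + T)" and
      w' = "\<lambda>a. 2 * (P t a * Pa t a + Q t a * Qa t a) / (S t a + T)"])
    fix z assume z: "0 \<le> z" "z \<le> 2*pi"
    have ST: "0 < S t z + T" using S_nonneg[of t z] T by simp
    have "((\<lambda>a. ln (S t a + T)) has_real_derivative 2 * (P t z * Pa t z + Q t z * Qa t z) / (S t z + T)) (at z)"
      using ST S_deriv_a[of t z] t by (auto intro!: derivative_eq_intros)
    then show "((\<lambda>a. ln (S t a + T)) has_real_derivative 2 * (P t z * Pa t z + Q t z * Qa t z) / (S t z + T)) (at z within {0..2*pi})"
      by (rule DERIV_subset) simp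
    have x: "t\<^sup>2 * ((Pt t z)\<^sup>2 + (Qt t z)\<^sup>2) \<le> 2 * m\<^sup>2 * S t z + 2 * T"
    proof -
      have "(t * Pt t z)\<^sup>2 \<le> 2 * (m * P t z)\<^sup>2 + 2 * (t * Pt t z - m * P t z)\<^sup>2"
        "(t * Qt t z)\<^sup>2 \<le> 2 * (m * Q t z)\<^sup>2 + 2 * (t * Qt t z - m * Q t z)\<^sup>2"
        using square_add_le[of "m * P t z" "t * Pt t z - m * P t z"]
          square_add_le[of "m * Q t z" "t * Qt t z - m * Q t z"] by auto
      then show ?thesis
        using D[of z] z unfolding S_def power_mult_distrib distrib_left by simp
    qed
    have "(Pa t z)\<^sup>2 + (Qa t z)\<^sup>2 \<le> K\<^sup>2 * (t\<^sup>2 * ((Pt t z)\<^sup>2 + (Qt t z)\<^sup>2)) + 2 * C * t\<^sup>2 * S t z"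
      using t by (intro angular_le_radial)
    also have "\<dots> \<le> K\<^sup>2 * (2 * m\<^sup>2 * S t z + 2 * T) + 2 * C * 1 * S t z"
      using x t C power_le_one[of t 2] S_nonneg[of t z]
      by (intro add_mono mult_left_mono mult_right_mono) auto
    finally have y: "(Pa t z)\<^sup>2 + (Qa t z)\<^sup>2 \<le> K\<^sup>2 * (2 * m\<^sup>2 * S t z + 2 * T) + 2 * C * S t z" by simp
    have "\<bar>2 * (P t z * Pa t z + Q t z * Qa t z)\<bar> \<le> S t z + ((Pa t z)\<^sup>2 + (Qa t z)\<^sup>2)"
    proof -
      have "0 \<le> (P t z - Pa t z)\<^sup>2 + (Q t z - Qa t z)\<^sup>2" "0 \<le> (P t z + Pa t z)\<^sup>2 + (Q t z + Qa t z)\<^sup>2" by auto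
      then show ?thesis unfolding S_def power2_eq_square by (auto simp: abs_if algebra_simps)
    qed
    also have "\<dots> \<le> S t z + (K\<^sup>2 * (2 * m\<^sup>2 * S t z + 2 * T) + 2 * C * S t z)"
      using y by simp
    also have "\<dots> \<le> L * (S t z + T)"
    proof -
      have "0 \<le> (K\<^sup>2 * (2 * m\<^sup>2)) * T" "0 \<le> C * T" "0 \<le> K\<^sup>2 * S t z"
        using T C S_nonneg[of t z] by auto
      then show ?thesis using T by (simp add: L_def algebra_simps)
    qed
    finally show "\<bar>2 * (P t z * Pa t z + Q t z * Qa t z) / (S t z + T)\<bar> \<le> L"
      using ST by (simp add: field_simps)
  qed (use a in auto)
  then have "ln (S t a0 + T) - 2 * pi * L \<le> ln (S t a + T)" by simp
  then have "exp (ln (S t a0 + T) + (- 2 * pi * L)) \<le> S t a + T"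
    using T S_nonneg[of t a] by (simp add: ln_ge_iff)
  then have "(S t a0 + T) * exp (- 2 * pi * L) \<le> S t a + T"
    using T S_nonneg[of t a0] unfolding exp_add by simp
  moreover have "0 \<le> T * exp (- 2 * pi * L)" using T by simp
  ultimately show ?thesis unfolding L_def[symmetric] by (simp add: algebra_simps)
qed

text \<open>Gronwall spreads the lower bound from the single direction \<open>a0\<close> to all
  directions. For small \<open>t\<close> the errors in \<open>D\<close> and the term
  \<open>C t\<^sup>2 S\<close> are then small multiples of the radial energy and can be
  absorbed.\<close>

lemma local_structure:
  assumes R1: "R \<le> 1" and m: "1 \<le> (m::nat)" and a0: "a0 \<in> {0..2*pi}" and k: "0 < k"
    and D: "\<And>t a. 0 < t \<Longrightarrow> t \<le> R \<Longrightarrow> a \<in> {0..2*pi} \<Longrightarrow>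
       (t * Pt t a - m * P t a)\<^sup>2 + (t * Qt t a - m * Q t a)\<^sup>2 \<le> D * (t ^ m * t)\<^sup>2"
    and lower: "\<And>t. 0 < t \<Longrightarrow> t \<le> R \<Longrightarrow> k * (t ^ m)\<^sup>2 \<le> S t a0"
  shows "\<exists>r>0. r \<le> R \<and> (\<forall>t a. 0 < t \<longrightarrow> t \<le> r \<longrightarrow> a \<in> {0..2*pi} \<longrightarrow>
     0 < t\<^sup>2 * ((Pt t a)\<^sup>2 + (Qt t a)\<^sup>2) + ((Pa t a)\<^sup>2 + (Qa t a)\<^sup>2) \<and>
     t\<^sup>2 * ((Pt t a)\<^sup>2 + (Qt t a)\<^sup>2) + ((Pa t a)\<^sup>2 + (Qa t a)\<^sup>2) \<le> 2 * K * t * (Pa t a * Qt t a - Pt t a * Qa t a) \<and>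
     P t a * Qa t a - Q t a * Pa t a < 0 \<and>
     4 * K\<^sup>2 * ((t * Pt t a - m * P t a)\<^sup>2 + (t * Qt t a - m * Q t a)\<^sup>2)
       < t\<^sup>2 * ((Pt t a)\<^sup>2 + (Qt t a)\<^sup>2) + ((Pa t a)\<^sup>2 + (Qa t a)\<^sup>2))"
proof -
  define D1 where "D1 = max D 1"
  define q where "q = exp (- 2 * pi * (K\<^sup>2 * (2 * (real m)\<^sup>2 + 2) + 2 * C + 1))"
  have q: "0 < q" by (simp add: q_def)
  \<comment> \<open>Half of the Gronwall bound \<open>q * k\<close>; the other half covers the error
    \<open>T\<close>.\<close>
  define c where "c = q * k / 2"
  have c: "0 < c" using q k by (simp add: c_def)
  \<comment> \<open>It dominates the three coefficients \<open>8 C\<close>, \<open>4 D1 / c\<close>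
    and \<open>16 K\<^sup>2 D1 / c\<close>, each of which has to be at most \<open>1/2\<close> after
    multiplication by \<open>t\<^sup>2\<close>.\<close>
  define M where "M = D1 / c * (4 + 16 * K\<^sup>2) + 8 * C"
  have D1: "1 \<le> D1" "D \<le> D1" by (auto simp: D1_def)
  have M: "0 < M" "8 * C \<le> M" "D1 / c * 4 \<le> M" "D1 / c * (16 * K\<^sup>2) \<le> M"
    using D1 c C by (auto simp: M_def distrib_left intro!: add_pos_nonneg)
  define r where "r = min R (min (sqrt (c / D1)) (sqrt (1 / (2 * M))))"
  have r: "0 < r" "r \<le> R" using R c D1 M by (auto simp: r_def)
  have "\<forall>t a. 0 < t \<longrightarrow> t \<le> r \<longrightarrow> a \<in> {0..2*pi} \<longrightarrow>
     0 < t\<^sup>2 * ((Pt t a)\<^sup>2 + (Qt t a)\<^sup>2) + ((Pa t a)\<^sup>2 + (Qa t a)\<^sup>2) \<and>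
     t\<^sup>2 * ((Pt t a)\<^sup>2 + (Qt t a)\<^sup>2) + ((Pa t a)\<^sup>2 + (Qa t a)\<^sup>2) \<le> 2 * K * t * (Pa t a * Qt t a - Pt t a * Qa t a) \<and>
     P t a * Qa t a - Q t a * Pa t a < 0 \<and>
     4 * K\<^sup>2 * ((t * Pt t a - m * P t a)\<^sup>2 + (t * Qt t a - m * Q t a)\<^sup>2)
       < t\<^sup>2 * ((Pt t a)\<^sup>2 + (Qt t a)\<^sup>2) + ((Pa t a)\<^sup>2 + (Qa t a)\<^sup>2)"
  proof (intro allI impI)
    fix t a assume t: "0 < t" "t \<le> r" and a: "a \<in> {0..2*pi}"
    have tR: "t \<le> R" "t \<le> 1" using t r R1 by auto
    have "t\<^sup>2 \<le> (sqrt (c / D1))\<^sup>2" "t\<^sup>2 \<le> (sqrt (1 / (2 * M)))\<^sup>2"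
      using t by (auto simp: r_def intro!: power_mono)
    then have t2: "t\<^sup>2 \<le> c / D1" "t\<^sup>2 \<le> 1 / (2 * M)" using c D1 M by auto
    define T where "T = D1 * (t ^ m * t)\<^sup>2"
    define s where "s = S t a"
    define d1 where "d1 = t * Pt t a - m * P t a"
    define d2 where "d2 = t * Qt t a - m * Q t a"
    define X where "X = t\<^sup>2 * ((Pt t a)\<^sup>2 + (Qt t a)\<^sup>2)"
    define Y where "Y = (Pa t a)\<^sup>2 + (Qa t a)\<^sup>2"
    define J where "J = Pa t a * Qt t a - Pt t a * Qa t a"
    have T0: "0 < T" using t D1 by (simp add: T_def)
    have DT: "(t * Pt t a - m * P t a)\<^sup>2 + (t * Qt t a - m * Q t a)\<^sup>2 \<le> T" if "a \<in> {0..2*pi}" for a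
      using D[OF t(1) tR(1) that] mult_right_mono[OF D1(2), of "(t ^ m * t)\<^sup>2"] unfolding T_def by simp
    have "q * S t a0 - T \<le> s"
      unfolding q_def s_def using circle_lower_bound[OF t(1) tR a0 a DT T0] by simp
    moreover have "q * (k * (t ^ m)\<^sup>2) \<le> q * S t a0"
      using lower[OF t(1) tR(1)] q by (intro mult_left_mono) auto
    moreover have "T = (D1 * t\<^sup>2) * (t ^ m)\<^sup>2"
      by (simp add: T_def power_mult_distrib)
    moreover have "(D1 * t\<^sup>2) * (t ^ m)\<^sup>2 \<le> c * (t ^ m)\<^sup>2"
      using t2(1) D1 by (intro mult_right_mono) (auto simp: field_simps)
    moreover have "q * (k * (t ^ m)\<^sup>2) = 2 * (c * (t ^ m)\<^sup>2)" by (simp add: c_def)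
    ultimately have s: "c * (t ^ m)\<^sup>2 \<le> s" by linarith
    have s0: "0 < s" using s c t by (auto intro: less_le_trans[rotated])
    have Ts: "T \<le> (D1 / c) * t\<^sup>2 * s"
    proof -
      have "T = (D1 / c) * t\<^sup>2 * (c * (t ^ m)\<^sup>2)"
        using c by (simp add: T_def power_mult_distrib)
      also have "\<dots> \<le> (D1 / c) * t\<^sup>2 * s"
        using s c D1 by (intro mult_left_mono) auto
      finally show ?thesis .
    qed
    have bnd: "v * t\<^sup>2 \<le> 1 / 2" if "v \<le> M" for v
    proof -
      have "v * t\<^sup>2 \<le> M * t\<^sup>2" using that by (intro mult_right_mono) auto
      also have "\<dots> \<le> M * (1 / (2 * M))" using t2(2) M by (intro mult_left_mono) auto
      finally show ?thesis using M by simp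
    qed
    have dT: "d1\<^sup>2 + d2\<^sup>2 \<le> T"
      using DT[OF a] by (simp add: d1_def d2_def)
    \<comment> \<open>As \<open>m \<ge> 1\<close>, \<open>|w|\<close> is at most
      \<open>|m w|\<close>, which is \<open>t\<close> times the radial derivative up to
      \<open>d1\<close> and \<open>d2\<close>.\<close>
    have X: "s \<le> 4 * X"
    proof -
      have "(m * P t a)\<^sup>2 \<le> 2 * (t * Pt t a)\<^sup>2 + 2 * d1\<^sup>2" "(m * Q t a)\<^sup>2 \<le> 2 * (t * Qt t a)\<^sup>2 + 2 * d2\<^sup>2"
        using square_add_le[of "t * Pt t a" "- d1"] square_add_le[of "t * Qt t a" "- d2"]
        by (auto simp: d1_def d2_def power2_commute)
      then have "(real m)\<^sup>2 * s \<le> 2 * X + 2 * (d1\<^sup>2 + d2\<^sup>2)"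
        unfolding s_def S_def X_def power_mult_distrib distrib_left by simp
      moreover have "s \<le> (real m)\<^sup>2 * s" using mult_right_mono[of 1 "(real m)\<^sup>2" s] m s0 by simp
      ultimately have "s \<le> 2 * X + 2 * (d1\<^sup>2 + d2\<^sup>2)" by (rule order_trans[rotated])
      moreover have "4 * ((D1 / c) * t\<^sup>2 * s) \<le> 1 / 2 * s"
      proof -
        have "4 * ((D1 / c) * t\<^sup>2 * s) = (D1 / c * 4 * t\<^sup>2) * s" by simp
        also have "\<dots> \<le> 1 / 2 * s"
          using bnd[OF M(3)] s0 by (intro mult_right_mono) auto
        finally show ?thesis .
      qed
      then have "4 * T \<le> 1 / 2 * s" using Ts by linarith
      moreover have "0 \<le> X" by (simp add: X_def)
      ultimately have "s \<le> 2 * X + 2 * T" "0 \<le> X" "T \<le> s / 8" using dT by simp_all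
      then show ?thesis by simp
    qed
    have CX: "C * t\<^sup>2 * s \<le> X / 2"
    proof -
      have "8 * (C * t\<^sup>2 * s) = (8 * C * t\<^sup>2) * s" by simp
      also have "\<dots> \<le> 1 / 2 * s"
        using bnd[of "8 * C"] M s0 by (intro mult_right_mono) auto
      finally have "C * t\<^sup>2 * s \<le> s / 16" by linarith
      then show ?thesis using X s0 by linarith
    qed
    have Y0: "0 \<le> Y" by (simp add: Y_def)
    have X0: "0 < X" using X s0 by simp
    have dX: "16 * K\<^sup>2 * (d1\<^sup>2 + d2\<^sup>2) \<le> 2 * X"
    proof -
      have "16 * K\<^sup>2 * (d1\<^sup>2 + d2\<^sup>2) \<le> 16 * K\<^sup>2 * ((D1 / c) * t\<^sup>2 * s)"
        using dT Ts by (intro mult_left_mono) auto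
      also have "\<dots> = (D1 / c * (16 * K\<^sup>2) * t\<^sup>2) * s" by simp
      also have "\<dots> \<le> 1 / 2 * s"
        using bnd[OF M(4)] s0 by (intro mult_right_mono) auto
      finally show ?thesis using X by simp
    qed
    have J: "X + Y \<le> 2 * K * t * J"
    proof -
      have "X + Y \<le> K * t * J + C * t\<^sup>2 * s"
        using quasi[OF t(1) tR(1), of a] by (simp add: X_def Y_def J_def s_def S_def)
      then show ?thesis using CX X0 Y0 by simp
    qed
    have "P t a * Qa t a - Q t a * Pa t a < 0"
    proof -
      \<comment> \<open>Writing \<open>m * P\<close> and \<open>m * Q\<close> as
        \<open>t * Pt - d1\<close> and \<open>t * Qt - d2\<close> turns the rotation rate into
        \<open>- t * J\<close> plus errors that \<open>X\<close> and \<open>Y\<close>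
        absorb.\<close>
      have "2 * K * (m * (P t a * Qa t a - Q t a * Pa t a)) =
        - (2 * K * t * J) + (2 * K) * (Qa t a * - d1) + (2 * K) * (Pa t a * d2)"
        by (simp add: J_def d1_def d2_def algebra_simps)
      moreover have "(2 * K) * (Qa t a * - d1) \<le> (Qa t a)\<^sup>2 / 2 + (2 * K)\<^sup>2 * (- d1)\<^sup>2 / 2"
        "(2 * K) * (Pa t a * d2) \<le> (Pa t a)\<^sup>2 / 2 + (2 * K)\<^sup>2 * d2\<^sup>2 / 2"
        by (rule mult_le_sum_squares)+
      ultimately have "2 * K * (m * (P t a * Qa t a - Q t a * Pa t a)) \<le> - (2 * K * t * J) + Y / 2 + 2 * K\<^sup>2 * (d1\<^sup>2 + d2\<^sup>2)"
        unfolding Y_def power_mult_distrib distrib_left power2_minus add_divide_distrib mult.assoc by simp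
      also have "\<dots> < 0" using J dX X0 Y0 by linarith
      finally show ?thesis using K m by (simp add: mult_less_0_iff)
    qed
    moreover have "4 * K\<^sup>2 * (d1\<^sup>2 + d2\<^sup>2) < X + Y" using dX X0 Y0 by simp
    ultimately show "0 < t\<^sup>2 * ((Pt t a)\<^sup>2 + (Qt t a)\<^sup>2) + ((Pa t a)\<^sup>2 + (Qa t a)\<^sup>2) \<and>
     t\<^sup>2 * ((Pt t a)\<^sup>2 + (Qt t a)\<^sup>2) + ((Pa t a)\<^sup>2 + (Qa t a)\<^sup>2) \<le> 2 * K * t * (Pa t a * Qt t a - Pt t a * Qa t a) \<and>
     P t a * Qa t a - Q t a * Pa t a < 0 \<and>
     4 * K\<^sup>2 * ((t * Pt t a - m * P t a)\<^sup>2 + (t * Qt t a - m * Q t a)\<^sup>2)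
       < t\<^sup>2 * ((Pt t a)\<^sup>2 + (Qt t a)\<^sup>2) + ((Pa t a)\<^sup>2 + (Qa t a)\<^sup>2)"
      unfolding X_def[symmetric] Y_def[symmetric] J_def[symmetric] d1_def[symmetric] d2_def[symmetric]
      using X0 Y0 J by simp
  qed
  then show ?thesis using r by blast
qed

end

section \<open>Smooth functions in the plane\<close>

lemma has_real_derivative_along_curve:
  fixes g :: "'a::real_normed_vector \<Rightarrow> real"
  assumes "g differentiable at (c t)" "(c has_vector_derivative v) (at t)"
  shows "((\<lambda>t. g (c t)) has_real_derivative frechet_derivative g (at (c t)) v) (at t)"
proof -
  have g: "(g has_derivative frechet_derivative g (at (c t))) (at (c t))"
    using assms(1) frechet_derivative_works by blast
  have "(g \<circ> c has_derivative frechet_derivative g (at (c t)) \<circ> (\<lambda>x. x *\<^sub>R v)) (at t)"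
    using diff_chain_at[OF assms(2)[unfolded has_vector_derivative_def] g] .
  moreover have "frechet_derivative g (at (c t)) \<circ> (\<lambda>x. x *\<^sub>R v) = (*) (frechet_derivative g (at (c t)) v)"
    by (rule ext) (simp add: linear_cmul[OF has_derivative_linear[OF g]])
  ultimately show ?thesis
    unfolding has_field_derivative_def by (simp add: o_def)
qed

lemma frechet_derivative_real2:
  fixes g :: "real^2 \<Rightarrow> real"
  assumes "g differentiable at x"
  shows "frechet_derivative g (at x) v = v $ 1 * partial 1 g x + v $ 2 * partial 2 g x"
proof -
  have l: "linear (frechet_derivative g (at x))"
    using assms frechet_derivative_works has_derivative_linear by blast
  have v: "v = v $ 1 *\<^sub>R axis 1 1 + v $ 2 *\<^sub>R axis 2 1"
    by (simp add: vec_eq_iff forall_2 axis_def)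
  show ?thesis
    by (subst v) (simp add: partial_def linear_add[OF l] linear_cmul[OF l])
qed

lemma smooth_on_partial: "smooth_on f S \<Longrightarrow> smooth_on (partial i f) S"
  unfolding smooth_on_def using Ck_on.simps(2) by blast

lemma smooth_on_continuous: "smooth_on f S \<Longrightarrow> continuous_on S f"
  unfolding smooth_on_def using Ck_on.simps(1) by blast

lemma smooth_on_differentiable: "smooth_on f S \<Longrightarrow> x \<in> S \<Longrightarrow> f differentiable (at x)"
  unfolding smooth_on_def using Ck_on.simps(2) by blast

lemma Ck_on_subset: "Ck_on k f S \<Longrightarrow> T \<subseteq> S \<Longrightarrow> Ck_on k f T"
  by (induction k arbitrary: f) (auto intro: continuous_on_subset)

lemma smooth_on_subset: "smooth_on f S \<Longrightarrow> T \<subseteq> S \<Longrightarrow> smooth_on f T"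
  unfolding smooth_on_def using Ck_on_subset by blast

text \<open>The mean value theorem is applied first in direction \<open>i\<close>, then in direction
  \<open>j\<close>. The left-hand side is symmetric in \<open>i\<close> and \<open>j\<close>, which
  is what permits exchanging the order of differentiation.\<close>

lemma second_difference:
  fixes f :: "real^'n::finite \<Rightarrow> real"
  assumes f: "smooth_on f (ball x r)" and h: "0 < h" "2 * h < r"
  shows "\<exists>y\<in>cball x (2 * h). f (x + h *\<^sub>R axis i 1 + h *\<^sub>R axis j 1) - f (x + h *\<^sub>R axis i 1)
    - f (x + h *\<^sub>R axis j 1) + f x = h * (h * partial j (partial i f) y)"
proof -
  let ?e = "axis i 1 :: real^'n" and ?e' = "axis j 1 :: real^'n"
  have h0: "0 \<le> h" using h by simp
  have near: "norm (s *\<^sub>R ?e + t *\<^sub>R ?e') \<le> 2 * h" if "0 \<le> s" "s \<le> h" "0 \<le> t" "t \<le> h" for s t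
    using norm_triangle_ineq[of "s *\<^sub>R ?e" "t *\<^sub>R ?e'"] that by simp
  have dst: "dist x (x + s *\<^sub>R ?e + t *\<^sub>R ?e') = norm (s *\<^sub>R ?e + t *\<^sub>R ?e')" for s t
  proof -
    have "dist x (x + v) = norm v" for v by (simp add: dist_norm)
    then show ?thesis by (metis add.assoc)
  qed
  have inb: "x + s *\<^sub>R ?e + t *\<^sub>R ?e' \<in> ball x r" if "0 \<le> s" "s \<le> h" "0 \<le> t" "t \<le> h" for s t
    using near[OF that] h by (simp add: dst)
  have d1: "((\<lambda>s. g (x + s *\<^sub>R ?e + t *\<^sub>R ?e')) has_real_derivative partial i g (x + s *\<^sub>R ?e + t *\<^sub>R ?e')) (at s)"
    if "0 \<le> s" "s \<le> h" "0 \<le> t" "t \<le> h" "smooth_on g (ball x r)" for s t g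
    unfolding partial_def
    by (rule has_real_derivative_along_curve[of g "\<lambda>s. x + s *\<^sub>R ?e + t *\<^sub>R ?e'"])
      (use smooth_on_differentiable[OF that(5) inb] that in \<open>auto intro!: derivative_eq_intros\<close>)
  have d2: "((\<lambda>t. g (x + s *\<^sub>R ?e + t *\<^sub>R ?e')) has_real_derivative partial j g (x + s *\<^sub>R ?e + t *\<^sub>R ?e')) (at t)"
    if "0 \<le> s" "s \<le> h" "0 \<le> t" "t \<le> h" "smooth_on g (ball x r)" for s t g
    unfolding partial_def
    by (rule has_real_derivative_along_curve[of g "\<lambda>t. x + s *\<^sub>R ?e + t *\<^sub>R ?e'"])
      (use smooth_on_differentiable[OF that(5) inb] that in \<open>auto intro!: derivative_eq_intros\<close>)
  have "\<exists>s. 0 < s \<and> s < h \<and>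
     (f (x + h *\<^sub>R ?e + h *\<^sub>R ?e') - f (x + h *\<^sub>R ?e + 0 *\<^sub>R ?e'))
     - (f (x + 0 *\<^sub>R ?e + h *\<^sub>R ?e') - f (x + 0 *\<^sub>R ?e + 0 *\<^sub>R ?e'))
     = (h - 0) * (partial i f (x + s *\<^sub>R ?e + h *\<^sub>R ?e') - partial i f (x + s *\<^sub>R ?e + 0 *\<^sub>R ?e'))"
    by (rule MVT2[of 0 h "\<lambda>s. f (x + s *\<^sub>R ?e + h *\<^sub>R ?e') - f (x + s *\<^sub>R ?e + 0 *\<^sub>R ?e')"])
      (assumption | rule h h0 DERIV_diff d1[of _ _ f] f order_refl)+
  then obtain s where s: "0 < s" "s < h" and
    1: "f (x + h *\<^sub>R ?e + h *\<^sub>R ?e') - f (x + h *\<^sub>R ?e) - f (x + h *\<^sub>R ?e') + f x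
     = h * (partial i f (x + s *\<^sub>R ?e + h *\<^sub>R ?e') - partial i f (x + s *\<^sub>R ?e + 0 *\<^sub>R ?e'))"
    by auto
  have "\<exists>t. 0 < t \<and> t < h \<and> partial i f (x + s *\<^sub>R ?e + h *\<^sub>R ?e') - partial i f (x + s *\<^sub>R ?e + 0 *\<^sub>R ?e')
     = (h - 0) * partial j (partial i f) (x + s *\<^sub>R ?e + t *\<^sub>R ?e')"
    by (rule MVT2[of 0 h "\<lambda>t. partial i f (x + s *\<^sub>R ?e + t *\<^sub>R ?e')"])
      (assumption | rule h d2[of _ _ "partial i f"] smooth_on_partial f s[THEN less_imp_le])+
  then obtain t where t: "0 < t" "t < h" and
    2: "partial i f (x + s *\<^sub>R ?e + h *\<^sub>R ?e') - partial i f (x + s *\<^sub>R ?e + 0 *\<^sub>R ?e')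
     = h * partial j (partial i f) (x + s *\<^sub>R ?e + t *\<^sub>R ?e')"
    by auto
  have "x + s *\<^sub>R ?e + t *\<^sub>R ?e' \<in> cball x (2 * h)"
    using near[of s t] s t by (simp add: dst)
  then show ?thesis
    by (rule rev_bexI) (rule 1[unfolded 2])
qed

text \<open>The second difference, computed in both orders, gives a common value of the two mixed
  derivatives at points within \<open>2 * h\<close> of \<open>x\<close>; continuity at
  \<open>x\<close> does the rest.\<close>

lemma partial_commute:
  fixes f :: "real^'n::finite \<Rightarrow> real"
  assumes "open S" "smooth_on f S" "x \<in> S"
  shows "partial i (partial j f) x = partial j (partial i f) x"
proof (rule ccontr)
  define G H where "G = partial i (partial j f)" and "H = partial j (partial i f)"
  assume "\<not> ?thesis"
  then have e: "0 < \<bar>G x - H x\<bar> / 2" by (simp add: G_def H_def)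
  obtain r where r: "0 < r" "ball x r \<subseteq> S" using assms open_contains_ball by blast
  have "continuous_on S G" "continuous_on S H"
    unfolding G_def H_def by (intro smooth_on_continuous smooth_on_partial assms)+
  then have "isCont G x" "isCont H x"
    using assms continuous_on_eq_continuous_at by blast+
  then obtain d1 d2 where d: "0 < d1" "0 < d2"
    and d1: "\<And>y. dist y x < d1 \<Longrightarrow> dist (G y) (G x) < \<bar>G x - H x\<bar> / 2"
    and d2: "\<And>y. dist y x < d2 \<Longrightarrow> dist (H y) (H x) < \<bar>G x - H x\<bar> / 2"
    using e unfolding continuous_at_eps_delta by metis
  define h where "h = min r (min d1 d2) / 3"
  have h: "0 < h" "2 * h < r" "2 * h < d1" "2 * h < d2" using r d by (auto simp: h_def)
  have f: "smooth_on f (ball x r)" using smooth_on_subset assms r by blast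
  obtain y where y: "y \<in> cball x (2 * h)" "f (x + h *\<^sub>R axis j 1 + h *\<^sub>R axis i 1) - f (x + h *\<^sub>R axis j 1)
    - f (x + h *\<^sub>R axis i 1) + f x = h * (h * G y)"
    using second_difference[OF f h(1,2), of j i] unfolding G_def by blast
  obtain z where z: "z \<in> cball x (2 * h)" "f (x + h *\<^sub>R axis i 1 + h *\<^sub>R axis j 1) - f (x + h *\<^sub>R axis i 1)
    - f (x + h *\<^sub>R axis j 1) + f x = h * (h * H z)"
    using second_difference[OF f h(1,2), of i j] unfolding H_def by blast
  have "h * (h * G y) = h * (h * H z)"
    unfolding y(2)[symmetric] z(2)[symmetric] by (simp add: add.commute add.left_commute)
  then have "G y = H z" using h by simp
  moreover have "dist (G y) (G x) < \<bar>G x - H x\<bar> / 2" using y h by (intro d1) (auto simp: dist_commute)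
  moreover have "dist (H z) (H x) < \<bar>G x - H x\<bar> / 2" using z h by (intro d2) (auto simp: dist_commute)
  ultimately show False by (auto simp: dist_real_def abs_if split: if_splits)
qed

section \<open>Polar coordinates around a point\<close>

definition polar :: "real^2 \<Rightarrow> real \<Rightarrow> real \<Rightarrow> real^2" where
  "polar z t a = z + t *\<^sub>R vector [cos a, sin a]"

lemma norm_vector_cos_sin [simp]: "norm (vector [cos a, sin a] :: real^2) = 1"
  by (simp add: norm_vec_def L2_set_def sum_2)

lemma dist_polar: "dist z (polar z t a) = \<bar>t\<bar>"
  by (simp add: polar_def dist_norm)

lemma polar_0 [simp]: "polar z 0 a = z"
  by (simp add: polar_def)

lemma polar_2pi: "polar z t (2 * pi) = polar z t 0"
  by (simp add: polar_def)

lemma polar_surj: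
  obtains t a where "x = polar z t a" "t = dist z x" "0 \<le> a" "a \<le> 2 * pi"
proof (cases "x = z")
  case True
  then show ?thesis using that[of 0 0] by simp
next
  case False
  define v where "v = x - z"
  have v: "norm v \<noteq> 0" using False by (simp add: v_def)
  have n: "(norm v)\<^sup>2 = (v $ 1)\<^sup>2 + (v $ 2)\<^sup>2"
    by (simp add: norm_vec_def L2_set_def sum_2)
  have "(v $ 1 / norm v)\<^sup>2 + (v $ 2 / norm v)\<^sup>2 = ((v $ 1)\<^sup>2 + (v $ 2)\<^sup>2) / (norm v)\<^sup>2"
    by (simp add: power_divide add_divide_distrib)
  also have "\<dots> = 1"
    unfolding n[symmetric] using v by simp
  finally have "(v $ 1 / norm v)\<^sup>2 + (v $ 2 / norm v)\<^sup>2 = 1" .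
  then obtain a where a: "0 \<le> a" "a < 2 * pi" "v $ 1 / norm v = cos a" "v $ 2 / norm v = sin a"
    using sincos_total_2pi by metis
  have "x = polar z (norm v) a"
    using v by (simp add: polar_def vec_eq_iff forall_2 a(3,4)[symmetric]) (simp add: v_def)
  then show ?thesis
    using that[of "norm v" a] a by (simp add: v_def dist_norm norm_minus_commute)
qed

lemma polar_deriv_t: "((\<lambda>t. polar z t a) has_vector_derivative vector [cos a, sin a]) (at t)"
  unfolding polar_def by (auto intro!: derivative_eq_intros)

lemma polar_deriv_a: "((\<lambda>a. polar z t a) has_vector_derivative vector [- t * sin a, t * cos a]) (at a)"
proof -
  have eq: "polar z t a = z + (t * cos a) *\<^sub>R axis 1 1 + (t * sin a) *\<^sub>R axis 2 1" for a
    by (simp add: polar_def vec_eq_iff forall_2 axis_def)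
  have v: "vector [- t * sin a, t * cos a] = (- t * sin a) *\<^sub>R axis 1 1 + (t * cos a) *\<^sub>R (axis 2 1 :: real^2)"
    by (simp add: vec_eq_iff forall_2 axis_def)
  show ?thesis
    unfolding eq v by (auto intro!: derivative_eq_intros simp: has_vector_derivative_def algebra_simps)
qed

lemma continuous_on_polar [continuous_intros]:
  fixes A :: "'a::t2_space set"
  assumes "continuous_on A f" "continuous_on A g"
  shows "continuous_on A (\<lambda>x. polar z (f x) (g x))"
proof -
  have eq: "polar z t a = z + (t * cos a) *\<^sub>R axis 1 1 + (t * sin a) *\<^sub>R axis 2 1" for t a
    by (simp add: polar_def vec_eq_iff forall_2 axis_def)
  show ?thesis unfolding eq by (intro continuous_intros assms)
qed

lemma polar_chain_t:
  assumes "g differentiable at (polar z t a)"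
  shows "((\<lambda>t. g (polar z t a)) has_real_derivative
    cos a * partial 1 g (polar z t a) + sin a * partial 2 g (polar z t a)) (at t)"
  using has_real_derivative_along_curve[OF assms polar_deriv_t]
  by (simp add: frechet_derivative_real2[OF assms])

lemma polar_chain_a:
  assumes "g differentiable at (polar z t a)"
  shows "((\<lambda>a. g (polar z t a)) has_real_derivative
    t * (cos a * partial 2 g (polar z t a) - sin a * partial 1 g (polar z t a))) (at a)"
  using has_real_derivative_along_curve[OF assms polar_deriv_a]
  by (simp add: frechet_derivative_real2[OF assms] algebra_simps)

section \<open>Strong unique continuation\<close>

lemma rotation_sum_squares:
  fixes c s x y :: real
  assumes "c\<^sup>2 + s\<^sup>2 = 1"
  shows "(c * x + s * y)\<^sup>2 + (c * y - s * x)\<^sup>2 = x\<^sup>2 + y\<^sup>2"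
proof -
  have "(c * x + s * y)\<^sup>2 + (c * y - s * x)\<^sup>2 = (c\<^sup>2 + s\<^sup>2) * (x\<^sup>2 + y\<^sup>2)"
    by (simp add: power2_eq_square algebra_simps)
  then show ?thesis using assms by simp
qed

lemma rotation_det:
  fixes c s x y x' y' :: real
  assumes "c\<^sup>2 + s\<^sup>2 = 1"
  shows "(c * y - s * x) * (c * x' + s * y') - (c * x + s * y) * (c * y' - s * x') = y * x' - x * y'"
proof -
  have "(c * y - s * x) * (c * x' + s * y') - (c * x + s * y) * (c * y' - s * x') = (c\<^sup>2 + s\<^sup>2) * (y * x' - x * y')"
    by (simp add: power2_eq_square algebra_simps)
  then show ?thesis using assms by simp
qed

text \<open>Each gradient is merely rotated into the radial and angular directions, so its norm is
  preserved.\<close>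

lemma polar_sum_squares:
  fixes x y x' y' t a :: real
  shows "t\<^sup>2 * ((cos a * x + sin a * y)\<^sup>2 + (cos a * x' + sin a * y')\<^sup>2)
      + ((t * (cos a * y - sin a * x))\<^sup>2 + (t * (cos a * y' - sin a * x'))\<^sup>2)
    = t\<^sup>2 * (x\<^sup>2 + y\<^sup>2 + x'\<^sup>2 + y'\<^sup>2)"
proof -
  have cs: "(cos a)\<^sup>2 + (sin a)\<^sup>2 = 1" by simp
  show ?thesis
    unfolding rotation_sum_squares[OF cs, of x y, symmetric] add.assoc
      rotation_sum_squares[OF cs, of x' y', symmetric]
    by (simp only: power_mult_distrib distrib_left add_ac)
qed

lemma polar_det:
  fixes x y x' y' t a :: real
  shows "t * (t * (cos a * y - sin a * x) * (cos a * x' + sin a * y')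
      - (cos a * x + sin a * y) * (t * (cos a * y' - sin a * x'))) = t\<^sup>2 * (y * x' - x * y')"
proof -
  have cs: "(cos a)\<^sup>2 + (sin a)\<^sup>2 = 1" by simp
  show ?thesis
    unfolding rotation_det[OF cs, of y x x' y', symmetric] by (simp add: power2_eq_square algebra_simps)
qed

definition polar_dt :: "real^2 \<Rightarrow> (real^2 \<Rightarrow> real) \<Rightarrow> real \<Rightarrow> real \<Rightarrow> real" where
  "polar_dt z g t a = cos a * partial 1 g (polar z t a) + sin a * partial 2 g (polar z t a)"

definition polar_da :: "real^2 \<Rightarrow> (real^2 \<Rightarrow> real) \<Rightarrow> real \<Rightarrow> real \<Rightarrow> real" where
  "polar_da z g t a = t * (cos a * partial 2 g (polar z t a) - sin a * partial 1 g (polar z t a))"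

definition polar_dta :: "real^2 \<Rightarrow> (real^2 \<Rightarrow> real) \<Rightarrow> real \<Rightarrow> real \<Rightarrow> real" where
  "polar_dta z g t a = cos a * partial 2 g (polar z t a) - sin a * partial 1 g (polar z t a)
     + cos a * polar_da z (partial 1 g) t a + sin a * polar_da z (partial 2 g) t a"

text \<open>The rotation identities carry the Cartesian inequality over to \<open>quasi\<close>,
  with a factor \<open>t\<^sup>2\<close> on both sides.\<close>

lemma polar_pairI:
  assumes p: "smooth_on p (ball z r)" and q: "smooth_on q (ball z r)"
    and R: "0 < R" "R < r" and K: "0 < K" and C: "0 \<le> C"
    and small: "\<And>x. x \<in> cball z R \<Longrightarrow> (p x)\<^sup>2 + (q x)\<^sup>2 \<le> 1/8"
    and quasi: "\<And>x. x \<in> ball z r \<Longrightarrow> (partial 1 p x)\<^sup>2 + (partial 2 p x)\<^sup>2 + (partial 1 q x)\<^sup>2 + (partial 2 q x)\<^sup>2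
      \<le> K * (partial 2 p x * partial 1 q x - partial 1 p x * partial 2 q x) + C * ((p x)\<^sup>2 + (q x)\<^sup>2)"
  shows "polar_pair (\<lambda>t a. p (polar z t a)) (\<lambda>t a. q (polar z t a)) (polar_dt z p) (polar_dt z q) (polar_da z p) (polar_da z q)
    (polar_dta z p) (polar_dta z q) R K C"
proof -
  have inb: "polar z t a \<in> ball z r" if "0 \<le> t" "t \<le> R" for t a
    using that R by (simp add: dist_polar)
  have diff: "g differentiable at (polar z t a)" if "0 \<le> t" "t \<le> R" "smooth_on g (ball z r)" for t a g
    using smooth_on_differentiable[OF that(3) inb] that by simp
  have cont: "continuous_on ({0..R} \<times> {0..2*pi}) (\<lambda>x. g (polar z (fst x) (snd x)))"
    if "smooth_on g (ball z r)" for g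
    by (rule continuous_on_compose2[OF smooth_on_continuous[OF that]])
      (auto intro!: continuous_intros simp: inb simp del: mem_ball)
  note [continuous_intros] = cont smooth_on_partial
  have dta: "(polar_dt z g t has_real_derivative polar_dta z g t a) (at a)"
    and dat: "((\<lambda>t. polar_da z g t a) has_real_derivative polar_dta z g t a) (at t)"
    if t: "0 \<le> t" "t \<le> R" and g: "smooth_on g (ball z r)" for g t a
  proof -
    note d1 = diff[OF t smooth_on_partial[OF g]]
    \<comment> \<open>\<open>polar_dta\<close> is written as an \<open>a\<close>-derivative of
      \<open>polar_dt\<close>; that it is also the \<open>t\<close>-derivative of
      \<open>polar_da\<close> uses the symmetry of second derivatives.\<close>
    have com: "partial 2 (partial 1 g) (polar z t a) = partial 1 (partial 2 g) (polar z t a)"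
      by (rule partial_commute[OF _ g inb[OF t]]) simp
    show "(polar_dt z g t has_real_derivative polar_dta z g t a) (at a)"
      unfolding polar_dt_def polar_dta_def polar_da_def
      by (auto intro!: derivative_eq_intros polar_chain_a[OF d1] simp: algebra_simps)
    show "((\<lambda>t. polar_da z g t a) has_real_derivative polar_dta z g t a) (at t)"
      unfolding polar_dta_def polar_da_def
      by (auto intro!: derivative_eq_intros polar_chain_t[OF d1] simp: algebra_simps com)
  qed
  show ?thesis
  proof (unfold_locales)
    show "0 < R" "0 < K" "0 \<le> C" by fact+
    fix t a
    show "t\<^sup>2 * ((polar_dt z p t a)\<^sup>2 + (polar_dt z q t a)\<^sup>2) + ((polar_da z p t a)\<^sup>2 + (polar_da z q t a)\<^sup>2)
      \<le> K * t * (polar_da z p t a * polar_dt z q t a - polar_dt z p t a * polar_da z q t a) + C * t\<^sup>2 * ((p (polar z t a))\<^sup>2 + (q (polar z t a))\<^sup>2)"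
      if t: "0 < t" "t \<le> R"
    proof -
      let ?x = "polar z t a"
      have "t\<^sup>2 * ((polar_dt z p t a)\<^sup>2 + (polar_dt z q t a)\<^sup>2) + ((polar_da z p t a)\<^sup>2 + (polar_da z q t a)\<^sup>2)
        = t\<^sup>2 * ((partial 1 p ?x)\<^sup>2 + (partial 2 p ?x)\<^sup>2 + (partial 1 q ?x)\<^sup>2 + (partial 2 q ?x)\<^sup>2)"
        unfolding polar_dt_def polar_da_def by (rule polar_sum_squares)
      also have "\<dots> \<le> t\<^sup>2 * (K * (partial 2 p ?x * partial 1 q ?x - partial 1 p ?x * partial 2 q ?x) + C * ((p ?x)\<^sup>2 + (q ?x)\<^sup>2))"
        using inb[of t a] t by (intro mult_left_mono quasi) auto
      also have "\<dots> = K * (t\<^sup>2 * (partial 2 p ?x * partial 1 q ?x - partial 1 p ?x * partial 2 q ?x)) + C * t\<^sup>2 * ((p ?x)\<^sup>2 + (q ?x)\<^sup>2)"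
        by (simp add: algebra_simps)
      also have "t\<^sup>2 * (partial 2 p ?x * partial 1 q ?x - partial 1 p ?x * partial 2 q ?x)
        = t * (polar_da z p t a * polar_dt z q t a - polar_dt z p t a * polar_da z q t a)"
        unfolding polar_dt_def polar_da_def polar_det ..
      also have "K * (t * (polar_da z p t a * polar_dt z q t a - polar_dt z p t a * polar_da z q t a)) = K * t * (polar_da z p t a * polar_dt z q t a - polar_dt z p t a * polar_da z q t a)"
        by simp
      finally show ?thesis .
    qed
    show "(p (polar z t a))\<^sup>2 + (q (polar z t a))\<^sup>2 \<le> 1/8" if "0 \<le> t" "t \<le> R"
      using that by (intro small) (auto simp: dist_polar)
    show "((\<lambda>t. p (polar z t a)) has_real_derivative polar_dt z p t a) (at t)"
      "((\<lambda>t. q (polar z t a)) has_real_derivative polar_dt z q t a) (at t)"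
      "((\<lambda>a. p (polar z t a)) has_real_derivative polar_da z p t a) (at a)"
      "((\<lambda>a. q (polar z t a)) has_real_derivative polar_da z q t a) (at a)" if "0 \<le> t" "t \<le> R"
      using that unfolding polar_dt_def polar_da_def by (intro polar_chain_t polar_chain_a diff p q; simp)+
    show "(polar_dt z p t has_real_derivative polar_dta z p t a) (at a)" "(polar_dt z q t has_real_derivative polar_dta z q t a) (at a)"
      "((\<lambda>t. polar_da z p t a) has_real_derivative polar_dta z p t a) (at t)"
      "((\<lambda>t. polar_da z q t a) has_real_derivative polar_dta z q t a) (at t)" if "0 \<le> t" "t \<le> R"
      using dta dat p q that by auto
    show "polar_da z p 0 a = 0" "polar_da z q 0 a = 0" by (simp_all add: polar_da_def)
  next
    fix F :: "real \<Rightarrow> real \<Rightarrow> real" and t :: real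
    assume "F \<in> {\<lambda>t a. p (polar z t a), \<lambda>t a. q (polar z t a), polar_dt z p, polar_dt z q}"
    then show "F t (2 * pi) = F t 0"
      by (auto simp: polar_dt_def polar_2pi)
  next
    fix F :: "real \<Rightarrow> real \<Rightarrow> real"
    assume "F \<in> {\<lambda>t a. p (polar z t a), \<lambda>t a. q (polar z t a), polar_dt z p, polar_dt z q, polar_da z p, polar_da z q, polar_dta z p, polar_dta z q}"
    moreover have "continuous_on ({0..R} \<times> {0..2*pi}) (\<lambda>x. g (polar z (fst x) (snd x)))"
      "continuous_on ({0..R} \<times> {0..2*pi}) (\<lambda>x. polar_dt z g (fst x) (snd x))"
      "continuous_on ({0..R} \<times> {0..2*pi}) (\<lambda>x. polar_da z g (fst x) (snd x))"
      "continuous_on ({0..R} \<times> {0..2*pi}) (\<lambda>x. polar_dta z g (fst x) (snd x))"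
      if "smooth_on g (ball z r)" for g
      unfolding polar_dt_def polar_dta_def polar_da_def using that by (intro continuous_intros; simp)+
    ultimately show "continuous_on ({0..R} \<times> {0..2*pi}) (\<lambda>x. F (fst x) (snd x))"
      using p q by auto
  qed
qed

lemma exists_small_radius:
  fixes p q :: "real^2 \<Rightarrow> real"
  assumes "smooth_on p (ball z r)" "smooth_on q (ball z r)" "0 < r" "p z = 0" "q z = 0"
  shows "\<exists>R>0. R < r \<and> (\<forall>x\<in>cball z R. (p x)\<^sup>2 + (q x)\<^sup>2 \<le> 1/8)"
proof -
  have "continuous_on (ball z r) (\<lambda>x. (p x)\<^sup>2 + (q x)\<^sup>2)"
    by (intro continuous_intros smooth_on_continuous assms)
  then have "isCont (\<lambda>x. (p x)\<^sup>2 + (q x)\<^sup>2) z"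
    using assms(3) by (simp add: continuous_on_eq_continuous_at)
  moreover have "(p z)\<^sup>2 + (q z)\<^sup>2 = 0" using assms by simp
  ultimately obtain d where d: "0 < d" "\<And>x. dist x z < d \<Longrightarrow> dist ((p x)\<^sup>2 + (q x)\<^sup>2) 0 < 1/8"
    unfolding continuous_at_eps_delta by (metis zero_less_divide_1_iff zero_less_numeral)
  define R where "R = min r d / 2"
  have R: "0 < R" "R < r" "R < d" using assms(3) d by (auto simp: R_def)
  have "(p x)\<^sup>2 + (q x)\<^sup>2 \<le> 1/8" if "x \<in> cball z R" for x
    using d(2)[of x] that R by (simp add: dist_commute)
  then show ?thesis using R by blast
qed

text \<open>If \<open>w\<close> is nonzero at some point, then \<open>|w|\<^sup>2\<close> stays away
  from zero on a short radial segment through it. This segment meets a circle without zeros, and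
  inside such a circle \<open>not_infinite_order\<close> applies.\<close>

lemma strong_unique_continuation:
  fixes p q :: "real^2 \<Rightarrow> real"
  assumes p: "smooth_on p (ball z r)" and q: "smooth_on q (ball z r)"
    and r: "0 < r" and K: "0 < K" and C: "0 \<le> C"
    and quasi: "\<And>x. x \<in> ball z r \<Longrightarrow> (partial 1 p x)\<^sup>2 + (partial 2 p x)\<^sup>2 + (partial 1 q x)\<^sup>2 + (partial 2 q x)\<^sup>2
      \<le> K * (partial 2 p x * partial 1 q x - partial 1 p x * partial 2 q x) + C * ((p x)\<^sup>2 + (q x)\<^sup>2)"
    and flat: "\<And>n::nat. \<exists>c. \<forall>x\<in>ball z r. (p x)\<^sup>2 + (q x)\<^sup>2 \<le> c * dist z x ^ n"
  shows "\<exists>R>0. \<forall>x\<in>ball z R. p x = 0 \<and> q x = 0"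
proof -
  have z0: "(p z)\<^sup>2 + (q z)\<^sup>2 = 0"
  proof -
    obtain c where "\<forall>x\<in>ball z r. (p x)\<^sup>2 + (q x)\<^sup>2 \<le> c * dist z x ^ 1" using flat by blast
    then have "(p z)\<^sup>2 + (q z)\<^sup>2 \<le> c * dist z z ^ 1" using r by (meson centre_in_ball)
    then show ?thesis using sum_power2_ge_zero[of "p z" "q z"] by simp
  qed
  then obtain R where Rr: "0 < R" "R < r" and small: "\<And>x. x \<in> cball z R \<Longrightarrow> (p x)\<^sup>2 + (q x)\<^sup>2 \<le> 1/8"
    using exists_small_radius[OF p q r] by auto
  interpret polar_pair "\<lambda>t a. p (polar z t a)" "\<lambda>t a. q (polar z t a)"
    "polar_dt z p" "polar_dt z q" "polar_da z p" "polar_da z q" "polar_dta z p" "polar_dta z q" R K C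
    by (rule polar_pairI[OF p q Rr(1,2) K C small quasi])
  show ?thesis
  proof (rule ccontr)
    assume "\<not> ?thesis"
    then obtain x where x: "x \<in> ball z R" "p x \<noteq> 0 \<or> q x \<noteq> 0" using Rr by blast
    obtain t1 a0 where ta: "x = polar z t1 a0" "t1 = dist z x" "0 \<le> a0" "a0 \<le> 2 * pi"
      by (rule polar_surj)
    have t1: "0 < t1" "t1 < R" using x z0 ta(2) by auto
    have "S t1 a0 \<noteq> 0" using x(2) ta(1) by (simp add: S_def)
    then have s: "0 < S t1 a0 / 2" using S_nonneg[of t1 a0] by simp
    have "isCont (\<lambda>t. S t a0) t1"
      by (rule DERIV_isCont[OF S_deriv_t]) (use t1 in auto)
    then obtain e where e: "0 < e" "\<And>t. dist t t1 < e \<Longrightarrow> dist (S t a0) (S t1 a0) < S t1 a0 / 2"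
      using s unfolding continuous_at_eps_delta by blast
    define k where "k = min (e/2) (R - t1)"
    have k: "0 < k" "k < e" "t1 + k \<le> R" using e t1 by (auto simp: k_def)
    have big: "S t1 a0 / 2 \<le> S t a0" if "t1 \<le> t" "t \<le> t1 + k" for t
      using e(2)[of t] that k by (auto simp: dist_real_def abs_if split: if_splits)
    obtain t where t: "t \<in> {t1..t1 + k}" "\<forall>a\<in>{0..2*pi}. S t a \<noteq> 0"
      using exists_zero_free_circle[of t1 "t1 + k" "S t1 a0 / 2" a0] t1 k s ta(3,4) big by auto
    show False
    proof (rule not_infinite_order[of t])
      fix n
      obtain c where c: "\<forall>x\<in>ball z r. (p x)\<^sup>2 + (q x)\<^sup>2 \<le> c * dist z x ^ n"
        using flat by blast
      have "S t a \<le> c * t ^ n" if "t \<in> {0..R}" for t a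
        using bspec[OF c, of "polar z t a"] that Rr by (simp add: S_def dist_polar)
      then show "\<exists>c. \<forall>t\<in>{0..R}. \<forall>a. S t a \<le> c * t ^ n" by blast
    qed (use t t1 k in auto)
  qed
qed

text \<open>The \<open>j\<close>-th derivative in direction \<open>e\<close>, expanded into iterated partial derivatives: linearity in \<open>e\<close>
  makes bounds uniform in the direction.\<close>

primrec dird :: "nat \<Rightarrow> real^2 \<Rightarrow> (real^2 \<Rightarrow> real) \<Rightarrow> real^2 \<Rightarrow> real" where
  "dird 0 e g = g"
| "dird (Suc j) e g = (\<lambda>x. e $ 1 * dird j e (partial 1 g) x + e $ 2 * dird j e (partial 2 g) x)"

lemma dird_deriv:
  assumes "smooth_on g S" "x + t *\<^sub>R e \<in> S"
  shows "((\<lambda>t. dird j e g (x + t *\<^sub>R e)) has_real_derivative dird (Suc j) e g (x + t *\<^sub>R e)) (at t)"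
  using assms(1)
proof (induction j arbitrary: g)
  case 0
  have d: "g differentiable at (x + t *\<^sub>R e)"
    using smooth_on_differentiable 0 assms(2) by blast
  have "((\<lambda>t. x + t *\<^sub>R e) has_vector_derivative e) (at t)"
    by (auto intro!: derivative_eq_intros)
  from has_real_derivative_along_curve[of g "\<lambda>t. x + t *\<^sub>R e", OF d this]
  show ?case by (simp add: frechet_derivative_real2[OF d])
next
  case (Suc j)
  show ?case
    unfolding dird.simps(2)[of j] dird.simps(2)[of "Suc j"]
    by (intro DERIV_add DERIV_cmult Suc.IH[unfolded dird.simps(2)] smooth_on_partial Suc.prems)
qed

lemma dird_continuous: "smooth_on g S \<Longrightarrow> continuous_on S (dird j e g)"
proof (induction j arbitrary: g)
  case (Suc j)
  show ?case
    unfolding dird.simps by (intro continuous_intros Suc.IH smooth_on_partial Suc.prems)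
qed (simp add: smooth_on_continuous)

lemma dird_bounded:
  assumes "smooth_on g S" "compact T" "T \<subseteq> S"
  shows "\<exists>M\<ge>0. \<forall>x\<in>T. \<forall>e. norm e \<le> 1 \<longrightarrow> \<bar>dird j e g x\<bar> \<le> M"
  using assms(1)
proof (induction j arbitrary: g)
  case 0
  have "compact (g ` T)"
    using assms continuous_on_subset smooth_on_continuous[OF 0] by (intro compact_continuous_image) auto
  then obtain M where "\<forall>x\<in>T. \<bar>g x\<bar> \<le> M"
    using compact_imp_bounded bounded_real by (metis imageI)
  then show ?case by (intro exI[of _ "max M 0"]) (auto simp: le_max_iff_disj)
next
  case (Suc j)
  obtain M1 where M1: "0 \<le> M1" "\<And>x e. x \<in> T \<Longrightarrow> norm e \<le> 1 \<Longrightarrow> \<bar>dird j e (partial 1 g) x\<bar> \<le> M1"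
    using Suc.IH[OF smooth_on_partial[OF Suc.prems]] by meson
  obtain M2 where M2: "0 \<le> M2" "\<And>x e. x \<in> T \<Longrightarrow> norm e \<le> 1 \<Longrightarrow> \<bar>dird j e (partial 2 g) x\<bar> \<le> M2"
    using Suc.IH[OF smooth_on_partial[OF Suc.prems]] by meson
  have "\<bar>dird (Suc j) e g x\<bar> \<le> M1 + M2" if "x \<in> T" "norm e \<le> 1" for x e
  proof -
    have e: "\<bar>e $ 1\<bar> \<le> 1" "\<bar>e $ 2\<bar> \<le> 1"
      using component_le_norm_cart[of e] that(2) by (meson order_trans)+
    have "\<bar>e $ 1 * dird j e (partial 1 g) x\<bar> \<le> 1 * M1" "\<bar>e $ 2 * dird j e (partial 2 g) x\<bar> \<le> 1 * M2"
      unfolding abs_mult using e M1 M2 that by (intro mult_mono; simp)+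
    then show ?thesis by simp
  qed
  then show ?case using M1(1) M2(1) by (intro exI[of _ "M1 + M2"]) auto
qed

lemma dird_eq_0:
  assumes "open U" "x \<in> U" "\<And>x. x \<in> U \<Longrightarrow> g x = 0"
  shows "dird j e g x = 0"
  using assms(2,3)
proof (induction j arbitrary: g x)
  case (Suc j)
  have "partial i g y = 0" if y: "y \<in> U" for i y
  proof -
    have "(g has_derivative (\<lambda>_. 0)) (at y)"
      by (rule has_derivative_transform_within_open[OF has_derivative_const assms(1) y])
        (simp add: Suc.prems)
    then show ?thesis
      unfolding partial_def by (simp add: frechet_derivative_at[symmetric])
  qed
  then show ?case using Suc.IH Suc.prems(1) by simp
qed simp

text \<open>The whole sequence of derivatives is a parameter, so that the estimate can also be
  applied to a shifted sequence, that is, to a derivative of the function.\<close>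

lemma maclaurin_leading:
  fixes d :: "nat \<Rightarrow> real \<Rightarrow> real"
  assumes d: "\<And>j t. 0 \<le> t \<Longrightarrow> t \<le> h \<Longrightarrow> (d j has_real_derivative d (Suc j) t) (at t)"
    and z: "\<And>j. j < m \<Longrightarrow> d j 0 = 0" and M: "\<And>t. 0 \<le> t \<Longrightarrow> t \<le> h \<Longrightarrow> \<bar>d (Suc m) t\<bar> \<le> M"
    and h: "0 < h"
  shows "\<bar>d 0 h - d m 0 / fact m * h ^ m\<bar> \<le> M * h ^ Suc m"
proof -
  obtain t where t: "0 < t" "t < h"
    "d 0 h = (\<Sum>k<Suc m. d k 0 / fact k * h ^ k) + d (Suc m) t / fact (Suc m) * h ^ Suc m"
    using Maclaurin[of h "Suc m" d "d 0"] d h by auto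
  have "(\<Sum>k<m. d k 0 / fact k * h ^ k) = 0"
    using z by (intro sum.neutral) auto
  then have "d 0 h - d m 0 / fact m * h ^ m = d (Suc m) t / fact (Suc m) * h ^ Suc m"
    using t(3) by simp
  also have "\<bar>\<dots>\<bar> = \<bar>d (Suc m) t\<bar> / fact (Suc m) * h ^ Suc m"
    using h by (simp add: abs_mult del: fact_Suc power_Suc)
  also have "\<dots> \<le> M / 1 * h ^ Suc m"
    using M[of t] t h fact_ge_1[of "Suc m"]
    by (intro mult_right_mono frac_le) (auto simp del: fact_Suc)
  finally show ?thesis by simp
qed

text \<open>The second estimate is Euler's relation up to a higher-order error: the leading terms of
  \<open>m g\<close> and of \<open>t\<close> times its radial derivative agree. The bound is uniform
  in the angle because \<open>dird_bounded\<close> is uniform in the direction.\<close>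

lemma dird_taylor:
  assumes g: "smooth_on g S" and S: "cball z r \<subseteq> S"
  shows "\<exists>M\<ge>0. \<forall>t a. 0 < t \<longrightarrow> t \<le> r \<longrightarrow> (\<forall>j<m. dird j (vector [cos a, sin a]) g z = 0) \<longrightarrow>
    \<bar>g (polar z t a) - dird m (vector [cos a, sin a]) g z / fact m * t ^ m\<bar> \<le> M * t ^ Suc m \<and>
    (1 \<le> m \<longrightarrow> \<bar>t * (cos a * partial 1 g (polar z t a) + sin a * partial 2 g (polar z t a)) - m * g (polar z t a)\<bar> \<le> M * t ^ Suc m)"
proof -
  obtain M where M: "0 \<le> M" "\<And>x e. x \<in> cball z r \<Longrightarrow> norm e \<le> 1 \<Longrightarrow> \<bar>dird (Suc m) e g x\<bar> \<le> M"
    using dird_bounded[OF g compact_cball S] by meson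
  have "\<bar>g (polar z t a) - dird m (vector [cos a, sin a]) g z / fact m * t ^ m\<bar> \<le> (1 + m) * M * t ^ Suc m \<and>
    (1 \<le> m \<longrightarrow> \<bar>t * (cos a * partial 1 g (polar z t a) + sin a * partial 2 g (polar z t a)) - m * g (polar z t a)\<bar> \<le> (1 + m) * M * t ^ Suc m)"
    if t: "0 < t" "t \<le> r" and zero: "\<forall>j<m. dird j (vector [cos a, sin a]) g z = 0" for t a
  proof
    define e :: "real^2" where "e = vector [cos a, sin a]"
    define d where "d j s = dird j e g (z + s *\<^sub>R e)" for j s
    have ne: "norm e = 1" by (simp add: e_def)
    have inb: "z + s *\<^sub>R e \<in> cball z r" if "0 \<le> s" "s \<le> t" for s
      using that t ne by (simp add: dist_norm)
    have dd: "(d j has_real_derivative d (Suc j) s) (at s)" if "0 \<le> s" "s \<le> t" for j s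
      unfolding d_def[abs_def] by (rule dird_deriv[OF g]) (use inb[OF that] S in blast)
    have dM: "\<bar>d (Suc m) s\<bar> \<le> M" if "0 \<le> s" "s \<le> t" for s
      unfolding d_def by (rule M(2)) (use inb[OF that] ne in auto)
    have d0: "d j 0 = dird j e g z" for j by (simp add: d_def)
    have z0: "d j 0 = 0" if "j < m" for j using zero that by (simp add: d0 e_def)
    have gd: "d 0 t = g (polar z t a)" by (simp add: d_def polar_def e_def)
    have gd1: "d 1 t = cos a * partial 1 g (polar z t a) + sin a * partial 2 g (polar z t a)"
      by (simp add: d_def polar_def e_def)
    have "\<bar>d 0 t - d m 0 / fact m * t ^ m\<bar> \<le> M * t ^ Suc m"
      by (rule maclaurin_leading) (use dd z0 dM t in auto)
    then have 1: "\<bar>g (polar z t a) - dird m e g z / fact m * t ^ m\<bar> \<le> M * t ^ Suc m"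
      by (simp add: gd d0)
    also have "\<dots> \<le> (1 + m) * M * t ^ Suc m"
      using t M(1) by (intro mult_right_mono) (auto simp: algebra_simps)
    finally show "\<bar>g (polar z t a) - dird m (vector [cos a, sin a]) g z / fact m * t ^ m\<bar> \<le> (1 + m) * M * t ^ Suc m"
      by (simp add: e_def)
    show "1 \<le> m \<longrightarrow> \<bar>t * (cos a * partial 1 g (polar z t a) + sin a * partial 2 g (polar z t a)) - m * g (polar z t a)\<bar> \<le> (1 + m) * M * t ^ Suc m"
    proof
      assume "1 \<le> m"
      then obtain n where n: "m = Suc n" by (cases m) auto
      \<comment> \<open>The sequence is shifted by one, hence the order drops to
        \<open>n = m - 1\<close>.\<close>
      have "\<bar>d (Suc 0) t - d (Suc n) 0 / fact n * t ^ n\<bar> \<le> M * t ^ Suc n"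
        by (rule maclaurin_leading[where d = "\<lambda>j. d (Suc j)"]) (use dd z0 dM t n in auto)
      then have "t * \<bar>d 1 t - d m 0 / fact n * t ^ n\<bar> \<le> t * (M * t ^ Suc n)"
        using t n by (intro mult_left_mono) auto
      then have t1: "\<bar>t * (d 1 t - d m 0 / fact n * t ^ n)\<bar> \<le> M * t ^ Suc m"
        unfolding abs_mult[of t] using t by (simp only: n abs_of_pos power_Suc mult.left_commute)
      have t2: "\<bar>m * (g (polar z t a) - dird m e g z / fact m * t ^ m)\<bar> \<le> m * (M * t ^ Suc m)"
        unfolding abs_mult using 1 by (intro mult_mono) auto
      have t3: "t * (d m 0 / fact n * t ^ n) = m * (dird m e g z / fact m * t ^ m)"
      proof -
        have "t * (v / fact n * t ^ n) = m * (v / fact m * t ^ m)" for v :: real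
          by (simp add: n del: of_nat_Suc)
        then show ?thesis unfolding d0 .
      qed
      have "\<bar>t * d 1 t - m * g (polar z t a)\<bar> \<le> M * t ^ Suc m + m * (M * t ^ Suc m)"
      proof -
        have "\<bar>a - b\<bar> \<le> A + B" if "\<bar>a - c\<bar> \<le> A" "\<bar>b - c'\<bar> \<le> B" "c = c'" for a b c c' A B :: real
          using that by linarith
        from this[OF t1[unfolded right_diff_distrib] t2[unfolded right_diff_distrib] t3]
        show ?thesis .
      qed
      then show "\<bar>t * (cos a * partial 1 g (polar z t a) + sin a * partial 2 g (polar z t a)) - m * g (polar z t a)\<bar> \<le> (1 + m) * M * t ^ Suc m"
        unfolding gd1 by (simp add: algebra_simps)
    qed
  qed
  then show ?thesis using M(1) by (intro exI[of _ "(1 + m) * M"]) auto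
qed

text \<open>Taylor's formula at order \<open>n\<close> has no leading term, so each component is at
  most \<open>M t\<^sup>n\<^sup>+\<^sup>1\<close> in absolute value; as the radius is at most
  \<open>1\<close>, its square is at most \<open>M\<^sup>2 t\<^sup>n\<close>.\<close>

lemma infinite_order_imp_zero:
  fixes p q :: "real^2 \<Rightarrow> real"
  assumes S: "open S" "z \<in> S" and p: "smooth_on p S" and q: "smooth_on q S"
    and K: "0 < K" and C: "0 \<le> C"
    and quasi: "\<And>x. x \<in> S \<Longrightarrow> (partial 1 p x)\<^sup>2 + (partial 2 p x)\<^sup>2 + (partial 1 q x)\<^sup>2 + (partial 2 q x)\<^sup>2
      \<le> K * (partial 2 p x * partial 1 q x - partial 1 p x * partial 2 q x) + C * ((p x)\<^sup>2 + (q x)\<^sup>2)"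
    and zero: "\<And>j e. norm e = 1 \<Longrightarrow> dird j e p z = 0 \<and> dird j e q z = 0"
  shows "\<exists>R>0. \<forall>x\<in>ball z R. p x = 0 \<and> q x = 0"
proof -
  obtain r0 where r0: "0 < r0" "cball z r0 \<subseteq> S" using S open_contains_cball by blast
  define r where "r = min r0 1"
  have r: "0 < r" "r \<le> 1" "cball z r \<subseteq> S" using r0 by (auto simp: r_def)
  have bS: "ball z r \<subseteq> S" using r(3) ball_subset_cball by blast
  show ?thesis
  proof (rule strong_unique_continuation[OF smooth_on_subset[OF p bS] smooth_on_subset[OF q bS] r(1) K C])
    fix n :: nat
    have bd: "\<exists>M. \<forall>x\<in>ball z r. (g x)\<^sup>2 \<le> M * dist z x ^ n"
      if g: "smooth_on g S" and gz: "\<And>j e. norm e = 1 \<Longrightarrow> dird j e g z = 0" for g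
    proof -
      obtain M where M: "0 \<le> M" and T: "\<And>t a. 0 < t \<Longrightarrow> t \<le> r \<Longrightarrow> \<bar>g (polar z t a)\<bar> \<le> M * t ^ Suc n"
        using dird_taylor[OF g r(3), of n] gz by (auto simp del: power_Suc)
      have "(g x)\<^sup>2 \<le> M\<^sup>2 * dist z x ^ n" if x: "x \<in> ball z r" for x
      proof -
        obtain t a where ta: "x = polar z t a" "t = dist z x" by (rule polar_surj)
        show ?thesis
        proof (cases "x = z")
          case True
          then show ?thesis using gz[of "axis 1 1" 0] by simp
        next
          case False
          then have t: "0 < t" "t \<le> r" "t \<le> 1" using ta(2) x r by auto
          have "(g x)\<^sup>2 \<le> (M * t ^ Suc n)\<^sup>2"
            using T[OF t(1,2), of a] unfolding ta(1)[symmetric] by (rule abs_le_square_iff[THEN iffD1, OF order_trans]) simp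
          also have "\<dots> = M\<^sup>2 * t ^ (Suc n * 2)" by (simp only: power_mult_distrib power_mult)
          also have "\<dots> \<le> M\<^sup>2 * t ^ n"
            using t by (intro mult_left_mono power_decreasing) auto
          finally show ?thesis by (simp add: ta(2)[symmetric])
        qed
      qed
      then show ?thesis by blast
    qed
    obtain M1 M2 where "\<forall>x\<in>ball z r. (p x)\<^sup>2 \<le> M1 * dist z x ^ n" "\<forall>x\<in>ball z r. (q x)\<^sup>2 \<le> M2 * dist z x ^ n"
      using bd[OF p] bd[OF q] zero by blast
    then have "\<forall>x\<in>ball z r. (p x)\<^sup>2 + (q x)\<^sup>2 \<le> (M1 + M2) * dist z x ^ n"
      unfolding distrib_right by (meson add_mono)
    then show "\<exists>c. \<forall>x\<in>ball z r. (p x)\<^sup>2 + (q x)\<^sup>2 \<le> c * dist z x ^ n" by blast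
  qed (use quasi bS in blast)
qed

lemma finite_order:
  fixes p q :: "real^2 \<Rightarrow> real"
  assumes S: "open S" "connected S" "z \<in> S" and p: "smooth_on p S" and q: "smooth_on q S"
    and K: "0 < K" and C: "0 \<le> C"
    and quasi: "\<And>x. x \<in> S \<Longrightarrow> (partial 1 p x)\<^sup>2 + (partial 2 p x)\<^sup>2 + (partial 1 q x)\<^sup>2 + (partial 2 q x)\<^sup>2
      \<le> K * (partial 2 p x * partial 1 q x - partial 1 p x * partial 2 q x) + C * ((p x)\<^sup>2 + (q x)\<^sup>2)"
    and nz: "\<exists>x\<in>S. p x \<noteq> 0 \<or> q x \<noteq> 0"
  shows "\<exists>j e. norm e = 1 \<and> (dird j e p z \<noteq> 0 \<or> dird j e q z \<noteq> 0)"
proof -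
  \<comment> \<open>\<open>A\<close> and \<open>B\<close> are open and disjoint, and they cover
    \<open>S\<close> by \<open>infinite_order_imp_zero\<close>. By connectedness one of them misses
    \<open>S\<close>, and \<open>nz\<close> shows that it is \<open>A\<close>.\<close>
  define A where "A = {x\<in>S. \<exists>R>0. \<forall>y\<in>ball x R. p y = 0 \<and> q y = 0}"
  define B where "B = (\<Union>j. \<Union>e\<in>{e. norm e = 1}. (S \<inter> dird j e p -` (-{0})) \<union> (S \<inter> dird j e q -` (-{0})))"
  have "open A"
    unfolding open_contains_ball
  proof
    fix x assume "x \<in> A"
    then obtain R where R: "x \<in> S" "0 < R" "\<forall>y\<in>ball x R. p y = 0 \<and> q y = 0" by (auto simp: A_def)
    obtain R' where R': "0 < R'" "ball x R' \<subseteq> S" using S R open_contains_ball by blast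
    have "y \<in> A" if y: "y \<in> ball x (min R R')" for y
    proof -
      obtain e where "0 < e" "ball y e \<subseteq> ball x (min R R')"
        using y open_ball open_contains_ball by blast
      then show ?thesis unfolding A_def using R' R y by fastforce
    qed
    then show "\<exists>e>0. ball x e \<subseteq> A" using R R' by (intro exI[of _ "min R R'"]) auto
  qed
  moreover have "open B"
    unfolding B_def
    by (intro open_UN open_Un ballI continuous_open_preimage dird_continuous p q S) auto
  moreover have "A \<inter> B \<inter> S = {}"
  proof -
    have False if "x \<in> A" "x \<in> B" for x
    proof -
      obtain R where R: "0 < R" "\<And>y. y \<in> ball x R \<Longrightarrow> p y = 0" "\<And>y. y \<in> ball x R \<Longrightarrow> q y = 0"
        using \<open>x \<in> A\<close> by (auto simp: A_def)
      have "dird j e p x = 0" "dird j e q x = 0" for j e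
        using R by (auto intro!: dird_eq_0[of "ball x R"])
      then show False using \<open>x \<in> B\<close> by (auto simp: B_def)
    qed
    then show ?thesis by blast
  qed
  moreover have AB: "S \<subseteq> A \<union> B"
  proof
    fix x assume x: "x \<in> S"
    show "x \<in> A \<union> B"
    proof (cases "\<exists>j e. norm e = 1 \<and> (dird j e p x \<noteq> 0 \<or> dird j e q x \<noteq> 0)")
      case True
      then show ?thesis using x by (auto simp: B_def)
    next
      case False
      then have "\<exists>R>0. \<forall>y\<in>ball x R. p y = 0 \<and> q y = 0"
        by (intro infinite_order_imp_zero[OF S(1) x p q K C quasi]) auto
      then show ?thesis using x by (simp add: A_def)
    qed
  qed
  ultimately have "A \<inter> S = {} \<or> B \<inter> S = {}"
    using connectedD[OF S(2)] by metis
  moreover have "\<not> S \<subseteq> A"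
  proof
    assume "S \<subseteq> A"
    obtain x where "x \<in> S" "p x \<noteq> 0 \<or> q x \<noteq> 0" using nz by blast
    then show False using \<open>S \<subseteq> A\<close> by (auto simp: A_def)
  qed
  ultimately have "z \<in> B" using AB S(3) by blast
  then show ?thesis by (auto simp: B_def)
qed

section \<open>Winding numbers\<close>

lemma field_circle_eq:
  "field_circle F z r = (\<lambda>x. complex_of_vec (F (polar z r (2 * pi * x))))"
proof
  fix x
  have "vec_of_complex (circlepath (complex_of_vec z) r x) = polar z r (2 * pi * x)"
    by (simp add: vec_of_complex_def complex_of_vec_def circlepath polar_def vec_eq_iff forall_2
        Re_exp Im_exp)
  then show "field_circle F z r x = complex_of_vec (F (polar z r (2 * pi * x)))"
    by (simp add: field_circle_def)
qed

lemma complex_of_vec_eq_0_iff: "complex_of_vec v = 0 \<longleftrightarrow> v = 0"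
  by (simp add: complex_of_vec_def vec_eq_iff forall_2 complex_eq_iff)

lemma continuous_on_complex_of_vec [continuous_intros]:
  "continuous_on A f \<Longrightarrow> continuous_on A (\<lambda>x. complex_of_vec (f x))"
  unfolding complex_of_vec_def Complex_eq by (intro continuous_intros)

text \<open>Interpolating the radius linearly gives a homotopy of loops that avoids the
  origin.\<close>

lemma winding_field_circle_const:
  assumes F: "continuous_on (ball z R - {z}) F" and nz: "\<And>x. x \<in> ball z R - {z} \<Longrightarrow> F x \<noteq> 0"
    and r: "0 < r" "r < R" "0 < r'" "r' < R"
  shows "winding_number (field_circle F z r) 0 = winding_number (field_circle F z r') 0"
proof (rule winding_number_homotopic_loops)
  let ?t = "\<lambda>s. (1 - s) * r + s * r'"
  let ?h = "\<lambda>y. complex_of_vec (F (polar z (?t (fst y)) (2 * pi * snd y)))"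
  have t: "0 < ?t s" "?t s < R" if "s \<in> {0..1}" for s
  proof -
    have "(1 - s) * r \<ge> (1 - s) * min r r'" "s * r' \<ge> s * min r r'"
      "(1 - s) * r \<le> (1 - s) * max r r'" "s * r' \<le> s * max r r'"
      using that by (auto intro!: mult_left_mono)
    then have "min r r' \<le> ?t s" "?t s \<le> max r r'" by (auto simp: algebra_simps)
    then show "0 < ?t s" "?t s < R" using r by auto
  qed
  have mem: "polar z (?t s) a \<in> ball z R - {z}" if "s \<in> {0..1}" for s a
    using t[OF that] dist_polar[of z "?t s" a] by auto
  show "homotopic_loops (- {0}) (field_circle F z r) (field_circle F z r')"
    unfolding homotopic_loops
  proof (intro exI[of _ ?h] conjI ballI)
    show "continuous_on ({0..1} \<times> {0..1}) ?h"
      by (intro continuous_intros continuous_on_compose2[OF F]) (use mem in auto)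
    show "?h \<in> {0..1} \<times> {0..1} \<rightarrow> - {0}"
      using nz[OF mem] by (auto simp: complex_of_vec_eq_0_iff)
  qed (auto simp: field_circle_eq pathfinish_def pathstart_def polar_2pi)
qed

text \<open>A single radius suffices, since the winding number is the same for all of them.\<close>

lemma has_indexI:
  assumes "0 < R" "continuous_on (ball z R - {z}) F" "\<And>x. x \<in> ball z R - {z} \<Longrightarrow> F x \<noteq> 0"
    and "0 < r" "r < R" "winding_number (field_circle F z r) 0 = of_int k"
  shows "has_index F z k"
  unfolding has_index_def
  using assms winding_field_circle_const[OF assms(2,3)] by (intro exI[of _ R]) metis

text \<open>Adding \<open>Ln c\<close> and \<open>2 pi i x\<close> to a continuous logarithm of
  \<open>p\<close> gives one of the product; only the latter term changes the increment.\<close>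

lemma winding_number_times_circle:
  assumes p: "path p" "0 \<notin> path_image p" and c: "c \<noteq> 0"
  shows "winding_number (\<lambda>x. c * p x * exp (2 * of_real pi * \<i> * of_real x)) 0 = winding_number p 0 + 1"
proof -
  obtain q where q: "path q" "pathfinish q - pathstart q = 2 * of_real pi * \<i> * winding_number p 0"
    "\<And>t. t \<in> {0..1} \<Longrightarrow> p t = 0 + exp (q t)"
    using winding_number_as_continuous_log[OF p] by metis
  define s where "s x = Ln c + q x + 2 * of_real pi * \<i> * of_real x" for x
  have s: "path s"
    using q(1) unfolding path_def s_def by (intro continuous_intros)
  have "winding_number (\<lambda>x. c * p x * exp (2 * of_real pi * \<i> * of_real x)) 0 = winding_number (exp \<circ> s) 0"
    by (rule winding_number_cong) (use c q(3) in \<open>auto simp: s_def exp_add\<close>)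
  also have "\<dots> = (pathfinish s - pathstart s) / (2 * of_real pi * \<i>)"
    using winding_number_compose_exp[OF s] .
  also have "pathfinish s - pathstart s = 2 * of_real pi * \<i> * (winding_number p 0 + 1)"
    using q(2) by (simp add: s_def pathfinish_def pathstart_def algebra_simps)
  finally show ?thesis by simp
qed

lemma winding_number_nearby:
  assumes "path g" "path h" "pathfinish g = pathstart g" "pathfinish h = pathstart h"
    and "\<And>t. t \<in> {0..1} \<Longrightarrow> norm (h t - g t) < norm (g t)"
  shows "winding_number g 0 = winding_number h 0"
  by (rule winding_number_homotopic_loops, rule homotopic_loops_nearby_explicit) (use assms in auto)

text \<open>The reversed path turns counterclockwise, and by compactness the quantity measuring this
  has a positive lower bound, as the criterion for a positive winding number demands.\<close>

lemma winding_number_neg: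
  assumes d: "\<And>x. (\<gamma> has_vector_derivative \<gamma>' x) (at x)" and c: "continuous_on UNIV \<gamma>'"
    and neg: "\<And>x. x \<in> {0..1} \<Longrightarrow> Im (\<gamma>' x * cnj (\<gamma> x)) < 0"
  shows "Re (winding_number \<gamma> 0) < 0"
proof -
  define \<delta> where "\<delta> = reversepath \<gamma>"
  define \<delta>' where "\<delta>' x = - \<gamma>' (1 - x)" for x
  have dd: "(\<delta> has_vector_derivative \<delta>' x) (at x)" for x
  proof -
    have "(\<gamma> \<circ> (\<lambda>x. 1 - x) has_vector_derivative (-1) *\<^sub>R \<gamma>' (1 - x)) (at x)"
    proof (rule vector_diff_chain_at)
      show "((\<lambda>x. 1 - x) has_vector_derivative - 1) (at x)"
        by (auto intro!: derivative_eq_intros)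
    qed (rule d)
    then show ?thesis by (simp add: \<delta>_def \<delta>'_def reversepath_def o_def)
  qed
  have c\<delta>': "continuous_on UNIV \<delta>'"
    unfolding \<delta>'_def by (intro continuous_intros continuous_on_compose2[OF c]) auto
  have v\<delta>: "valid_path \<delta>"
    unfolding valid_path_def
  proof (rule C1_differentiable_imp_piecewise)
    show "\<delta> C1_differentiable_on {0..1}"
      unfolding C1_differentiable_on_def using dd continuous_on_subset[OF c\<delta>' subset_UNIV] by blast
  qed
  have cont: "continuous_on UNIV \<gamma>"
    by (intro continuous_at_imp_continuous_on ballI has_vector_derivative_continuous[OF d])
  have nz: "0 \<notin> path_image \<gamma>"
    using neg by (force simp: path_image_def)
  have nzd: "0 \<notin> path_image \<delta>" using nz by (simp add: \<delta>_def)
  let ?f = "\<lambda>x. Im (\<delta>' x * cnj (\<delta> x - 0))"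
  have pos: "0 < ?f x" if "x \<in> {0..1}" for x
    using neg[of "1 - x"] that by (simp add: \<delta>_def \<delta>'_def reversepath_def)
  have "continuous_on {0..1} ?f"
    using dd c\<delta>' v\<delta>
    by (intro continuous_intros continuous_on_subset[OF c\<delta>'] valid_path_imp_path[unfolded path_def]) auto
  then obtain x0 where x0: "x0 \<in> {0..1}" "\<And>x. x \<in> {0..1} \<Longrightarrow> ?f x0 \<le> ?f x"
    using continuous_attains_inf[of "{0..1}" ?f] by auto
  have "0 < Re (winding_number \<delta> 0)"
  proof (rule winding_number_pos_lt[OF v\<delta> nzd pos[OF x0(1)]])
    fix x :: real assume "0 < x" "x < 1"
    then show "?f x0 \<le> Im (vector_derivative \<delta> (at x) * cnj (\<delta> x - 0))"
      using x0(2)[of x] vector_derivative_at[OF dd] by simp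
  qed
  moreover have "path \<gamma>" using cont continuous_on_subset unfolding path_def by blast
  ultimately show ?thesis
    using winding_number_reversepath[OF _ nz] by (simp add: \<delta>_def)
qed

section \<open>Gradients of solutions\<close>

text \<open>Here \<open>X\<close>, \<open>Y\<close>, \<open>Z\<close> stand for the second
  derivatives and \<open>g\<close> for the first-order terms. Eliminating \<open>a * X\<close> from
  \<open>a * D\<close>, and \<open>c * Z\<close> from \<open>c * D\<close>, leaves the quadratic
  form at \<open>(Y, Z)\<close> and at \<open>(X, Y)\<close>, up to \<open>g * Z\<close> and
  \<open>g * X\<close>.\<close>

lemma elliptic_pointwise:
  fixes a b c X Y Z g l1 l2 :: real
  assumes l: "0 < l1" "l1 \<le> l2"
    and ell: "\<And>x y. l1 * (x\<^sup>2 + y\<^sup>2) \<le> a * x\<^sup>2 + 2 * b * x * y + c * y\<^sup>2"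
      "\<And>x y. a * x\<^sup>2 + 2 * b * x * y + c * y\<^sup>2 \<le> l2 * (x\<^sup>2 + y\<^sup>2)"
    and eq: "a * X + 2 * b * Y + c * Z + g = 0"
  shows "X\<^sup>2 + 2 * Y\<^sup>2 + Z\<^sup>2 \<le> 4 * l2 / l1 * (Y\<^sup>2 - X * Z) + 2 / l1 * (l2 / l1\<^sup>2 + 1 / l1) * g\<^sup>2"
proof -
  define D where "D = Y\<^sup>2 - X * Z"
  define N where "N = X\<^sup>2 + 2 * Y\<^sup>2 + Z\<^sup>2"
  have T: "2 * l1 \<le> a + c" "a + c \<le> 2 * l2"
    using ell(1)[of 1 0] ell(1)[of 0 1] ell(2)[of 1 0] ell(2)[of 0 1] by auto
  have "a * D = a * Y\<^sup>2 + 2 * b * Y * Z + c * Z\<^sup>2 + g * Z"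
  proof -
    have "a * D = a * Y\<^sup>2 - (a * X) * Z" by (simp add: D_def algebra_simps)
    also have "a * X = - 2 * b * Y - c * Z - g" using eq by linarith
    finally show ?thesis by (simp add: power2_eq_square algebra_simps)
  qed
  then have 1: "l1 * (Y\<^sup>2 + Z\<^sup>2) + g * Z \<le> a * D" using ell(1)[of Y Z] by simp
  have "c * D = a * X\<^sup>2 + 2 * b * X * Y + c * Y\<^sup>2 + g * X"
  proof -
    have "c * D = c * Y\<^sup>2 - (c * Z) * X" by (simp add: D_def algebra_simps)
    also have "c * Z = - 2 * b * Y - a * X - g" using eq by linarith
    finally show ?thesis by (simp add: power2_eq_square algebra_simps)
  qed
  then have 2: "l1 * (X\<^sup>2 + Y\<^sup>2) + g * X \<le> c * D" using ell(1)[of X Y] by simp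
  have young: "- (l1 / 2 * x\<^sup>2 + g\<^sup>2 / (2 * l1)) \<le> g * x" for x
  proof -
    have "0 \<le> (l1 * x + g)\<^sup>2 / (2 * l1)" using l by simp
    also have "\<dots> = l1 / 2 * x\<^sup>2 + g\<^sup>2 / (2 * l1) + g * x"
      using l by (simp add: power2_eq_square field_simps)
    finally show ?thesis by linarith
  qed
  have "l1 * (X\<^sup>2 + Y\<^sup>2) + l1 * (Y\<^sup>2 + Z\<^sup>2) = l1 / 2 * N + l1 * Y\<^sup>2 + l1 / 2 * X\<^sup>2 + l1 / 2 * Z\<^sup>2"
    by (simp add: N_def algebra_simps)
  moreover have "0 \<le> l1 * Y\<^sup>2" using l by simp
  moreover have "g\<^sup>2 / (2 * l1) + g\<^sup>2 / (2 * l1) = g\<^sup>2 / l1" by simp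
  moreover have "(a + c) * D = a * D + c * D" by (rule distrib_right)
  ultimately have 3: "l1 / 2 * N \<le> (a + c) * D + g\<^sup>2 / l1"
    using 1 2 young[of X] young[of Z] by linarith
  have N0: "0 \<le> N" by (simp add: N_def)
  \<comment> \<open>Replacing \<open>a + c\<close> by its upper bound needs
    \<open>D \<ge> 0\<close>. For negative \<open>D\<close> the lower bound \<open>2 * l1\<close>
    and the inequality just proved show that \<open>2 * l1 * D\<close> is at least
    \<open>- g\<^sup>2 / l1\<close>, which the extra term compensates.\<close>
  have "(a + c) * D \<le> 2 * l2 * D + l2 / l1\<^sup>2 * g\<^sup>2"
  proof (cases "0 \<le> D")
    case True
    have "(a + c) * D \<le> 2 * l2 * D" using T True by (intro mult_right_mono) auto
    moreover have "0 \<le> l2 / l1\<^sup>2 * g\<^sup>2" using l by simp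
    ultimately show ?thesis by linarith
  next
    case False
    have "(a + c) * D \<le> 2 * l1 * D" using T False by (intro mult_right_mono_neg) auto
    moreover have "0 \<le> l1 / 2 * N" using l N0 by simp
    ultimately have "- (g\<^sup>2 / l1) \<le> 2 * l1 * D" using 3 by linarith
    then have "l2 / l1 * - (g\<^sup>2 / l1) \<le> l2 / l1 * (2 * l1 * D)"
      using l by (intro mult_left_mono) auto
    then have "- (l2 / l1\<^sup>2 * g\<^sup>2) \<le> 2 * l2 * D"
      using l by (simp add: power2_eq_square)
    moreover have "(a + c) * D \<le> 0" using T l False by (intro mult_nonneg_nonpos) auto
    ultimately show ?thesis by linarith
  qed
  then have "l1 / 2 * N \<le> 2 * l2 * D + (l2 / l1\<^sup>2 + 1 / l1) * g\<^sup>2"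
  proof -
    have "(l2 / l1\<^sup>2 + 1 / l1) * g\<^sup>2 = l2 / l1\<^sup>2 * g\<^sup>2 + g\<^sup>2 / l1"
      by (simp add: distrib_right)
    then show ?thesis using 3 \<open>(a + c) * D \<le> _\<close> by linarith
  qed
  then have "2 / l1 * (l1 / 2 * N) \<le> 2 / l1 * (2 * l2 * D + (l2 / l1\<^sup>2 + 1 / l1) * g\<^sup>2)"
    using l by (intro mult_left_mono) auto
  moreover have "2 / l1 * (l1 / 2 * N) = N" using l by simp
  moreover have "2 / l1 * (2 * l2 * D + h * y) = 4 * l2 / l1 * D + 2 / l1 * h * y" for h y
    by (simp add: distrib_left)
  ultimately show ?thesis
    by (simp only: D_def N_def)
qed

text \<open>Boundedness of \<open>b1\<close> and \<open>b2\<close> turns the squared first-order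
  terms into a multiple of \<open>|w|\<^sup>2\<close>.\<close>

lemma pde_quasi:
  fixes u :: "real^2 \<Rightarrow> real"
  assumes S: "open S" and u: "smooth_on u S" and l: "0 < l1" "l1 \<le> l2"
    and b: "bounded (b1 ` S)" "bounded (b2 ` S)"
    and ell: "\<forall>x\<in>S. \<forall>\<xi>::real^2.
           l1 * (norm \<xi>)\<^sup>2 \<le> a11 x * (\<xi> $ 1)\<^sup>2 + 2 * a12 x * \<xi> $ 1 * \<xi> $ 2 + a22 x * (\<xi> $ 2)\<^sup>2 \<and>
           a11 x * (\<xi> $ 1)\<^sup>2 + 2 * a12 x * \<xi> $ 1 * \<xi> $ 2 + a22 x * (\<xi> $ 2)\<^sup>2 \<le> l2 * (norm \<xi>)\<^sup>2"
    and pde: "\<forall>x\<in>S. a11 x * partial 1 (partial 1 u) x + 2 * a12 x * partial 2 (partial 1 u) x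
               + a22 x * partial 2 (partial 2 u) x + b1 x * partial 1 u x + b2 x * partial 2 u x = 0"
  shows "\<exists>K C. 0 < K \<and> 0 \<le> C \<and> (\<forall>x\<in>S. (partial 1 (partial 1 u) x)\<^sup>2 + (partial 2 (partial 1 u) x)\<^sup>2
      + (partial 1 (partial 2 u) x)\<^sup>2 + (partial 2 (partial 2 u) x)\<^sup>2
      \<le> K * (partial 2 (partial 1 u) x * partial 1 (partial 2 u) x - partial 1 (partial 1 u) x * partial 2 (partial 2 u) x)
        + C * ((partial 1 u x)\<^sup>2 + (partial 2 u x)\<^sup>2))"
proof -
  obtain M1 where M1: "\<And>x. x \<in> S \<Longrightarrow> \<bar>b1 x\<bar> \<le> M1" using b(1) unfolding bounded_real by auto
  obtain M2 where M2: "\<And>x. x \<in> S \<Longrightarrow> \<bar>b2 x\<bar> \<le> M2" using b(2) unfolding bounded_real by auto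
  define k where "k = 2 / l1 * (l2 / l1\<^sup>2 + 1 / l1)"
  define C where "C = k * (2 * M1\<^sup>2 + 2 * M2\<^sup>2)"
  have k: "0 \<le> k" using l by (simp add: k_def)
  have "(partial 1 (partial 1 u) x)\<^sup>2 + (partial 2 (partial 1 u) x)\<^sup>2
      + (partial 1 (partial 2 u) x)\<^sup>2 + (partial 2 (partial 2 u) x)\<^sup>2
      \<le> 4 * l2 / l1 * (partial 2 (partial 1 u) x * partial 1 (partial 2 u) x - partial 1 (partial 1 u) x * partial 2 (partial 2 u) x)
        + C * ((partial 1 u x)\<^sup>2 + (partial 2 u x)\<^sup>2)" if x: "x \<in> S" for x
  proof -
    define g where "g = b1 x * partial 1 u x + b2 x * partial 2 u x"
    have com: "partial 1 (partial 2 u) x = partial 2 (partial 1 u) x"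
      by (rule partial_commute[OF S u x])
    have e: "l1 * (s\<^sup>2 + t\<^sup>2) \<le> a11 x * s\<^sup>2 + 2 * a12 x * s * t + a22 x * t\<^sup>2"
      "a11 x * s\<^sup>2 + 2 * a12 x * s * t + a22 x * t\<^sup>2 \<le> l2 * (s\<^sup>2 + t\<^sup>2)" for s t
    proof -
      have "(norm (vector [s, t] :: real^2))\<^sup>2 = s\<^sup>2 + t\<^sup>2"
        by (simp add: norm_vec_def L2_set_def sum_2)
      then show "l1 * (s\<^sup>2 + t\<^sup>2) \<le> a11 x * s\<^sup>2 + 2 * a12 x * s * t + a22 x * t\<^sup>2"
        "a11 x * s\<^sup>2 + 2 * a12 x * s * t + a22 x * t\<^sup>2 \<le> l2 * (s\<^sup>2 + t\<^sup>2)"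
        using ell x by (metis vector_2)+
    qed
    have "(partial 1 (partial 1 u) x)\<^sup>2 + 2 * (partial 2 (partial 1 u) x)\<^sup>2 + (partial 2 (partial 2 u) x)\<^sup>2
      \<le> 4 * l2 / l1 * ((partial 2 (partial 1 u) x)\<^sup>2 - partial 1 (partial 1 u) x * partial 2 (partial 2 u) x) + k * g\<^sup>2"
      unfolding k_def by (rule elliptic_pointwise[OF l e]) (use pde x in \<open>simp add: g_def add.assoc\<close>)
    moreover have "k * g\<^sup>2 \<le> C * ((partial 1 u x)\<^sup>2 + (partial 2 u x)\<^sup>2)"
    proof -
      have "(b1 x)\<^sup>2 \<le> M1\<^sup>2" "(b2 x)\<^sup>2 \<le> M2\<^sup>2"
        using M1[OF x] M2[OF x] by (auto simp: abs_le_square_iff[symmetric])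
      then have "(b1 x)\<^sup>2 * (partial 1 u x)\<^sup>2 \<le> M1\<^sup>2 * (partial 1 u x)\<^sup>2"
        "(b2 x)\<^sup>2 * (partial 2 u x)\<^sup>2 \<le> M2\<^sup>2 * (partial 2 u x)\<^sup>2"
        by (auto intro: mult_right_mono)
      moreover have "g\<^sup>2 \<le> 2 * ((b1 x)\<^sup>2 * (partial 1 u x)\<^sup>2) + 2 * ((b2 x)\<^sup>2 * (partial 2 u x)\<^sup>2)"
        using square_add_le[of "b1 x * partial 1 u x" "b2 x * partial 2 u x"] by (simp add: g_def power_mult_distrib)
      moreover have "0 \<le> M1\<^sup>2 * (partial 2 u x)\<^sup>2" "0 \<le> M2\<^sup>2 * (partial 1 u x)\<^sup>2" by auto
      ultimately have "g\<^sup>2 \<le> (2 * M1\<^sup>2 + 2 * M2\<^sup>2) * ((partial 1 u x)\<^sup>2 + (partial 2 u x)\<^sup>2)"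
        unfolding distrib_left distrib_right by linarith
      then show ?thesis using k unfolding C_def mult.assoc by (intro mult_left_mono)
    qed
    ultimately show ?thesis unfolding com by (simp add: power2_eq_square)
  qed
  moreover have "0 < 4 * l2 / l1" "0 \<le> C" using l k by (auto simp: C_def)
  ultimately show ?thesis by blast
qed

text \<open>In turn: \<open>Dw \<noteq> 0\<close>; \<open>det Dw < 0\<close> quantitatively; \<open>w\<close> turns clockwise along the circle of radius \<open>t\<close>;
  Euler's relation \<open>Dw v = m w\<close> for homogeneous fields, up to a small error.\<close>

definition nearly_homogeneous ::
  "real \<Rightarrow> real \<Rightarrow> (real^2 \<Rightarrow> real) \<Rightarrow> (real^2 \<Rightarrow> real) \<Rightarrow> real^2 \<Rightarrow> real \<Rightarrow> real \<Rightarrow> bool" where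
  "nearly_homogeneous K m p q z t a \<longleftrightarrow> (let x = polar z t a; c = cos a; s = sin a;
       N = (partial 1 p x)\<^sup>2 + (partial 2 p x)\<^sup>2 + (partial 1 q x)\<^sup>2 + (partial 2 q x)\<^sup>2 in
     0 < N \<and> N \<le> 2 * K * (partial 2 p x * partial 1 q x - partial 1 p x * partial 2 q x) \<and>
     p x * (c * partial 2 q x - s * partial 1 q x) - q x * (c * partial 2 p x - s * partial 1 p x) < 0 \<and>
     4 * K\<^sup>2 * ((t * (c * partial 1 p x + s * partial 2 p x) - m * p x)\<^sup>2
       + (t * (c * partial 1 q x + s * partial 2 q x) - m * q x)\<^sup>2) < t\<^sup>2 * N)"

lemma structure_near_zero:
  fixes p q :: "real^2 \<Rightarrow> real"
  assumes S: "open S" "connected S" "z \<in> S" and p: "smooth_on p S" and q: "smooth_on q S"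
    and K: "0 < K" and C: "0 \<le> C"
    and quasi: "\<And>x. x \<in> S \<Longrightarrow> (partial 1 p x)\<^sup>2 + (partial 2 p x)\<^sup>2 + (partial 1 q x)\<^sup>2 + (partial 2 q x)\<^sup>2
      \<le> K * (partial 2 p x * partial 1 q x - partial 1 p x * partial 2 q x) + C * ((p x)\<^sup>2 + (q x)\<^sup>2)"
    and nz: "\<exists>x\<in>S. p x \<noteq> 0 \<or> q x \<noteq> 0" and z: "p z = 0" "q z = 0"
  shows "\<exists>r>0. \<exists>m::nat. 0 < m \<and> cball z r \<subseteq> S \<and> (\<forall>t a. 0 < t \<longrightarrow> t \<le> r \<longrightarrow> a \<in> {0..2*pi} \<longrightarrow>
    nearly_homogeneous K m p q z t a)"
proof -
  define NZ where "NZ j a \<longleftrightarrow> dird j (vector [cos a, sin a]) p z \<noteq> 0 \<or> dird j (vector [cos a, sin a]) q z \<noteq> 0" for j a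
  obtain j e where je: "norm e = 1" "dird j e p z \<noteq> 0 \<or> dird j e q z \<noteq> 0"
    using finite_order[OF S p q K C quasi nz] by blast
  obtain t0 a' where "e = polar 0 t0 a'" "t0 = dist 0 e" "0 \<le> a'" "a' \<le> 2 * pi" by (rule polar_surj)
  then have "e = vector [cos a', sin a']" using je(1) by (simp add: polar_def)
  then have ex: "\<exists>a\<in>{0..2*pi}. NZ j a" using je(2) \<open>0 \<le> a'\<close> \<open>a' \<le> 2*pi\<close> by (auto simp: NZ_def)
  \<comment> \<open>The order is minimal over all directions and both components together, so
    Euler's relation holds with the same \<open>m\<close> for \<open>p\<close> and \<open>q\<close>
    in every direction, even where a leading term vanishes.\<close>
  define m where "m = (LEAST j. \<exists>a\<in>{0..2*pi}. NZ j a)"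
  obtain a0 where a0: "a0 \<in> {0..2*pi}" "NZ m a0"
    using LeastI_ex[of "\<lambda>j. \<exists>a\<in>{0..2*pi}. NZ j a"] ex unfolding m_def by blast
  have less: "\<not> NZ j a" if "j < m" "a \<in> {0..2*pi}" for j a
    using not_less_Least[of j "\<lambda>j. \<exists>a\<in>{0..2*pi}. NZ j a"] that unfolding m_def by blast
  have m: "0 < m" using a0(2) z by (cases m) (auto simp: NZ_def)
  obtain r0 where r0: "0 < r0" "cball z r0 \<subseteq> S" using S open_contains_cball by blast
  have b0: "ball z r0 \<subseteq> S" using r0(2) ball_subset_cball by blast
  note pb = smooth_on_subset[OF p b0] and qb = smooth_on_subset[OF q b0]
  obtain R0 where R0: "0 < R0" "R0 < r0" and small: "\<And>x. x \<in> cball z R0 \<Longrightarrow> (p x)\<^sup>2 + (q x)\<^sup>2 \<le> 1/8"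
    using exists_small_radius[OF pb qb r0(1) z] by auto
  define tay where "tay g M \<longleftrightarrow> 0 \<le> M \<and> (\<forall>t a. 0 < t \<longrightarrow> t \<le> r0 \<longrightarrow> a \<in> {0..2*pi} \<longrightarrow>
    \<bar>g (polar z t a) - dird m (vector [cos a, sin a]) g z / fact m * t ^ m\<bar> \<le> M * (t ^ m * t) \<and>
    \<bar>t * (cos a * partial 1 g (polar z t a) + sin a * partial 2 g (polar z t a)) - m * g (polar z t a)\<bar> \<le> M * (t ^ m * t))"
    for g :: "real^2 \<Rightarrow> real" and M
  obtain M1 M2 where M1: "tay p M1" and M2: "tay q M2"
    using dird_taylor[OF p r0(2), of m] dird_taylor[OF q r0(2), of m] less m
    unfolding tay_def NZ_def power_Suc mult.commute[of _ "_ ^ m"] Suc_le_eq One_nat_def by meson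
  obtain g M where g: "g = p \<or> g = q" "tay g M" "dird m (vector [cos a0, sin a0]) g z \<noteq> 0"
    using a0(2) M1 M2 unfolding NZ_def by blast
  define k where "k = \<bar>dird m (vector [cos a0, sin a0]) g z\<bar> / fact m"
  have k: "0 < k" using g(3) by (simp add: k_def)
  \<comment> \<open>The last entry keeps the Taylor error in direction \<open>a0\<close> below half
    of the leading term.\<close>
  define R where "R = min (min R0 1) (k / (2 * (M + 1)))"
  have M0: "0 \<le> M" using g(2) by (simp add: tay_def)
  have R: "0 < R" "R \<le> R0" "R \<le> 1" "R < r0" "R \<le> k / (2 * (M + 1))" using R0 k M0 by (auto simp: R_def)
  have small': "(p x)\<^sup>2 + (q x)\<^sup>2 \<le> 1/8" if "x \<in> cball z R" for x using small that R by auto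
  have quasi': "(partial 1 p x)\<^sup>2 + (partial 2 p x)\<^sup>2 + (partial 1 q x)\<^sup>2 + (partial 2 q x)\<^sup>2
      \<le> K * (partial 2 p x * partial 1 q x - partial 1 p x * partial 2 q x) + C * ((p x)\<^sup>2 + (q x)\<^sup>2)"
    if "x \<in> ball z r0" for x using quasi b0 that by blast
  have pp: "polar_pair (\<lambda>t a. p (polar z t a)) (\<lambda>t a. q (polar z t a))
    (polar_dt z p) (polar_dt z q) (polar_da z p) (polar_da z q) (polar_dta z p) (polar_dta z q) R K C"
    by (rule polar_pairI[OF pb qb R(1,4) K C small' quasi'])
  have "(k / 2)\<^sup>2 * (t ^ m)\<^sup>2 \<le> (p (polar z t a0))\<^sup>2 + (q (polar z t a0))\<^sup>2" if t: "0 < t" "t \<le> R" for t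
  proof -
    have "M * t \<le> M * (k / (2 * (M + 1)))" using t R(5) M0 by (intro mult_left_mono) auto
    also have "\<dots> \<le> k / 2" using M0 k by (simp add: field_simps)
    finally have "M * t * t ^ m \<le> k / 2 * t ^ m" using t by (intro mult_right_mono) auto
    moreover have "\<bar>g (polar z t a0) - dird m (vector [cos a0, sin a0]) g z / fact m * t ^ m\<bar> \<le> M * t * t ^ m"
      using g(2) t R a0(1) unfolding tay_def by (simp add: mult.assoc mult.commute[of t])
    moreover have "\<bar>dird m (vector [cos a0, sin a0]) g z / fact m * t ^ m\<bar> = k * t ^ m"
      using t by (simp add: k_def abs_mult)
    ultimately have "k / 2 * t ^ m \<le> \<bar>g (polar z t a0)\<bar>" by linarith
    then have "(k / 2 * t ^ m)\<^sup>2 \<le> (g (polar z t a0))\<^sup>2"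
      using k t by (intro abs_le_square_iff[THEN iffD1]) (simp add: abs_mult)
    also have "\<dots> \<le> (p (polar z t a0))\<^sup>2 + (q (polar z t a0))\<^sup>2" using g(1) by auto
    finally show ?thesis by (simp only: power_mult_distrib)
  qed
  note lower = this[folded polar_pair.S_def[OF pp]]
  have D: "(t * polar_dt z p t a - m * p (polar z t a))\<^sup>2 + (t * polar_dt z q t a - m * q (polar z t a))\<^sup>2
    \<le> (M1\<^sup>2 + M2\<^sup>2) * (t ^ m * t)\<^sup>2" if t: "0 < t" "t \<le> R" "a \<in> {0..2*pi}" for t a
  proof -
    have "(t * polar_dt z p t a - m * p (polar z t a))\<^sup>2 \<le> (M1 * (t ^ m * t))\<^sup>2"
      "(t * polar_dt z q t a - m * q (polar z t a))\<^sup>2 \<le> (M2 * (t ^ m * t))\<^sup>2"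
      using M1 M2 t R unfolding tay_def polar_dt_def by (auto intro!: power2_le_iff_abs_le[THEN iffD2])
    then show ?thesis by (simp add: power_mult_distrib distrib_right)
  qed
  have "(k / 2)\<^sup>2 > 0" using k by simp
  from polar_pair.local_structure[OF pp R(3) _ a0(1) this D lower] m
  obtain r where r: "0 < r" "r \<le> R" and str: "\<And>t a. 0 < t \<Longrightarrow> t \<le> r \<Longrightarrow> a \<in> {0..2*pi} \<Longrightarrow>
     0 < t\<^sup>2 * ((polar_dt z p t a)\<^sup>2 + (polar_dt z q t a)\<^sup>2) + ((polar_da z p t a)\<^sup>2 + (polar_da z q t a)\<^sup>2) \<and>
     t\<^sup>2 * ((polar_dt z p t a)\<^sup>2 + (polar_dt z q t a)\<^sup>2) + ((polar_da z p t a)\<^sup>2 + (polar_da z q t a)\<^sup>2)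
       \<le> 2 * K * t * (polar_da z p t a * polar_dt z q t a - polar_dt z p t a * polar_da z q t a) \<and>
     p (polar z t a) * polar_da z q t a - q (polar z t a) * polar_da z p t a < 0 \<and>
     4 * K\<^sup>2 * ((t * polar_dt z p t a - m * p (polar z t a))\<^sup>2 + (t * polar_dt z q t a - m * q (polar z t a))\<^sup>2)
       < t\<^sup>2 * ((polar_dt z p t a)\<^sup>2 + (polar_dt z q t a)\<^sup>2) + ((polar_da z p t a)\<^sup>2 + (polar_da z q t a)\<^sup>2)"
    by (auto simp: Suc_le_eq)
  show ?thesis
  proof (intro exI[of _ r] exI[of _ m] conjI allI impI)
    show "cball z r \<subseteq> S" using r R r0(2) by (auto simp: subset_iff)
    fix t a assume t: "0 < t" "t \<le> r" "a \<in> {0..2*pi}"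
    define x where "x = polar z t a"
    define N where "N = (partial 1 p x)\<^sup>2 + (partial 2 p x)\<^sup>2 + (partial 1 q x)\<^sup>2 + (partial 2 q x)\<^sup>2"
    define J where "J = partial 2 p x * partial 1 q x - partial 1 p x * partial 2 q x"
    have s: "0 < t\<^sup>2 * N" "t\<^sup>2 * N \<le> 2 * K * (t\<^sup>2 * J)"
      "p x * (t * (cos a * partial 2 q x - sin a * partial 1 q x)) - q x * (t * (cos a * partial 2 p x - sin a * partial 1 p x)) < 0"
      "4 * K\<^sup>2 * ((t * (cos a * partial 1 p x + sin a * partial 2 p x) - m * p x)\<^sup>2
       + (t * (cos a * partial 1 q x + sin a * partial 2 q x) - m * q x)\<^sup>2) < t\<^sup>2 * N"
      using str[OF t, unfolded polar_dt_def polar_da_def polar_sum_squares mult.assoc[of "2 * K" t], unfolded polar_det]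
      unfolding x_def N_def J_def by auto
    have "t\<^sup>2 * N \<le> t\<^sup>2 * (2 * K * J)" using s(2) by (simp add: algebra_simps)
    moreover have "t * (p x * (cos a * partial 2 q x - sin a * partial 1 q x) - q x * (cos a * partial 2 p x - sin a * partial 1 p x)) < 0"
      using s(3) by (simp add: algebra_simps)
    ultimately have "0 < N" "N \<le> 2 * K * J"
      "p x * (cos a * partial 2 q x - sin a * partial 1 q x) - q x * (cos a * partial 2 p x - sin a * partial 1 p x) < 0"
      using s(1) t by (auto simp: zero_less_mult_iff mult_less_0_iff dest: mult_left_le_imp_le)
    then show "nearly_homogeneous K m p q z t a"
      using s(4) unfolding nearly_homogeneous_def Let_def x_def N_def J_def by blast
  qed (use r m in auto)
qed

text \<open>The symmetric matrix with entries \<open>X\<close>, \<open>Y\<close>, \<open>Z\<close>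
  acts on \<open>\<zeta> = c + i s\<close> as
  \<open>(X + Z) / 2 * \<zeta> + \<beta> * cnj \<zeta>\<close>. With \<open>A = |X + Z| / 2\<close>
  and \<open>b = |\<beta>|\<close>, \<open>Y\<^sup>2 - X Z\<close> is
  \<open>(b - A) (b + A)\<close>, and \<open>N\<close> gives
  \<open>n \<le> 4 K\<^sup>2 (b - A)\<^sup>2\<close>. Hence the error in Euler's relation is less
  than \<open>t (b - A)\<close>.\<close>

lemma gradient_column_near_rotated_field:
  fixes X Y Z p q c s t m K :: real
  assumes cs: "c\<^sup>2 + s\<^sup>2 = 1" and t: "0 < t" and K: "0 < K"
    and N: "0 < X\<^sup>2 + 2 * Y\<^sup>2 + Z\<^sup>2" "X\<^sup>2 + 2 * Y\<^sup>2 + Z\<^sup>2 \<le> 2 * K * (Y\<^sup>2 - X * Z)"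
    and d: "4 * K\<^sup>2 * ((t * (c * X + s * Y) - m * p)\<^sup>2 + (t * (c * Y + s * Z) - m * q)\<^sup>2) < t\<^sup>2 * (X\<^sup>2 + 2 * Y\<^sup>2 + Z\<^sup>2)"
  defines "\<beta> \<equiv> Complex ((X - Z) / 2) Y"
  shows "\<bar>X + Z\<bar> / 2 < cmod \<beta>" and "cmod (of_real (m / t) * Complex p q * Complex c s - \<beta>) < cmod \<beta>"
proof -
  define A where "A = \<bar>X + Z\<bar> / 2"
  define b where "b = cmod \<beta>"
  define n where "n = X\<^sup>2 + 2 * Y\<^sup>2 + Z\<^sup>2"
  have A2: "A\<^sup>2 = (X + Z)\<^sup>2 / 4" by (simp add: A_def power_divide)
  have b2: "b\<^sup>2 = ((X - Z) / 2)\<^sup>2 + Y\<^sup>2" by (simp add: b_def \<beta>_def cmod_power2)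
  have n: "n = 2 * b\<^sup>2 + 2 * A\<^sup>2"
    unfolding A2 b2 n_def by (simp add: power2_eq_square field_simps)
  have det: "Y\<^sup>2 - X * Z = (b - A) * (b + A)"
  proof -
    have "(b - A) * (b + A) = b\<^sup>2 - A\<^sup>2" by (simp add: power2_eq_square algebra_simps)
    then show ?thesis unfolding A2 b2 by (simp add: power2_eq_square field_simps)
  qed
  have A0: "0 \<le> A" "0 \<le> b" by (simp_all add: A_def b_def)
  have "0 < 2 * K * ((b - A) * (b + A))" using N by (simp add: det[symmetric])
  then have bA: "0 < b - A" "0 < b + A"
    using K A0 by (auto simp: zero_less_mult_iff)
  then show 1: "\<bar>X + Z\<bar> / 2 < cmod \<beta>" by (simp add: A_def b_def)
  have sq: "(b + A)\<^sup>2 \<le> n" using square_add_le[of b A] by (simp add: n)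
  have nK: "n \<le> 2 * K * (b - A) * (b + A)" using N(2) by (simp add: n_def det mult.assoc)
  have "(b + A) * (b + A) \<le> 2 * K * (b - A) * (b + A)"
    using sq nK by (simp add: power2_eq_square)
  then have "b + A \<le> 2 * K * (b - A)" using bA by (metis mult_right_le_imp_le)
  then have "2 * K * (b - A) * (b + A) \<le> 2 * K * (b - A) * (2 * K * (b - A))"
    using bA K by (intro mult_left_mono) auto
  then have nsq: "n \<le> 4 * K\<^sup>2 * (b - A)\<^sup>2" using nK by (simp add: power2_eq_square algebra_simps)
  define \<delta> where "\<delta> = Complex (t * (c * X + s * Y) - m * p) (t * (c * Y + s * Z) - m * q)"
  have "4 * K\<^sup>2 * (cmod \<delta>)\<^sup>2 < t\<^sup>2 * n"
    using d by (simp add: \<delta>_def cmod_power2 n_def)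
  also have "\<dots> \<le> t\<^sup>2 * (4 * K\<^sup>2 * (b - A)\<^sup>2)" using nsq by (intro mult_left_mono) auto
  also have "\<dots> = 4 * K\<^sup>2 * (t * (b - A))\<^sup>2" by (simp add: power_mult_distrib)
  finally have "(cmod \<delta>)\<^sup>2 < (t * (b - A))\<^sup>2" using K by simp
  then have "cmod \<delta> < t * (b - A)" by (rule power2_less_imp_less) (use t bA in simp)
  then have \<delta>: "cmod \<delta> / t < b - A" using t by (simp add: field_simps)
  define \<zeta> where "\<zeta> = Complex c s"
  have z: "\<zeta> * cnj \<zeta> = 1" using cs by (simp add: \<zeta>_def complex_eq_iff power2_eq_square)
  have n1: "cmod \<zeta> = 1" using cs by (simp add: \<zeta>_def cmod_def)
  have "Complex (c * X + s * Y) (c * Y + s * Z) = of_real ((X + Z) / 2) * \<zeta> + \<beta> * cnj \<zeta>"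
    by (simp add: \<zeta>_def \<beta>_def complex_eq_iff field_simps)
  moreover have "\<delta> = of_real t * Complex (c * X + s * Y) (c * Y + s * Z) - of_real m * Complex p q"
    by (simp add: \<delta>_def complex_eq_iff)
  ultimately have "\<delta> = of_real t * (of_real ((X + Z) / 2) * \<zeta> + \<beta> * cnj \<zeta>) - of_real m * Complex p q" by simp
  \<comment> \<open>Multiplying by \<open>\<zeta>\<close>, a unit, frees \<open>\<beta>\<close> from
    the factor \<open>cnj \<zeta>\<close>.\<close>
  then have "\<delta> * \<zeta> = of_real t * (of_real ((X + Z) / 2) * \<zeta> * \<zeta> + \<beta> * (\<zeta> * cnj \<zeta>)) - of_real m * Complex p q * \<zeta>"
    by (simp only:) (simp add: algebra_simps)
  then have "of_real (m / t) * Complex p q * \<zeta> - \<beta> = of_real ((X + Z) / 2) * \<zeta> * \<zeta> - \<delta> * \<zeta> / of_real t"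
  proof -
    have "M / T * W * G - V = U - D / T" if "D = T * (U + V * 1) - M * W * G" "T \<noteq> 0"
      for D T U V M W G :: complex
      using that by (simp add: field_simps)
    from this[OF \<open>\<delta> * \<zeta> = _\<close>[unfolded z]] show ?thesis using t by simp
  qed
  then have "cmod (of_real (m / t) * Complex p q * \<zeta> - \<beta>) \<le> cmod (of_real ((X + Z) / 2) * \<zeta> * \<zeta>) + cmod (\<delta> * \<zeta> / of_real t)"
    by (simp only: norm_triangle_ineq4)
  also have "\<dots> = A + cmod \<delta> / t"
    using t by (simp add: norm_mult norm_divide n1 A_def del: of_real_add of_real_divide)
  also have "\<dots> < b" using \<delta> by simp
  finally show "cmod (of_real (m / t) * Complex p q * Complex c s - \<beta>) < cmod \<beta>"
    by (simp add: b_def \<zeta>_def)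
qed

text \<open>The curve \<open>\<beta>\<close> is compared with \<open>w\<close> times the unit circle
  on one side and with the gradient of \<open>p\<close> on the other. The gradient of
  \<open>q\<close> is compared with \<open>- \<i> * \<beta>\<close>, a constant rotation with the
  same winding number.\<close>

lemma winding_gradients:
  fixes p q :: "real^2 \<Rightarrow> real"
  assumes p: "smooth_on p (ball z r)" and q: "smooth_on q (ball z r)" and t: "0 < t" "t < r"
    and K: "0 < K" and m: "0 < m"
    and sym: "\<And>x. x \<in> ball z r \<Longrightarrow> partial 1 q x = partial 2 p x"
    and str: "\<And>a. a \<in> {0..2*pi} \<Longrightarrow> nearly_homogeneous K m p q z t a"
  shows "\<exists>k\<le>0. winding_number (field_circle (grad p) z t) 0 = of_int k \<and>
    winding_number (field_circle (grad q) z t) 0 = of_int k"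
proof -
  define \<gamma> where "\<gamma> x = polar z t (2 * pi * x)" for x
  have inb: "\<gamma> x \<in> ball z r" for x using t by (simp add: \<gamma>_def dist_polar)
  have c\<gamma>: "continuous_on A (\<lambda>x. g (\<gamma> x))" if "smooth_on g (ball z r)" for g A
    unfolding \<gamma>_def
    by (rule continuous_on_compose2[OF smooth_on_continuous[OF that]])
      (use inb[unfolded \<gamma>_def] in \<open>auto intro!: continuous_intros simp del: mem_ball\<close>)
  note cg = c\<gamma>[OF p] c\<gamma>[OF q] c\<gamma>[OF smooth_on_partial[OF p]] c\<gamma>[OF smooth_on_partial[OF q]]
  have cC: "continuous_on A (\<lambda>x. Complex (f x) (g x))" if "continuous_on A f" "continuous_on A g"
    for A f and g :: "real \<Rightarrow> real"
    unfolding Complex_eq by (intro continuous_intros that)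
  define w where "w x = Complex (p (\<gamma> x)) (q (\<gamma> x))" for x
  define \<beta> where "\<beta> x = Complex ((partial 1 p (\<gamma> x) - partial 2 q (\<gamma> x)) / 2) (partial 2 p (\<gamma> x))" for x
  define w1 where "w1 x = Complex (partial 1 p (\<gamma> x)) (partial 2 p (\<gamma> x))" for x
  define w2 where "w2 x = Complex (partial 2 p (\<gamma> x)) (partial 2 q (\<gamma> x))" for x
  define e where "e x = exp (2 * of_real pi * \<i> * of_real x)" for x :: real
  have e: "e x = Complex (cos (2 * pi * x)) (sin (2 * pi * x))" for x
    by (simp add: e_def complex_eq_iff Re_exp Im_exp)
  have loop: "\<gamma> 1 = \<gamma> 0" by (simp add: \<gamma>_def polar_2pi)
  have paths: "path w" "path \<beta>" "path w1" "path w2" "path (\<lambda>x. - \<i> * \<beta> x)"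
    "path (\<lambda>x. of_real (m / t) * w x * e x)" "path (\<lambda>x. - \<i> * of_real (m / t) * w x * e x)"
    unfolding path_def w_def \<beta>_def w1_def w2_def e_def by (intro continuous_intros cC cg; simp)+
  have str': "\<bar>partial 1 p (\<gamma> x) + partial 2 q (\<gamma> x)\<bar> / 2 < cmod (\<beta> x)"
    "cmod (of_real (m / t) * w x * e x - \<beta> x) < cmod (\<beta> x)"
    "p (\<gamma> x) * (cos (2 * pi * x) * partial 2 q (\<gamma> x) - sin (2 * pi * x) * partial 1 q (\<gamma> x))
      - q (\<gamma> x) * (cos (2 * pi * x) * partial 2 p (\<gamma> x) - sin (2 * pi * x) * partial 1 p (\<gamma> x)) < 0"
    if x: "x \<in> {0..1}" for x
  proof -
    have "2 * pi * x \<in> {0..2*pi}" using x by (auto simp: mult_le_cancel_left1)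
    note s = str[OF this, unfolded nearly_homogeneous_def Let_def, folded \<gamma>_def, unfolded sym[OF inb]]
    define X Y Z where "X = partial 1 p (\<gamma> x)" and "Y = partial 2 p (\<gamma> x)" and "Z = partial 2 q (\<gamma> x)"
    have N: "X\<^sup>2 + Y\<^sup>2 + Y\<^sup>2 + Z\<^sup>2 = X\<^sup>2 + 2 * Y\<^sup>2 + Z\<^sup>2" "Y * Y - X * Z = Y\<^sup>2 - X * Z"
      by (simp_all add: power2_eq_square)
    note s' = s[folded X_def Y_def Z_def, unfolded N]
    show "\<bar>partial 1 p (\<gamma> x) + partial 2 q (\<gamma> x)\<bar> / 2 < cmod (\<beta> x)"
      unfolding \<beta>_def X_def[symmetric] Y_def[symmetric] Z_def[symmetric]
      by (rule gradient_column_near_rotated_field(1)[OF _ t(1) K]) (use s' in \<open>auto simp del: of_nat_eq_0_iff\<close>)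
    show "cmod (of_real (m / t) * w x * e x - \<beta> x) < cmod (\<beta> x)"
      unfolding \<beta>_def w_def e X_def[symmetric] Y_def[symmetric] Z_def[symmetric]
      by (rule gradient_column_near_rotated_field(2)[OF _ t(1) K]) (use s' in auto)
    show "p (\<gamma> x) * (cos (2 * pi * x) * partial 2 q (\<gamma> x) - sin (2 * pi * x) * partial 1 q (\<gamma> x))
      - q (\<gamma> x) * (cos (2 * pi * x) * partial 2 p (\<gamma> x) - sin (2 * pi * x) * partial 1 p (\<gamma> x)) < 0"
      using s unfolding sym[OF inb] by blast
  qed
  have nzw: "w x \<noteq> 0" if "x \<in> {0..1}" for x
    using str'(3)[OF that] by (auto simp: w_def complex_eq_iff)
  have n0: "0 \<notin> path_image w" using nzw by (auto simp: path_image_def)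
  have "Re (winding_number w 0) < 0"
  proof (rule winding_number_neg)
    let ?d = "\<lambda>g x. t * (cos (2 * pi * x) * partial 2 g (\<gamma> x) - sin (2 * pi * x) * partial 1 g (\<gamma> x)) * (2 * pi)"
    have "((\<lambda>x. g (\<gamma> x)) has_real_derivative ?d g x) (at x)" if "smooth_on g (ball z r)" for g x
      unfolding \<gamma>_def
      by (rule DERIV_chain2[where f = "\<lambda>a. g (polar z t a)"], rule polar_chain_a)
        (use smooth_on_differentiable[OF that inb[of x, unfolded \<gamma>_def]] in
          \<open>auto intro!: derivative_eq_intros\<close>)
    then show "(w has_vector_derivative Complex (?d p x) (?d q x)) (at x)" for x
      using p q by (simp add: has_vector_derivative_complex_iff w_def has_real_derivative_iff_has_vector_derivative)
    show "continuous_on UNIV (\<lambda>x. Complex (?d p x) (?d q x))"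
      by (intro cC continuous_intros cg)
    fix x :: real assume x: "x \<in> {0..1}"
    have "Im (Complex (?d p x) (?d q x) * cnj (w x)) = 2 * pi * t * (
      p (\<gamma> x) * (cos (2 * pi * x) * partial 2 q (\<gamma> x) - sin (2 * pi * x) * partial 1 q (\<gamma> x))
      - q (\<gamma> x) * (cos (2 * pi * x) * partial 2 p (\<gamma> x) - sin (2 * pi * x) * partial 1 p (\<gamma> x)))"
      by (simp add: w_def algebra_simps)
    also have "\<dots> < 0" using str'(3)[OF x] t by (intro mult_pos_neg) auto
    finally show "Im (Complex (?d p x) (?d q x) * cnj (w x)) < 0" .
  qed
  moreover have "winding_number w 0 \<in> \<int>"
    using loop by (intro integer_winding_number paths n0) (simp add: w_def pathfinish_def pathstart_def)
  then obtain j where j: "winding_number w 0 = of_int j" by (auto elim: Ints_cases)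
  ultimately have j0: "j < 0" by simp
  \<comment> \<open>The circle adds one to the index of \<open>w\<close>; since
    \<open>j \<le> -1\<close>, the result is at most \<open>0\<close>.\<close>
  have eq: "winding_number (\<lambda>x. of_real (m / t) * w x * e x) 0 = of_int (j + 1)"
    "winding_number (\<lambda>x. - \<i> * of_real (m / t) * w x * e x) 0 = of_int (j + 1)"
    unfolding e_def using t m j
    by (subst winding_number_times_circle[OF paths(1) n0]; simp)+
  have e1: "e 1 = e 0" by (simp add: e)
  have "winding_number \<beta> 0 = winding_number (\<lambda>x. of_real (m / t) * w x * e x) 0"
    using str'(2) loop e1
    by (intro winding_number_nearby paths) (auto simp: pathfinish_def pathstart_def \<beta>_def w_def)
  moreover have "winding_number \<beta> 0 = winding_number w1 0"
  proof (rule winding_number_nearby[OF paths(2,3)])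
    fix x :: real assume x: "x \<in> {0..1}"
    have "w1 x - \<beta> x = of_real ((partial 1 p (\<gamma> x) + partial 2 q (\<gamma> x)) / 2)"
      by (simp add: w1_def \<beta>_def complex_eq_iff field_simps)
    then show "norm (w1 x - \<beta> x) < norm (\<beta> x)"
      using str'(1)[OF x] by (simp only: norm_of_real) simp
  qed (use loop in \<open>auto simp: pathfinish_def pathstart_def w1_def \<beta>_def\<close>)
  ultimately have 1: "winding_number w1 0 = of_int (j + 1)" using eq by simp
  have "winding_number (\<lambda>x. - \<i> * \<beta> x) 0 = winding_number (\<lambda>x. - \<i> * of_real (m / t) * w x * e x) 0"
  proof (rule winding_number_nearby[OF paths(5,7)])
    fix x :: real assume x: "x \<in> {0..1}"
    have "- \<i> * of_real (m / t) * w x * e x - - \<i> * \<beta> x = - \<i> * (of_real (m / t) * w x * e x - \<beta> x)"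
      by (simp add: algebra_simps)
    then show "norm (- \<i> * of_real (m / t) * w x * e x - - \<i> * \<beta> x) < norm (- \<i> * \<beta> x)"
      using str'(2)[OF x] by (simp only: norm_mult) simp
  qed (use loop e1 in \<open>auto simp: pathfinish_def pathstart_def w_def \<beta>_def\<close>)
  moreover have "winding_number (\<lambda>x. - \<i> * \<beta> x) 0 = winding_number w2 0"
  proof (rule winding_number_nearby[OF paths(5,4)])
    fix x :: real assume x: "x \<in> {0..1}"
    have "w2 x - - \<i> * \<beta> x = \<i> * of_real ((partial 1 p (\<gamma> x) + partial 2 q (\<gamma> x)) / 2)"
      by (simp add: w2_def \<beta>_def complex_eq_iff field_simps)
    then show "norm (w2 x - - \<i> * \<beta> x) < norm (- \<i> * \<beta> x)"
      using str'(1)[OF x] by (simp only: norm_of_real norm_mult) simp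
  qed (use loop in \<open>auto simp: pathfinish_def pathstart_def w2_def \<beta>_def\<close>)
  ultimately have 2: "winding_number w2 0 = of_int (j + 1)" using eq by simp
  have "field_circle (grad p) z t = w1" "field_circle (grad q) z t = w2"
    by (auto simp: field_circle_eq w1_def w2_def complex_of_vec_def grad_def \<gamma>_def[symmetric] sym[OF inb])
  then show ?thesis using 1 2 j0 by (intro exI[of _ "j + 1"]) auto
qed

lemma constant_on_if_partials_zero:
  fixes u :: "real^2 \<Rightarrow> real"
  assumes S: "open S" "connected S" and u: "smooth_on u S"
    and zero: "\<And>x. x \<in> S \<Longrightarrow> partial 1 u x = 0" "\<And>x. x \<in> S \<Longrightarrow> partial 2 u x = 0"
  shows "u constant_on S"
proof -
  have "(u has_derivative (\<lambda>_. 0)) (at x)" if x: "x \<in> S" for x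
  proof -
    have d: "u differentiable (at x)" using smooth_on_differentiable[OF u x] .
    have "frechet_derivative u (at x) = (\<lambda>_. 0)"
      by (rule ext) (simp add: frechet_derivative_real2[OF d] zero[OF x])
    then show ?thesis using d frechet_derivative_works by metis
  qed
  then have "u x = u y" if "x \<in> S" "y \<in> S" for x y
    using has_derivative_zero_unique_connected[OF S _ that(1), of u] that by metis
  then show ?thesis unfolding constant_on_def by metis
qed

theorem theorem3p1:
  fixes \<Omega> :: "(real^2) set"
    and a11 a12 a22 b1 b2 u :: "real^2 \<Rightarrow> real"
    and l1 l2 :: real
    and p0 :: "real^2"
  assumes "open \<Omega>" and "connected \<Omega>"
    and "\<forall>f\<in>{a11, a12, a22, b1, b2}. bounded (f ` \<Omega>) \<and> f \<in> borel_measurable (lebesgue_on \<Omega>)"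
    and "0 < l1" and "l1 \<le> l2"
    and "\<forall>x\<in>\<Omega>. \<forall>\<xi>::real^2.
           l1 * (norm \<xi>)\<^sup>2 \<le> a11 x * (\<xi> $ 1)\<^sup>2 + 2 * a12 x * \<xi> $ 1 * \<xi> $ 2 + a22 x * (\<xi> $ 2)\<^sup>2 \<and>
           a11 x * (\<xi> $ 1)\<^sup>2 + 2 * a12 x * \<xi> $ 1 * \<xi> $ 2 + a22 x * (\<xi> $ 2)\<^sup>2 \<le> l2 * (norm \<xi>)\<^sup>2"
    and "smooth_on u \<Omega>"
    and "\<not> u constant_on \<Omega>"
    and "\<forall>x\<in>\<Omega>. a11 x * partial 1 (partial 1 u) x + 2 * a12 x * partial 2 (partial 1 u) x
               + a22 x * partial 2 (partial 2 u) x + b1 x * partial 1 u x + b2 x * partial 2 u x = 0"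
    and "p0 \<in> \<Omega>" and "grad u p0 = 0"
  shows "\<exists>R>0. ball p0 R - {p0} \<subseteq> \<Omega> \<and>
           (\<forall>x\<in>ball p0 R - {p0}. det (hessian u x) < 0) \<and>
           (\<exists>k::int. has_index (grad (partial 1 u)) p0 k \<and> has_index (grad (partial 2 u)) p0 k \<and> k \<le> 0)"
proof -
  note \<Omega> = \<open>open \<Omega>\<close> \<open>connected \<Omega>\<close> \<open>p0 \<in> \<Omega>\<close> and u = \<open>smooth_on u \<Omega>\<close>
  define p q where "p = partial 1 u" and "q = partial 2 u"
  have p: "smooth_on p \<Omega>" and q: "smooth_on q \<Omega>"
    unfolding p_def q_def by (intro smooth_on_partial u)+
  have sym: "partial 1 q x = partial 2 p x" if "x \<in> \<Omega>" for x
    unfolding p_def q_def by (rule partial_commute[OF \<Omega>(1) u that])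
  obtain K C where K: "0 < K" and C: "0 \<le> C" and
    quasi: "\<And>x. x \<in> \<Omega> \<Longrightarrow> (partial 1 p x)\<^sup>2 + (partial 2 p x)\<^sup>2 + (partial 1 q x)\<^sup>2 + (partial 2 q x)\<^sup>2
      \<le> K * (partial 2 p x * partial 1 q x - partial 1 p x * partial 2 q x) + C * ((p x)\<^sup>2 + (q x)\<^sup>2)"
    using pde_quasi[OF \<Omega>(1) u assms(4,5) _ _ assms(6,9)] assms(3) unfolding p_def q_def by auto
  have nz: "\<exists>x\<in>\<Omega>. p x \<noteq> 0 \<or> q x \<noteq> 0"
    using constant_on_if_partials_zero[OF \<Omega>(1,2) u] assms(8) unfolding p_def q_def by blast
  have z: "p p0 = 0" "q p0 = 0"
    using \<open>grad u p0 = 0\<close> by (auto simp: p_def q_def grad_def vec_eq_iff forall_2)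
  obtain r m where r: "0 < r" "cball p0 r \<subseteq> \<Omega>" and m: "0 < m" and str: "\<And>t a. 0 < t \<Longrightarrow> t \<le> r \<Longrightarrow> a \<in> {0..2*pi} \<Longrightarrow>
    nearly_homogeneous K m p q p0 t a"
    using structure_near_zero[OF \<Omega> p q K C quasi nz z] by blast
  have b: "ball p0 r \<subseteq> \<Omega>" using r(2) ball_subset_cball by blast
  note pb = smooth_on_subset[OF p b] and qb = smooth_on_subset[OF q b]
  have det: "0 < partial 2 p x * partial 1 q x - partial 1 p x * partial 2 q x" if x: "x \<in> ball p0 r - {p0}" for x
  proof -
    obtain t a where ta: "x = polar p0 t a" "t = dist p0 x" "0 \<le> a" "a \<le> 2 * pi" by (rule polar_surj)
    have "0 < t" "t \<le> r" using x ta(2) by auto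
    then have "0 < 2 * K * (partial 2 p x * partial 1 q x - partial 1 p x * partial 2 q x)"
      using str[of t a] ta(3,4) unfolding nearly_homogeneous_def Let_def ta(1)[symmetric] by force
    then show ?thesis using K by (simp add: zero_less_mult_iff)
  qed
  \<comment> \<open>The index is read off on this one circle; \<open>has_indexI\<close> extends it
    to all smaller and larger ones in the disk.\<close>
  have "0 < r / 2" "r / 2 < r" using r by auto
  obtain k where k: "k \<le> 0" "winding_number (field_circle (grad p) p0 (r / 2)) 0 = of_int k"
    "winding_number (field_circle (grad q) p0 (r / 2)) 0 = of_int k"
    using winding_gradients[OF pb qb \<open>0 < r / 2\<close> \<open>r / 2 < r\<close> K m sym[OF subsetD[OF b]] str] r(1)
    by auto
  have cont: "continuous_on (ball p0 r - {p0}) (grad g)" if "smooth_on g (ball p0 r)" for g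
    unfolding grad_def
    by (intro continuous_on_vec_lambda continuous_on_subset[OF smooth_on_continuous[OF smooth_on_partial[OF that]]]) auto
  have nzg: "grad p x \<noteq> 0" "grad q x \<noteq> 0" if "x \<in> ball p0 r - {p0}" for x
    using det[OF that] by (auto simp: grad_def vec_eq_iff forall_2)
  have "has_index (grad p) p0 k" "has_index (grad q) p0 k"
    using has_indexI[OF r(1) cont[OF pb] nzg(1) \<open>0 < r / 2\<close> \<open>r / 2 < r\<close> k(2)]
      has_indexI[OF r(1) cont[OF qb] nzg(2) \<open>0 < r / 2\<close> \<open>r / 2 < r\<close> k(3)] by auto
  moreover have "det (hessian u x) < 0" if "x \<in> ball p0 r - {p0}" for x
    using det[OF that] by (simp add: det_2 hessian_def p_def q_def mult.commute)
  ultimately show ?thesis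
    using r(1) b k(1) unfolding p_def q_def by blast
qed

end
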